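(* Fix an integer $I\ge 0$ and $\beta>0$. For each $n\ge 1$ let $\Gamma^n=\{\Gamma^n(x),\,0\le x\le\beta\}$ be the random occupancy process described in the context, and suppose that the initial conditions $\Gamma^n(0)$ are deterministic and converge to some $\alpha\in S_I$ as $n\to\infty$. Then $\{\Gamma^n\}$ satisfies the large deviation principle on $D([0,\beta]:\mathbb{R}^{I+2})$ (with the Skorokhod topology) with rate function $J$: for every measurable set $A$ of trajectories, $$\liminf_{n\to\infty}\frac1n\log P\{\Gamma^n\in A\}\ \ge\ -\inf\{J(\gamma):\gamma\in A^\circ,\ \gamma(0)=\alpha\},$$ $$\limsup_{n\to\infty}\frac1n\log P\{\Gamma^n\in A\}\ \le\ -\inf\{J(\gamma):\gamma\in \bar A,\ \gamma(0)=\alpha\},$$ where $A^\circ$ and $\bar A$ denote interior and closure; moreover, for every compact $K\subset S_I$ and every $C<\infty$, the set $\{\gamma: J(\gamma)\le C,\ \gamma(0)\in K\}$ is compact.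
   Context: $S_I=\{\gamma\in\mathbb{R}^{I+2}:\gamma_j\ge 0,\ \sum_{j=0}^{I+1}\gamma_j=1\}$; components are indexed $0,1,\dots,I,I+$ (the last one, also written with index $I+1$). Occupancy process: there are $n$ cells; balls are thrown one at a time, each independently into a uniformly chosen cell; $\Gamma^n_i(x)$ ($0\le i\le I$) is $1/n$ times the number of cells containing exactly $i$ balls and $\Gamma^n_{I+}(x)$ is $1/n$ times the number containing more than $I$ balls after $\lfloor nx\rfloor$ balls have been thrown (in addition to the initial configuration), so $\Gamma^n$ is constant on intervals $[i/n,(i+1)/n)$. Equivalently $\Gamma^n((i+1)/n)=\Gamma^n(i/n)+\frac1n b_i(\Gamma^n(i/n))$ where, given $\gamma\in S_I$, $b_i(\gamma)$ are i.i.d. with $P\{b_i(\gamma)=e_{j+1}-e_j\}=\gamma_j$ for $0\le j\le I$ and $P\{b_i(\gamma)=0\}=\gamma_{I+1}$ ($e_j$ the unit vectors of $\mathbb{R}^{I+2}$). Occupancy functions: a measurable $\theta:[0,\beta]\to S_I$ (occupancy rates) together with $\gamma(0)$ determines $\gamma$ by $\dot\gamma_0=-\theta_0$, $\dot\gamma_j=\theta_{j-1}-\theta_j$ ($1\le j\le I$), $\dot\gamma_{I+}=\theta_I$. Conversely, for absolutely continuous $\gamma$ the rates are determined by these equations and $\sum_j\theta_j=1$. $\gamma$ is a valid occupancy function if it is absolutely continuous, $\gamma(x)\in S_I$ for all $x\in[0,\beta]$, and its rate $\theta(x)\in S_I$ for a.e. $x$. For $\theta,\gamma\in S_I$, $D(\theta\|\gamma)=\sum_{i=0}^{I+1}\theta_i\log(\theta_i/\gamma_i)$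 with $0\log(0/\cdot)=0$ and $\theta_i\log(\theta_i/0)=\infty$ if $\theta_i>0$. For valid $\gamma$ with rates $\theta$, $J(\gamma)=\int_0^\beta D(\theta(x)\|\gamma(x))\,dx$; $J(\gamma)=\infty$ otherwise. *)

theory Defs
  imports "HOL-Analysis.Analysis" "HOL-Probability.Probability"
begin

text \<open>Vectors of R^(I+2) with components 0..I+1 are represented as functions
  nat => real that vanish at indices > I+1. Trajectories on [0,beta] are functions
  real => (nat => real), extended constantly outside [0,beta].\<close>

definition occ_simplex :: "nat \<Rightarrow> (nat \<Rightarrow> real) set" where
  "occ_simplex I = {g. (\<forall>j. 0 \<le> g j) \<and> (\<forall>j>I+1. g j = 0) \<and> (\<Sum>j\<le>I+1. g j) = 1}"

definition Dsp :: "nat \<Rightarrow> real \<Rightarrow> (real \<Rightarrow> nat \<Rightarrow> real) set" where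
  "Dsp I \<beta> = {g. (\<forall>t j. j > I+1 \<longrightarrow> g t j = 0)
      \<and> (\<forall>t<0. g t = g 0) \<and> (\<forall>t>\<beta>. g t = g \<beta>)
      \<and> (\<forall>t\<in>{0..<\<beta>}. (g \<longlongrightarrow> g t) (at_right t))
      \<and> (\<forall>t\<in>{0<..\<beta>}. \<exists>l. (g \<longlongrightarrow> l) (at_left t))}"

definition time_changes :: "real \<Rightarrow> (real \<Rightarrow> real) set" where
  "time_changes \<beta> = {tc. continuous_on {0..\<beta>} tc \<and> strict_mono_on {0..\<beta>} tc
      \<and> tc 0 = 0 \<and> tc \<beta> = \<beta>}"

definition skor_dist :: "nat \<Rightarrow> real \<Rightarrow> (real \<Rightarrow> nat \<Rightarrow> real) \<Rightarrow> (real \<Rightarrow> nat \<Rightarrow> real) \<Rightarrow> real" where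
  "skor_dist I \<beta> f g = Inf {e. \<exists>tc\<in>time_changes \<beta>. \<forall>t\<in>{0..\<beta>}.
      \<bar>tc t - t\<bar> \<le> e \<and> (\<forall>j\<le>I+1. \<bar>f t j - g (tc t) j\<bar> \<le> e)}"

definition skor_open :: "nat \<Rightarrow> real \<Rightarrow> (real \<Rightarrow> nat \<Rightarrow> real) set \<Rightarrow> bool" where
  "skor_open I \<beta> U \<longleftrightarrow> U \<subseteq> Dsp I \<beta> \<and>
     (\<forall>f\<in>U. \<exists>e>0. \<forall>g\<in>Dsp I \<beta>. skor_dist I \<beta> f g < e \<longrightarrow> g \<in> U)"

definition skor_interior :: "nat \<Rightarrow> real \<Rightarrow> (real \<Rightarrow> nat \<Rightarrow> real) set \<Rightarrow> (real \<Rightarrow> nat \<Rightarrow> real) set" where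
  "skor_interior I \<beta> A = \<Union>{U. skor_open I \<beta> U \<and> U \<subseteq> A}"

definition skor_closure :: "nat \<Rightarrow> real \<Rightarrow> (real \<Rightarrow> nat \<Rightarrow> real) set \<Rightarrow> (real \<Rightarrow> nat \<Rightarrow> real) set" where
  "skor_closure I \<beta> A = Dsp I \<beta> - skor_interior I \<beta> (Dsp I \<beta> - A)"

definition skor_compact :: "nat \<Rightarrow> real \<Rightarrow> (real \<Rightarrow> nat \<Rightarrow> real) set \<Rightarrow> bool" where
  "skor_compact I \<beta> S \<longleftrightarrow> S \<subseteq> Dsp I \<beta> \<and>
     (\<forall>\<U>. (\<forall>U\<in>\<U>. skor_open I \<beta> U) \<and> S \<subseteq> \<Union>\<U> \<longrightarrow>
        (\<exists>\<F>\<subseteq>\<U>. finite \<F> \<and> S \<subseteq> \<Union>\<F>))"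

definition skor_borel :: "nat \<Rightarrow> real \<Rightarrow> (real \<Rightarrow> nat \<Rightarrow> real) set set" where
  "skor_borel I \<beta> = sigma_sets (Dsp I \<beta>) {U. skor_open I \<beta> U}"

definition occ_choice :: "nat \<Rightarrow> (nat \<Rightarrow> real) \<Rightarrow> nat pmf" where
  "occ_choice I g = embed_pmf (\<lambda>j. if j \<le> I+1 then g j else 0)"

definition occ_incr :: "nat \<Rightarrow> nat \<Rightarrow> nat \<Rightarrow> (nat \<Rightarrow> real)" where
  "occ_incr I n j = (\<lambda>i. if j \<le> I then (if i = j+1 then 1 / real n else if i = j then - 1 / real n else 0) else 0)"

definition occ_step :: "nat \<Rightarrow> nat \<Rightarrow> (nat \<Rightarrow> real) \<Rightarrow> (nat \<Rightarrow> real) pmf" where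
  "occ_step I n g = map_pmf (\<lambda>j i. g i + occ_incr I n j i) (occ_choice I g)"

primrec occ_states :: "nat \<Rightarrow> nat \<Rightarrow> (nat \<Rightarrow> real) \<Rightarrow> nat \<Rightarrow> (nat \<Rightarrow> real) list pmf" where
  "occ_states I n g0 0 = return_pmf [g0]"
| "occ_states I n g0 (Suc k) =
     bind_pmf (occ_states I n g0 k) (\<lambda>xs. map_pmf (\<lambda>y. xs @ [y]) (occ_step I n (last xs)))"

definition occ_path :: "real \<Rightarrow> nat \<Rightarrow> (nat \<Rightarrow> real) list \<Rightarrow> real \<Rightarrow> nat \<Rightarrow> real" where
  "occ_path \<beta> n xs = (\<lambda>x. xs ! nat \<lfloor>real n * max 0 (min \<beta> x)\<rfloor>)"

definition occ_law :: "nat \<Rightarrow> real \<Rightarrow> nat \<Rightarrow> (nat \<Rightarrow> real) \<Rightarrow> (real \<Rightarrow> nat \<Rightarrow> real) pmf" where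
  "occ_law I \<beta> n g0 = map_pmf (occ_path \<beta> n) (occ_states I n g0 (nat \<lfloor>real n * \<beta>\<rfloor>))"

definition occ_prob :: "nat \<Rightarrow> real \<Rightarrow> nat \<Rightarrow> (nat \<Rightarrow> real) \<Rightarrow> (real \<Rightarrow> nat \<Rightarrow> real) set \<Rightarrow> real" where
  "occ_prob I \<beta> n g0 A = measure_pmf.prob (occ_law I \<beta> n g0) A"

definition abs_cont_on :: "real \<Rightarrow> real \<Rightarrow> (real \<Rightarrow> real) \<Rightarrow> bool" where
  "abs_cont_on a b f \<longleftrightarrow> (\<forall>\<epsilon>>0. \<exists>\<delta>>0. \<forall>(m::nat) (u::nat \<Rightarrow> real) v.
      (\<forall>k<m. a \<le> u k \<and> u k \<le> v k \<and> v k \<le> b) \<and>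
      (\<forall>k<m. \<forall>l<m. k \<noteq> l \<longrightarrow> v k \<le> u l \<or> v l \<le> u k) \<and>
      (\<Sum>k<m. v k - u k) < \<delta> \<longrightarrow> (\<Sum>k<m. \<bar>f (v k) - f (u k)\<bar>) < \<epsilon>)"

text \<open>Occupancy rates determined by gamma: theta_0 = -gamma_0', theta_j = theta_(j-1) - gamma_j'
  (1 <= j <= I), and theta_(I+1) = 1 - sum_(j<=I) theta_j.\<close>
definition occ_rate :: "nat \<Rightarrow> (real \<Rightarrow> nat \<Rightarrow> real) \<Rightarrow> real \<Rightarrow> nat \<Rightarrow> real" where
  "occ_rate I g x = (let th = (\<lambda>j. - (\<Sum>k\<le>j. deriv (\<lambda>y. g y k) x)) in
      (\<lambda>j. if j \<le> I then th j else if j = I+1 then 1 - (\<Sum>i\<le>I. th i) else 0))"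

definition valid_occ :: "nat \<Rightarrow> real \<Rightarrow> (real \<Rightarrow> nat \<Rightarrow> real) \<Rightarrow> bool" where
  "valid_occ I \<beta> g \<longleftrightarrow> g \<in> Dsp I \<beta>
     \<and> (\<forall>j\<le>I+1. abs_cont_on 0 \<beta> (\<lambda>x. g x j))
     \<and> (\<forall>x\<in>{0..\<beta>}. g x \<in> occ_simplex I)
     \<and> (AE x in lborel. x \<in> {0..\<beta>} \<longrightarrow> occ_rate I g x \<in> occ_simplex I)"

definition rel_entropy :: "nat \<Rightarrow> (nat \<Rightarrow> real) \<Rightarrow> (nat \<Rightarrow> real) \<Rightarrow> ereal" where
  "rel_entropy I th g = (if \<exists>i\<le>I+1. th i > 0 \<and> g i = 0 then \<infinity>
      else ereal (\<Sum>i\<le>I+1. if th i = 0 then 0 else th i * ln (th i / g i)))"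

definition occ_J :: "nat \<Rightarrow> real \<Rightarrow> (real \<Rightarrow> nat \<Rightarrow> real) \<Rightarrow> ereal" where
  "occ_J I \<beta> g = (if valid_occ I \<beta> g then
      enn2ereal (\<integral>\<^sup>+ x. indicator {0..\<beta>} x * e2ennreal (rel_entropy I (occ_rate I g x) (g x)) \<partial>lborel)
    else \<infinity>)"

definition elog :: "real \<Rightarrow> ereal" where
  "elog p = (if p = 0 then - \<infinity> else ereal (ln p))"

end

theory Submission
  imports Defs "HOL-Real_Asymp.Real_Asymp"
begin

text \<open>An absolutely continuous function is the integral of its derivative, so the paths of finite cost
  are exactly the simplex-valued paths whose cumulative flows are nondecreasing with total speed one. They
  form a compact set in the topology of pointwise convergence, on which uniform neighbourhoods
  contain pointwise ones; this reduces everything to local estimates on uniform balls. The entropy is a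
  supremum of affine functionals (Gibbs' inequality), so \<open>J\<close> is bounded below, up to \<open>O(1/N)\<close>, by a cost
  on a grid of \<open>N\<close> blocks that is continuous in the path, and by Fatou's lemma these costs recover \<open>J\<close>
  in the limit; this gives the closed level sets.
  The local upper bound is an exponential Chebyshev estimate whose exponents are constant on each block.
  For the local lower bound the path is mixed with a linear path that charges every reachable level,
  which keeps all relevant components positive after a short time \<open>\<tau>\<close>. Up to \<open>\<tau>\<close> the balls are thrown
  level by level, at a cost of order \<open>\<tau> log (1/\<tau>)\<close>; afterwards, multinomial coefficients bound
  the probability of hitting prescribed occupancy counts at the ends of the blocks.\<close>

section \<open>Absolutely continuous functions are indefinite integrals\<close>

text \<open>The rates are defined through \<open>deriv\<close> almost everywhere, a condition that
  pointwise limits do not preserve. The fundamental theorem of calculus trades it for nonnegativity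
  of the flows over all intervals, where each single condition involves finitely many values of the
  path; hence compactness. A Skorokhod-open set contains a uniform ball around each of its points,
  and this is how the topology enters all three claims. Exponential tightness is automatic, since
  all sample paths lie in one compact set. The obstacle throughout is the logarithm at the boundary
  of the simplex: the initial state may have empty levels, levels below the lowest occupied one stay
  empty along every admissible path, and a path of finite cost may touch zero later. Gibbs
  functionals with fixed positive multipliers avoid this singularity. They are linear in rate and
  occupancy, so they integrate over a block to an expression in flows and grid values, and their
  linearity also stands in for convexity of the entropy when a path is mixed with the linear
  one.\<close>

definition nonoverlapping :: "real \<Rightarrow> real \<Rightarrow> (real \<times> real) set \<Rightarrow> bool" where
  "nonoverlapping a b F \<longleftrightarrow> finite F \<and> (\<forall>p\<in>F. a \<le> fst p \<and> fst p < snd p \<and> snd p \<le> b)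
     \<and> (\<forall>p\<in>F. \<forall>q\<in>F. p \<noteq> q \<longrightarrow> snd p \<le> fst q \<or> snd q \<le> fst p)"

text \<open>The increments are signed, so that cutting an interval in two leaves the sum unchanged.
  Large sums still see only the positive variation, because a family may leave out the intervals on
  which \<open>f\<close> decreases.\<close>

definition increment_sum :: "(real \<Rightarrow> real) \<Rightarrow> (real \<times> real) set \<Rightarrow> real" where
  "increment_sum f F = (\<Sum>p\<in>F. f (snd p) - f (fst p))"

lemma nonoverlapping_empty [simp]: "nonoverlapping a b {}"
  by (simp add: nonoverlapping_def)

lemma nonoverlapping_mono: "nonoverlapping a b F \<Longrightarrow> a' \<le> a \<Longrightarrow> b \<le> b' \<Longrightarrow> nonoverlapping a' b' F"
  unfolding nonoverlapping_def by (meson order_trans)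

text \<open>Refinement of a family: each interval is replaced by a family of its own inside it. It
  serves to pass from increments of the variation function to increments of
  \<open>f\<close>.\<close>

lemma increment_sum_UN:
  assumes "nonoverlapping a b F" and G: "\<And>p. p \<in> F \<Longrightarrow> nonoverlapping (fst p) (snd p) (G p)"
  shows "nonoverlapping a b (\<Union>p\<in>F. G p)"
    and "increment_sum f (\<Union>p\<in>F. G p) = (\<Sum>p\<in>F. increment_sum f (G p))"
proof -
  have F: "finite F" using assms by (simp add: nonoverlapping_def)
  have sep: "snd r \<le> fst s \<or> snd s \<le> fst r" 
    if "p \<in> F" "q \<in> F" "p \<noteq> q" "r \<in> G p" "s \<in> G q" for p q r s
  proof -
    have "snd p \<le> fst q \<or> snd q \<le> fst p" using assms(1) that by (auto simp: nonoverlapping_def)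
    moreover have "fst p \<le> fst r" "snd r \<le> snd p" "fst q \<le> fst s" "snd s \<le> snd q"
      using G[OF that(1)] G[OF that(2)] that by (auto simp: nonoverlapping_def)
    ultimately show ?thesis by linarith
  qed
  have fin: "finite (G p)" if "p \<in> F" for p using G[OF that] by (simp add: nonoverlapping_def)
  have lt: "fst r < snd r" if "p \<in> F" "r \<in> G p" for p r 
    using G[OF that(1)] that by (auto simp: nonoverlapping_def)
  show "nonoverlapping a b (\<Union>p\<in>F. G p)"
    unfolding nonoverlapping_def
  proof (intro conjI ballI impI)
    show "finite (\<Union>p\<in>F. G p)" using F fin by auto
  next
    fix r assume "r \<in> (\<Union>p\<in>F. G p)"
    then obtain p where p: "p \<in> F" "r \<in> G p" by auto
    with assms(1) G[OF p(1)] show "a \<le> fst r" "fst r < snd r" "snd r \<le> b"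
      unfolding nonoverlapping_def by (meson order_trans)+
  next
    fix r s assume "r \<in> (\<Union>p\<in>F. G p)" "s \<in> (\<Union>p\<in>F. G p)" "r \<noteq> s"
    then obtain p q where p: "p \<in> F" "r \<in> G p" and q: "q \<in> F" "s \<in> G q" by auto
    show "snd r \<le> fst s \<or> snd s \<le> fst r"
    proof (cases "p = q")
      case True
      with G[OF p(1)] p q \<open>r \<noteq> s\<close> show ?thesis by (auto simp: nonoverlapping_def)
    next
      case False
      with sep p q show ?thesis by blast
    qed
  qed
  show "increment_sum f (\<Union>p\<in>F. G p) = (\<Sum>p\<in>F. increment_sum f (G p))"
    unfolding increment_sum_def
  proof (rule sum.UNION_disjoint)
    show "\<forall>i\<in>F. \<forall>j\<in>F. i \<noteq> j \<longrightarrow> G i \<inter> G j = {}"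
    proof (intro ballI impI)
      fix i j assume ij: "i \<in> F" "j \<in> F" "i \<noteq> j"
      show "G i \<inter> G j = {}"
      proof (rule ccontr)
        assume "G i \<inter> G j \<noteq> {}"
        then obtain r where r: "r \<in> G i" "r \<in> G j" by auto
        have "snd r \<le> fst r \<or> snd r \<le> fst r" using sep[OF ij r] .
        with lt[OF ij(1) r(1)] show False by auto
      qed
    qed
  qed (use F fin in auto)
qed

lemma increment_sum_Un:
  assumes "nonoverlapping a b F" "nonoverlapping b c G" "a \<le> b" "b \<le> c"
  shows "nonoverlapping a c (F \<union> G)" and "increment_sum f (F \<union> G) = increment_sum f F + increment_sum f G"
proof -
  have *: "snd p \<le> fst q" if "p \<in> F" "q \<in> G" for p q
    using assms that unfolding nonoverlapping_def by (meson order_trans)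
  have lt: "fst p < snd p" if "p \<in> F \<union> G" for p
    using assms that unfolding nonoverlapping_def by auto
  have "F \<inter> G = {}" using * lt by fastforce
  moreover have "finite F" "finite G" using assms by (auto simp: nonoverlapping_def)
  ultimately show "increment_sum f (F \<union> G) = increment_sum f F + increment_sum f G"
    unfolding increment_sum_def by (intro sum.union_disjoint)
  have "nonoverlapping a c F" "nonoverlapping a c G"
    using assms nonoverlapping_mono[OF assms(1), of a c] nonoverlapping_mono[OF assms(2), of a c] by auto
  with * show "nonoverlapping a c (F \<union> G)"
    unfolding nonoverlapping_def by (metis Un_iff finite_Un)
qed

text \<open>Both endpoints of every interval are clamped to the left part by \<open>min\<close> and
  to the right part by \<open>max\<close>; the two clamped increments add up to the original one.
  Intervals that become degenerate contribute zero and are dropped.\<close>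

lemma nonoverlapping_split:
  assumes "nonoverlapping a b F" "a \<le> c" "c \<le> b"
  obtains F1 F2 where "nonoverlapping a c F1" "nonoverlapping c b F2"
    "increment_sum f F = increment_sum f F1 + increment_sum f F2"
proof -
  have fin: "finite F" and ord: "\<And>p. p \<in> F \<Longrightarrow> a \<le> fst p \<and> fst p < snd p \<and> snd p \<le> b"
    and disj: "\<And>p q. p \<in> F \<Longrightarrow> q \<in> F \<Longrightarrow> p \<noteq> q \<Longrightarrow> snd p \<le> fst q \<or> snd q \<le> fst p"
    using assms(1) by (auto simp: nonoverlapping_def)
  define l where "l p = (min (fst p) c, min (snd p) c)" for p :: "real \<times> real"
  define r where "r p = (max (fst p) c, max (snd p) c)" for p :: "real \<times> real"
  define A where "A = {p\<in>F. fst p < c}"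
  define B where "B = {p\<in>F. c < snd p}"
  have injA: "inj_on l A"
  proof (rule inj_onI, rule ccontr)
    fix p q assume "p \<in> A" "q \<in> A" "l p = l q" "p \<noteq> q"
    then show False using disj[of p q] ord[of p] ord[of q] by (auto simp: A_def l_def min_def split: if_splits)
  qed
  have injB: "inj_on r B"
  proof (rule inj_onI, rule ccontr)
    fix p q assume "p \<in> B" "q \<in> B" "r p = r q" "p \<noteq> q"
    then show False using disj[of p q] ord[of p] ord[of q] by (auto simp: B_def r_def max_def split: if_splits)
  qed
  show ?thesis
  proof
    show "nonoverlapping a c (l ` A)"
      unfolding nonoverlapping_def
    proof (intro conjI ballI impI)
      show "finite (l ` A)" using fin by (auto simp: A_def)
    next
      fix p assume "p \<in> l ` A"
      then obtain q where q: "q \<in> A" "p = l q" by auto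
      show "a \<le> fst p" "fst p < snd p" "snd p \<le> c"
        using q ord[of q] assms by (auto simp: A_def l_def)
    next
      fix p p' assume pp: "p \<in> l ` A" "p' \<in> l ` A" "p \<noteq> p'"
      then obtain q q' where q: "q \<in> A" "p = l q" "q' \<in> A" "p' = l q'" by auto
      with pp have "q \<noteq> q'" by auto
      then have "snd q \<le> fst q' \<or> snd q' \<le> fst q" using disj[of q q'] q by (auto simp: A_def)
      then show "snd p \<le> fst p' \<or> snd p' \<le> fst p"
        using q by (auto simp: A_def l_def min_def)
    qed
    show "nonoverlapping c b (r ` B)"
      unfolding nonoverlapping_def
    proof (intro conjI ballI impI)
      show "finite (r ` B)" using fin by (auto simp: B_def)
    next
      fix p assume "p \<in> r ` B"
      then obtain q where q: "q \<in> B" "p = r q" by auto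
      show "c \<le> fst p" "fst p < snd p" "snd p \<le> b"
        using q ord[of q] assms by (auto simp: B_def r_def)
    next
      fix p p' assume pp: "p \<in> r ` B" "p' \<in> r ` B" "p \<noteq> p'"
      then obtain q q' where q: "q \<in> B" "p = r q" "q' \<in> B" "p' = r q'" by auto
      with pp have "q \<noteq> q'" by auto
      then have "snd q \<le> fst q' \<or> snd q' \<le> fst q" using disj[of q q'] q by (auto simp: B_def)
      then show "snd p \<le> fst p' \<or> snd p' \<le> fst p"
        using q by (auto simp: B_def r_def max_def)
    qed
    have "f (min (snd p) c) - f (min (fst p) c) = 0" if "p \<in> F - A" for p
    proof -
      have "c \<le> fst p" "c \<le> snd p" using that ord[of p] by (auto simp: A_def)
      then show ?thesis by (simp add: min_absorb2)
    qed
    then have 1: "increment_sum f (l ` A) = (\<Sum>p\<in>F. f (min (snd p) c) - f (min (fst p) c))"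
      unfolding increment_sum_def sum.reindex[OF injA]
      by (intro sum.mono_neutral_cong_left) (use fin in \<open>auto simp: A_def l_def\<close>)
    have "f (max (snd p) c) - f (max (fst p) c) = 0" if "p \<in> F - B" for p
    proof -
      have "fst p \<le> c" "snd p \<le> c" using that ord[of p] by (auto simp: B_def)
      then show ?thesis by (simp add: max_absorb2)
    qed
    then have 2: "increment_sum f (r ` B) = (\<Sum>p\<in>F. f (max (snd p) c) - f (max (fst p) c))"
      unfolding increment_sum_def sum.reindex[OF injB]
      by (intro sum.mono_neutral_cong_left) (use fin in \<open>auto simp: B_def r_def\<close>)
    show "increment_sum f F = increment_sum f (l ` A) + increment_sum f (r ` B)"
      unfolding 1 2 sum.distrib[symmetric] unfolding increment_sum_def
      by (rule sum.cong) (auto simp: min_def max_def)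
  qed
qed

text \<open>The open intervals are disjoint, so their total length is the Lebesgue measure of a
  subset of \<open>{a..b}\<close>.\<close>

lemma nonoverlapping_length_le:
  assumes "nonoverlapping a b F" "a \<le> b"
  shows "increment_sum (\<lambda>x. x) F \<le> b - a"
proof -
  have fin: "finite F" and ord: "\<And>p. p \<in> F \<Longrightarrow> a \<le> fst p \<and> fst p < snd p \<and> snd p \<le> b"
    and disj: "\<And>p q. p \<in> F \<Longrightarrow> q \<in> F \<Longrightarrow> p \<noteq> q \<Longrightarrow> snd p \<le> fst q \<or> snd q \<le> fst p"
    using assms(1) by (auto simp: nonoverlapping_def)
  have "increment_sum (\<lambda>x. x) F = (\<Sum>p\<in>F. measure lborel {fst p<..<snd p})"
    unfolding increment_sum_def using ord by (intro sum.cong) (auto dest: ord less_imp_le)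
  also have "\<dots> = measure lborel (\<Union>p\<in>F. {fst p<..<snd p})"
  proof (rule measure_finite_Union[symmetric])
    show "disjoint_family_on (\<lambda>p. {fst p<..<snd p}) F"
      using disj unfolding disjoint_family_on_def by fastforce
    show "emeasure lborel {fst p<..<snd p} \<noteq> \<infinity>" if "p \<in> F" for p
      using ord[OF that] by (simp add: emeasure_lborel_Ioo)
  qed (use fin in auto)
  also have "\<dots> \<le> measure lborel {a..b}"
  proof (rule measure_mono_fmeasurable)
    show "(\<Union>p\<in>F. {fst p<..<snd p}) \<subseteq> {a..b}" using ord by fastforce
    show "{a..b} \<in> fmeasurable lborel" using fmeasurable_cbox[of a b] by simp
    show "(\<Union>p\<in>F. {fst p<..<snd p}) \<in> sets lborel" using fin by (intro sets.finite_UN) auto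
  qed
  also have "\<dots> = b - a" using assms by simp
  finally show ?thesis .
qed

definition pos_variation :: "(real \<Rightarrow> real) \<Rightarrow> real \<Rightarrow> real \<Rightarrow> real" where
  "pos_variation f a x = Sup (increment_sum f ` {F. nonoverlapping a x F})"

lemma abs_cont_on_nonoverlapping:
  assumes "abs_cont_on a b f" "e > 0"
  obtains d where "d > 0" "\<And>F. nonoverlapping a b F \<Longrightarrow> increment_sum (\<lambda>x. x) F < d \<Longrightarrow> \<bar>increment_sum f F\<bar> < e"
proof -
  from assms obtain d where d: "d > 0" "\<And>(m::nat) (u::nat \<Rightarrow> real) v.
      (\<forall>k<m. a \<le> u k \<and> u k \<le> v k \<and> v k \<le> b) \<and>
      (\<forall>k<m. \<forall>l<m. k \<noteq> l \<longrightarrow> v k \<le> u l \<or> v l \<le> u k) \<and>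
      (\<Sum>k<m. v k - u k) < d \<Longrightarrow> (\<Sum>k<m. \<bar>f (v k) - f (u k)\<bar>) < e"
    unfolding abs_cont_on_def by blast
  show ?thesis
  proof (rule that[OF d(1)])
    fix F assume F: "nonoverlapping a b F" "increment_sum (\<lambda>x. x) F < d"
    then have "finite F" by (simp add: nonoverlapping_def)
    then obtain h where h: "bij_betw h {..<card F} F" 
      using ex_bij_betw_nat_finite atLeast0LessThan by metis
    have hF: "h k \<in> F" if "k < card F" for k using h that by (auto simp: bij_betw_def)
    have inj: "h k \<noteq> h l" if "k < card F" "l < card F" "k \<noteq> l" for k l
      using h that by (auto simp: bij_betw_def inj_on_def)
    have "(\<Sum>k<card F. \<bar>f (snd (h k)) - f (fst (h k))\<bar>) < e"
    proof (rule d(2), intro conjI allI impI)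
      fix k assume "k < card F"
      then show "a \<le> fst (h k)" "fst (h k) \<le> snd (h k)" "snd (h k) \<le> b"
        using F(1) hF[of k] unfolding nonoverlapping_def by force+
    next
      fix k l assume "k < card F" "l < card F" "k \<noteq> l"
      then show "snd (h k) \<le> fst (h l) \<or> snd (h l) \<le> fst (h k)"
        using F(1) hF inj unfolding nonoverlapping_def by blast
    next
      show "(\<Sum>k<card F. snd (h k) - fst (h k)) < d"
        using F(2) sum.reindex_bij_betw[OF h, of "\<lambda>p. snd p - fst p"] by (simp add: increment_sum_def)
    qed
    moreover have "(\<Sum>k<card F. \<bar>f (snd (h k)) - f (fst (h k))\<bar>) = (\<Sum>p\<in>F. \<bar>f (snd p) - f (fst p)\<bar>)"
      by (rule sum.reindex_bij_betw[OF h])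
    moreover have "\<bar>increment_sum f F\<bar> \<le> (\<Sum>p\<in>F. \<bar>f (snd p) - f (fst p)\<bar>)"
      unfolding increment_sum_def by (rule sum_abs)
    ultimately show "\<bar>increment_sum f F\<bar> < e" by simp
  qed
qed

text \<open>The interval is crossed in steps of length \<open>d/2\<close>, where \<open>d\<close>
  belongs to the tolerance 1. Splitting a family at the step points, each step contributes less than
  1, so \<open>k\<close> steps contribute at most \<open>k\<close>.\<close>

lemma abs_cont_on_bounded_increments:
  assumes ac: "abs_cont_on a b f" and "a \<le> b"
  obtains B where "\<And>F. nonoverlapping a b F \<Longrightarrow> increment_sum f F \<le> B"
proof -
  obtain d where d: "d > 0" "\<And>F. nonoverlapping a b F \<Longrightarrow> increment_sum (\<lambda>x. x) F < d \<Longrightarrow> \<bar>increment_sum f F\<bar> < 1"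
    using abs_cont_on_nonoverlapping[OF ac, of 1] by auto
  have *: "\<forall>F. nonoverlapping a (min b (a + real k * (d/2))) F \<longrightarrow> increment_sum f F \<le> real k" for k :: nat
  proof (induction k)
    case 0
    have "F = {}" if "nonoverlapping a (min b a) F" for F
    proof (rule ccontr)
      assume "F \<noteq> {}"
      then obtain p where "p \<in> F" by auto
      with that show False by (force simp: nonoverlapping_def)
    qed
    then show ?case by (force simp: increment_sum_def)
  next
    case (Suc k)
    show ?case
    proof (intro allI impI)
      define c where "c = min b (a + real k * (d/2))"
      define c' where "c' = min b (a + real (Suc k) * (d/2))"
      have c: "a \<le> c" "c \<le> c'" "c' \<le> b" "c' - c < d"
        using d assms by (auto simp: c_def c'_def min_def field_simps)
      fix F assume "nonoverlapping a (min b (a + real (Suc k) * (d/2))) F"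
      then have "nonoverlapping a c' F" by (simp add: c'_def)
      from nonoverlapping_split[OF this c(1,2), of f] obtain F1 F2 where
        F: "nonoverlapping a c F1" "nonoverlapping c c' F2"
           "increment_sum f F = increment_sum f F1 + increment_sum f F2" by blast
      have "increment_sum f F1 \<le> real k" using Suc F(1) by (simp add: c_def)
      moreover have "\<bar>increment_sum f F2\<bar> < 1"
      proof (rule d(2))
        show "nonoverlapping a b F2" using F(2) c by (auto intro: nonoverlapping_mono)
        show "increment_sum (\<lambda>x. x) F2 < d" using nonoverlapping_length_le[OF F(2)] c by simp
      qed
      ultimately show "increment_sum f F \<le> real (Suc k)" using F(3) by simp
    qed
  qed
  obtain k :: nat where "(b - a) / (d/2) < real k" using reals_Archimedean2 by blast
  then have "b \<le> a + real k * (d/2)" using d by (simp add: field_simps)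
  then have "min b (a + real k * (d/2)) = b" by simp
  with *[of k] that show ?thesis by metis
qed

text \<open>Additivity of the positive variation: its increment over \<open>{x..y}\<close> is the
  supremum of the sums over families inside \<open>{x..y}\<close>. One bound glues families at
  \<open>x\<close>, the other splits a nearly optimal family there.\<close>

lemma pos_variation_diff:
  assumes ac: "abs_cont_on a b f" and xy: "a \<le> x" "x \<le> y" "y \<le> b"
  shows "nonoverlapping x y F \<Longrightarrow> increment_sum f F \<le> pos_variation f a y - pos_variation f a x"
    and "e > 0 \<Longrightarrow> \<exists>F. nonoverlapping x y F \<and> pos_variation f a y - pos_variation f a x < increment_sum f F + e"
proof -
  obtain B where B: "\<And>F. nonoverlapping a b F \<Longrightarrow> increment_sum f F \<le> B"
    using abs_cont_on_bounded_increments[OF ac] xy by auto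
  have bdd: "bdd_above (increment_sum f ` {F. nonoverlapping a z F})" if "z \<le> b" for z
    by (rule bdd_aboveI[of _ B]) (use B that nonoverlapping_mono[of a z _ a b] in auto)
  have upper: "increment_sum f F \<le> pos_variation f a z" if "nonoverlapping a z F" "z \<le> b" for F z
    unfolding pos_variation_def by (rule cSUP_upper[OF _ bdd]) (use that in auto)
  have appr: "\<exists>F. nonoverlapping a z F \<and> pos_variation f a z - e < increment_sum f F" if "z \<le> b" "e > 0" for z e
  proof -
    have ne: "{F. nonoverlapping a z F} \<noteq> {}" using nonoverlapping_empty by blast
    have "pos_variation f a z - e < Sup (increment_sum f ` {F. nonoverlapping a z F})"
      using that by (simp add: pos_variation_def)
    from less_cSupD[OF _ this] ne show ?thesis by auto
  qed
  show "increment_sum f F \<le> pos_variation f a y - pos_variation f a x" if F: "nonoverlapping x y F"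
  proof (rule field_le_epsilon)
    fix e :: real assume "e > 0"
    obtain G where G: "nonoverlapping a x G" "pos_variation f a x - e < increment_sum f G"
      using appr[of x e] xy \<open>e > 0\<close> by auto
    have "increment_sum f G + increment_sum f F \<le> pos_variation f a y"
      using upper[of y "G \<union> F"] increment_sum_Un[OF G(1) F] xy by auto
    with G show "increment_sum f F \<le> pos_variation f a y - pos_variation f a x + e" by simp
  qed
  show "\<exists>F. nonoverlapping x y F \<and> pos_variation f a y - pos_variation f a x < increment_sum f F + e" if "e > 0"
  proof -
    obtain G where G: "nonoverlapping a y G" "pos_variation f a y - e < increment_sum f G"
      using appr[of y e] xy \<open>e > 0\<close> by auto
    obtain F1 F2 where F: "nonoverlapping a x F1" "nonoverlapping x y F2"
           "increment_sum f G = increment_sum f F1 + increment_sum f F2"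
      using nonoverlapping_split[OF G(1) xy(1,2), of f] by blast
    have "increment_sum f F1 \<le> pos_variation f a x" using upper[OF F(1)] xy by auto
    with F G show ?thesis by force
  qed
qed

text \<open>Absolute continuity with signed sums; for a nondecreasing function the signs make no
  difference.\<close>

definition ac_increments :: "real \<Rightarrow> real \<Rightarrow> (real \<Rightarrow> real) \<Rightarrow> bool" where
  "ac_increments a b f \<longleftrightarrow> (\<forall>e>0. \<exists>d>0. \<forall>F. nonoverlapping a b F \<longrightarrow> increment_sum (\<lambda>x. x) F < d \<longrightarrow> increment_sum f F < e)"

text \<open>A nearly optimal family inside every interval of \<open>F\<close> yields a refinement
  whose total length is no larger, so the modulus of \<open>f\<close> applies to it
  directly.\<close>

lemma ac_increments_pos_variation:
  assumes ac: "abs_cont_on a b f"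
  shows "ac_increments a b (pos_variation f a)"
  unfolding ac_increments_def
proof (intro allI impI)
  fix e :: real assume "e > 0"
  obtain d where d: "d > 0" "\<And>F. nonoverlapping a b F \<Longrightarrow> increment_sum (\<lambda>x. x) F < d \<Longrightarrow> \<bar>increment_sum f F\<bar> < e/2"
    using abs_cont_on_nonoverlapping[OF ac, of "e/2"] \<open>e > 0\<close> by auto
  show "\<exists>d>0. \<forall>F. nonoverlapping a b F \<longrightarrow> increment_sum (\<lambda>x. x) F < d \<longrightarrow> increment_sum (pos_variation f a) F < e"
  proof (intro exI[of _ d] conjI allI impI)
    fix F assume F: "nonoverlapping a b F" "increment_sum (\<lambda>x. x) F < d"
    \<comment> \<open>Distributes the tolerance \<open>e/2\<close> over the intervals of
      \<open>F\<close>; the added 1 covers the empty family.\<close>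
    define e' where "e' = e / (2 * (real (card F) + 1))"
    have "e' > 0" using \<open>e > 0\<close> by (simp add: e'_def)
    have ord: "\<And>p. p \<in> F \<Longrightarrow> a \<le> fst p \<and> fst p < snd p \<and> snd p \<le> b" using F by (auto simp: nonoverlapping_def)
    have "\<forall>p\<in>F. \<exists>G. nonoverlapping (fst p) (snd p) G \<and> 
       pos_variation f a (snd p) - pos_variation f a (fst p) < increment_sum f G + e'"
      using pos_variation_diff(2)[OF ac _ _ _ \<open>e' > 0\<close>] ord by (meson less_imp_le)
    then obtain G where G: "\<And>p. p \<in> F \<Longrightarrow> nonoverlapping (fst p) (snd p) (G p)"
       "\<And>p. p \<in> F \<Longrightarrow> pos_variation f a (snd p) - pos_variation f a (fst p) < increment_sum f (G p) + e'"
      by metis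
    note UN = increment_sum_UN[OF F(1) G(1)]
    have "increment_sum (\<lambda>x. x) (\<Union>p\<in>F. G p) < d"
    proof -
      have "increment_sum (\<lambda>x. x) (\<Union>p\<in>F. G p) = (\<Sum>p\<in>F. increment_sum (\<lambda>x. x) (G p))" by (rule UN(2))
      also have "\<dots> \<le> (\<Sum>p\<in>F. snd p - fst p)"
        using nonoverlapping_length_le[OF G(1)] ord by (intro sum_mono) (simp add: less_imp_le)
      also have "\<dots> < d" using F(2) by (simp add: increment_sum_def)
      finally show ?thesis .
    qed
    then have "\<bar>increment_sum f (\<Union>p\<in>F. G p)\<bar> < e/2" using d(2)[OF UN(1)] by blast
    moreover have "increment_sum (pos_variation f a) F \<le> (\<Sum>p\<in>F. increment_sum f (G p) + e')"
      unfolding increment_sum_def[of "pos_variation f a"] by (rule sum_mono) (use G(2) less_imp_le in blast)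
    moreover have "(\<Sum>p\<in>F. increment_sum f (G p) + e') = increment_sum f (\<Union>p\<in>F. G p) + real (card F) * e'"
      using UN(2)[of f] by (simp add: sum.distrib)
    moreover have "real (card F) * e' \<le> e/2" 
      using \<open>e > 0\<close> by (simp add: e'_def field_simps)
    ultimately show "increment_sum (pos_variation f a) F < e" by linarith
  qed (use d in auto)
qed

text \<open>The density is the Radon-Nikodym derivative of the Stieltjes measure of
  \<open>G\<close>. The point to prove is that absolute continuity of the function gives absolute
  continuity of the measure.\<close>

lemma mono_ac_increments_density:
  assumes "a < b" and mono: "\<And>x y. a \<le> x \<Longrightarrow> x \<le> y \<Longrightarrow> y \<le> b \<Longrightarrow> G x \<le> G y"
    and ac: "ac_increments a b G"
  obtains h :: "real \<Rightarrow> real" where "h \<in> borel_measurable borel" "\<And>x. 0 \<le> h x" "set_integrable lborel {a..b} h"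
    "\<And>x. x \<in> {a..b} \<Longrightarrow> G x - G a = (LINT t:{a..x}|lborel. h t)"
proof -
  \<comment> \<open>\<open>interval_measure\<close> needs a monotone continuous function on the
    whole line, so \<open>G\<close> is extended by its end values.\<close>
  define H where "H x = G (max a (min b x))" for x
  have H_eq: "H x = G x" if "x \<in> {a..b}" for x using that by (simp add: H_def)
  have monoH: "H x \<le> H y" if "x \<le> y" for x y
    unfolding H_def by (rule mono) (use that \<open>a < b\<close> in auto)
  have cont: "continuous_on UNIV H"
    unfolding continuous_on_iff
  proof (intro ballI allI impI)
    fix x e :: real assume "e > 0"
    from ac \<open>e > 0\<close> obtain d where d: "d > 0" "\<And>F. nonoverlapping a b F \<Longrightarrow> increment_sum (\<lambda>x. x) F < d \<Longrightarrow> increment_sum G F < e"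
      unfolding ac_increments_def by blast
    have *: "G v - G u < e" if "a \<le> u" "u < v" "v \<le> b" "v - u < d" for u v
      using d(2)[of "{(u,v)}"] that by (auto simp: nonoverlapping_def increment_sum_def)
    have **: "\<bar>H x - H y\<bar> < e" if "\<bar>x - y\<bar> < d" for x y
    proof -
      let ?u = "max a (min b (min x y))" and ?v = "max a (min b (max x y))"
      have uv: "a \<le> ?u" "?u \<le> ?v" "?v \<le> b" "?v - ?u < d" using that \<open>a < b\<close> \<open>d > 0\<close> by linarith+
      then have "G ?v - G ?u < e" using *[of ?u ?v] \<open>e > 0\<close> by (metis diff_self less_le)
      moreover have "G ?u \<le> G ?v" by (rule mono[OF uv(1-3)])
      moreover have "\<bar>H x - H y\<bar> = \<bar>G ?v - G ?u\<bar>"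
      proof (cases "x \<le> y")
        case True
        then show ?thesis by (simp only: H_def min_absorb1 max_absorb2 abs_minus_commute)
      next
        case False
        then have "y \<le> x" by simp
        then show ?thesis by (simp only: H_def min_absorb2 max_absorb1)
      qed
      ultimately show ?thesis by (metis abs_of_nonneg diff_ge_0_iff_ge)
    qed
    show "\<exists>d>0. \<forall>x'\<in>UNIV. dist x' x < d \<longrightarrow> dist (H x') (H x) < e"
      using d(1) ** by (intro exI[of _ d]) (auto simp: dist_real_def)
  qed
  have rc: "continuous (at_right x) H" for x
    by (rule continuous_at_imp_continuous_at_within) (use cont continuous_on_eq_continuous_at[OF open_UNIV] in blast)
  define \<mu> where "\<mu> = interval_measure H"
  have sets_mu: "sets \<mu> = sets borel" by (simp add: \<mu>_def)
  have Icc: "emeasure \<mu> {c..d} = ennreal (H d - H c)" if "c \<le> d" for c d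
    unfolding \<mu>_def by (rule emeasure_interval_measure_Icc[OF that]) (use monoH cont in \<open>auto intro: mono_onI continuous_on_subset\<close>)
  have Ioc: "emeasure \<mu> {c<..d} = ennreal (H d - H c)" if "c \<le> d" for c d
    unfolding \<mu>_def by (rule emeasure_interval_measure_Ioc[OF that]) (use monoH rc in auto)
  define M where "M = density \<mu> (indicator {a<..b})"
  have sets_M: "sets M = sets lborel" by (simp add: M_def sets_mu)
  have emM: "emeasure M A = emeasure \<mu> (A \<inter> {a<..b})" if "A \<in> sets borel" for A
  proof -
    have "emeasure M A = (\<integral>\<^sup>+x. indicator {a<..b} x * indicator A x \<partial>\<mu>)"
      using that unfolding M_def by (subst emeasure_density) (auto simp: sets_mu intro!: borel_measurable_indicator)
    also have "\<dots> = (\<integral>\<^sup>+x. indicator (A \<inter> {a<..b}) x \<partial>\<mu>)"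
      by (rule nn_integral_cong) (auto split: split_indicator)
    also have "\<dots> = emeasure \<mu> (A \<inter> {a<..b})"
      using that by (intro nn_integral_indicator) (auto simp: sets_mu)
    finally show ?thesis .
  qed
  have ac_M: "absolutely_continuous lborel M"
    unfolding absolutely_continuous_def
  proof
    fix N :: "real set" assume N: "N \<in> null_sets lborel"
    then have Nb: "N \<in> sets borel" by auto
    \<comment> \<open>The null set is enclosed in an open set of measure below \<open>d\<close> and
      covered by countably many nonoverlapping closed cells inside it. Finitely many cells have
      total length below \<open>d\<close>, so their Stieltjes mass is below \<open>e\<close>; the
      countable union follows by passing to the limit of partial sums.\<close>
    have small: "emeasure \<mu> (N \<inter> {a<..b}) \<le> ennreal e" if "e > 0" for e :: real
    proof -
      from ac \<open>e > 0\<close> obtain d where d: "d > 0" "\<And>F. nonoverlapping a b F \<Longrightarrow> increment_sum (\<lambda>x. x) F < d \<Longrightarrow> increment_sum G F < e"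
        unfolding ac_increments_def by blast
      obtain U where U: "open U" "N \<subseteq> U" "emeasure lborel (U - N) < d"
        using outer_regular_lborel[OF Nb d(1)] by blast
      have "emeasure lborel U \<le> emeasure lborel N + emeasure lborel (U - N)"
        using U Nb by (intro order_trans[OF _ emeasure_subadditive] emeasure_mono) auto
      with U N have Ud: "emeasure lborel U < d" by (auto simp: null_sets_def)
      \<comment> \<open>Each cell of the covering lemma contains a point of \<open>N\<close> and
        lies in the gauge set of that point; since \<open>N\<close> is inside \<open>U\<close>, this
        puts the cell inside \<open>U\<close>.\<close>
      have g: "gauge (\<lambda>x. if x \<in> U then U else UNIV)" using U by (auto simp: gauge_def)
      have s: "N \<inter> {a<..b} \<subseteq> cbox a b" by auto
      have bne: "box a b \<noteq> {}" using \<open>a < b\<close> by auto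
      obtain D where D: "countable D" "\<Union>D \<subseteq> cbox a b" 
        "\<And>K. K \<in> D \<Longrightarrow> interior K \<noteq> {} \<and> (\<exists>c d. K = cbox c d)"
        "pairwise (\<lambda>A B. interior A \<inter> interior B = {}) D"
        "\<And>K. K \<in> D \<Longrightarrow> \<exists>x\<in>(N \<inter> {a<..b}) \<inter> K. K \<subseteq> (if x \<in> U then U else UNIV)"
        "N \<inter> {a<..b} \<subseteq> \<Union>D"
        using covering_lemma[OF s bne g] by metis
      have DU: "K \<subseteq> U" if KD: "K \<in> D" for K 
      proof -
        obtain x where "x \<in> N" "K \<subseteq> (if x \<in> U then U else UNIV)" using D(5)[OF KD] by blast
        with U(2) show ?thesis by (simp add: subsetD)
      qed
      define p where "p K = (Inf K, Sup K :: real)" for K :: "real set"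
      have pK: "K = {fst (p K)..snd (p K)} \<and> fst (p K) < snd (p K) \<and> a \<le> fst (p K) \<and> snd (p K) \<le> b" if "K \<in> D" for K
      proof -
        have "\<exists>u v. K = cbox u v" using D(3)[OF that] by blast
        then obtain u v where uv: "K = cbox u v" by blast
        then have "u < v" using D(3)[OF that] by (auto simp: interior_cbox)
        moreover have "K \<subseteq> {a..b}" using D(2) that by auto
        ultimately show ?thesis using uv by (simp add: p_def)
      qed
      have pK_eq: "K = {fst (p K)..snd (p K)}" if "K \<in> D" for K using pK[OF that] by blast
      have pK_ord: "fst (p K) < snd (p K)" "a \<le> fst (p K)" "snd (p K) \<le> b" if "K \<in> D" for K using pK[OF that] by blast+
      have pK_int: "interior K = {fst (p K)<..<snd (p K)}" if "K \<in> D" for K 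
        by (subst pK_eq[OF that]) (rule interior_atLeastAtMost_real)
      have injp: "inj_on p D"
      proof (rule inj_onI)
        fix K L assume "K \<in> D" "L \<in> D" "p K = p L"
        then show "K = L" using pK_eq[of K] pK_eq[of L] by metis
      qed
      have fin: "(\<Sum>K\<in>E. emeasure \<mu> K) \<le> ennreal e" if E: "finite E" "E \<subseteq> D" for E
      proof -
        have no: "nonoverlapping a b (p ` E)"
          unfolding nonoverlapping_def
        proof (intro conjI ballI impI)
          fix r s assume rs: "r \<in> p ` E" "s \<in> p ` E" "r \<noteq> s"
          then obtain K L where KL: "K \<in> E" "L \<in> E" "r = p K" "s = p L" by auto
          then have "K \<in> D" "L \<in> D" "K \<noteq> L" using E rs by auto
          then have "interior K \<inter> interior L = {}" using D(4) by (auto simp: pairwise_def)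
          moreover have "interior K = {fst r<..<snd r}" "interior L = {fst s<..<snd s}"
            using pK_int[of K] pK_int[of L] KL E(2) by (simp_all add: subset_iff)
          ultimately have "{max (fst r) (fst s)<..<min (snd r) (snd s)} = {}"
            by (simp add: Int_greaterThanLessThan)
          then show "snd r \<le> fst s \<or> snd s \<le> fst r"
            using pK_ord[of K] pK_ord[of L] KL E(2) by (auto simp: max_def min_def split: if_splits)
        qed (use E pK_ord in auto)
        have leE: "fst (p K) \<le> snd (p K)" "a \<le> fst (p K)" "snd (p K) \<le> b" if "K \<in> E" for K
          using pK_ord[of K] that E(2) by (auto intro: less_imp_le)
        have injE: "inj_on p E" using injp E by (auto intro: inj_on_subset)
        have "ennreal (increment_sum (\<lambda>x. x) (p ` E)) = (\<Sum>K\<in>E. emeasure lborel (interior K))"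
        proof -
          have "ennreal (increment_sum (\<lambda>x. x) (p ` E)) = (\<Sum>K\<in>E. ennreal (snd (p K) - fst (p K)))"
            unfolding increment_sum_def sum.reindex[OF injE] using leE
            by (subst sum_ennreal[symmetric]) auto
          also have "\<dots> = (\<Sum>K\<in>E. emeasure lborel (interior K))"
          proof (rule sum.cong)
            fix K assume "K \<in> E"
            then have "K \<in> D" using E by auto
            then show "ennreal (snd (p K) - fst (p K)) = emeasure lborel (interior K)"
              using pK_ord(1)[of K] pK_int[of K] by (simp add: less_imp_le)
          qed simp
          finally show ?thesis .
        qed
        also have "\<dots> = emeasure lborel (\<Union>K\<in>E. interior K)"
          by (rule sum_emeasure) (use E D(4) in \<open>auto simp: disjoint_family_on_def pairwise_def\<close>)
        also have "\<dots> \<le> emeasure lborel U"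
        proof (rule emeasure_mono)
          show "(\<Union>K\<in>E. interior K) \<subseteq> U" using DU E interior_subset by blast
        qed (use U in auto)
        also have "\<dots> < ennreal d" by (rule Ud)
        finally have "increment_sum (\<lambda>x. x) (p ` E) < d" by (metis ennreal_leI not_le)
        then have "increment_sum G (p ` E) < e" by (rule d(2)[OF no])
        moreover have "(\<Sum>K\<in>E. emeasure \<mu> K) = ennreal (increment_sum G (p ` E))"
        proof -
          have "(\<Sum>K\<in>E. emeasure \<mu> K) = (\<Sum>K\<in>E. ennreal (G (snd (p K)) - G (fst (p K))))"
          proof (rule sum.cong)
            fix K assume "K \<in> E"
            then have K: "K \<in> D" using E by auto
            have "emeasure \<mu> K = emeasure \<mu> {fst (p K)..snd (p K)}" using pK_eq[OF K] by metis
            also have "\<dots> = ennreal (G (snd (p K)) - G (fst (p K)))"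
              using pK_ord[OF K] by (subst Icc) (auto simp: H_eq)
            finally show "emeasure \<mu> K = ennreal (G (snd (p K)) - G (fst (p K)))" .
          qed simp
          also have "\<dots> = ennreal (increment_sum G (p ` E))"
            unfolding increment_sum_def sum.reindex[OF injE] using leE
            by (subst sum_ennreal[symmetric]) (auto intro!: mono)
          finally show ?thesis .
        qed
        ultimately show ?thesis by (simp add: ennreal_leI)
      qed
      define A where "A i = (if i \<in> to_nat_on D ` D then from_nat_into D i else {})" for i
      have A: "A i \<in> sets \<mu>" for i
      proof (cases "i \<in> to_nat_on D ` D")
        case True
        then have "from_nat_into D i \<in> D" using D(1) by auto
        moreover have "A i = from_nat_into D i" using True by (simp add: A_def)
        ultimately show ?thesis unfolding sets_mu using pK_eq by (metis atLeastAtMost_borel)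
      qed (simp add: A_def)
      have "emeasure \<mu> (N \<inter> {a<..b}) \<le> emeasure \<mu> (\<Union>i. A i)"
      proof (rule emeasure_mono)
        show "N \<inter> {a<..b} \<subseteq> (\<Union>i. A i)"
        proof
          fix x assume "x \<in> N \<inter> {a<..b}"
          then obtain K where K: "K \<in> D" "x \<in> K" using D(6) by blast
          then have "A (to_nat_on D K) = K" using D(1) by (simp add: A_def)
          then show "x \<in> (\<Union>i. A i)" using K by blast
        qed
      qed (use A in auto)
      also have "\<dots> \<le> (\<Sum>i. emeasure \<mu> (A i))"
        by (rule emeasure_subadditive_countably) (use A in auto)
      also have "\<dots> \<le> ennreal e"
      proof (rule suminf_le_const)
        fix n
        define J where "J = {i\<in>{..<n}. i \<in> to_nat_on D ` D}"
        have injJ: "inj_on (from_nat_into D) J"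
          using D(1) by (auto simp: inj_on_def J_def)
        have "(\<Sum>i<n. emeasure \<mu> (A i)) = (\<Sum>i\<in>J. emeasure \<mu> (from_nat_into D i))"
          by (rule sum.mono_neutral_cong_right) (auto simp: J_def A_def)
        also have "\<dots> = (\<Sum>K\<in>from_nat_into D ` J. emeasure \<mu> K)"
          by (simp add: sum.reindex[OF injJ])
        also have "\<dots> \<le> ennreal e"
          by (rule fin) (use D(1) in \<open>auto simp: J_def\<close>)
        finally show "(\<Sum>i<n. emeasure \<mu> (A i)) \<le> ennreal e" .
      qed simp
      finally show ?thesis .
    qed
    have "emeasure \<mu> (N \<inter> {a<..b}) \<le> 0"
      by (rule ennreal_le_epsilon) (use small in auto)
    then have "emeasure \<mu> (N \<inter> {a<..b}) = 0" by simp
    then show "N \<in> null_sets M" using emM[OF Nb] Nb sets_M by auto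
  qed
  obtain h0 where h0: "h0 \<in> borel_measurable lborel" "density lborel h0 = M"
    using sigma_finite_measure.Radon_Nikodym[OF sigma_finite_lborel ac_M sets_M] by blast
  have [measurable]: "h0 \<in> borel_measurable borel" using h0(1) by simp
  have nn: "(\<integral>\<^sup>+t. h0 t * indicator {a<..x} t \<partial>lborel) = ennreal (G x - G a)" if "x \<in> {a..b}" for x
  proof -
    have "(\<integral>\<^sup>+t. h0 t * indicator {a<..x} t \<partial>lborel) = emeasure M {a<..x}"
      unfolding h0(2)[symmetric] by (subst emeasure_density) auto
    also have "\<dots> = emeasure \<mu> {a<..x}"
      using emM[of "{a<..x}"] that by (simp add: Int_absorb2)
    also have "\<dots> = ennreal (G x - G a)" using that by (simp add: Ioc H_eq)
    finally show ?thesis .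
  qed
  \<comment> \<open>\<open>h0\<close> has finite integral over \<open>{a<..b}\<close>, so the
    conversion to reals changes it there on a null set only.\<close>
  define h where "h t = enn2real (h0 t)" for t
  have hm[measurable]: "h \<in> borel_measurable borel" unfolding h_def by measurable
  have fin: "AE t in lborel. t \<in> {a<..b} \<longrightarrow> h0 t \<noteq> \<infinity>"
  proof -
    have "AE t in lborel. h0 t * indicator {a<..b} t \<noteq> \<infinity>"
      by (rule nn_integral_noteq_infinite) (use nn[of b] \<open>a < b\<close> in auto)
    then show ?thesis by eventually_elim auto
  qed
  have nnh: "(\<integral>\<^sup>+t. ennreal (indicator {a..x} t * h t) \<partial>lborel) = ennreal (G x - G a)" if x: "x \<in> {a..b}" for x
  proof -
    have "AE t in lborel. t \<noteq> a" using AE_lborel_singleton[of a] by simp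
    with fin have "AE t in lborel. ennreal (indicator {a..x} t * h t) = h0 t * indicator {a<..x} t"
      by eventually_elim (use x in \<open>auto simp: h_def indicator_def less_top\<close>)
    then have "(\<integral>\<^sup>+t. ennreal (indicator {a..x} t * h t) \<partial>lborel) = (\<integral>\<^sup>+t. h0 t * indicator {a<..x} t \<partial>lborel)"
      by (rule nn_integral_cong_AE)
    with nn[OF x] show ?thesis by simp
  qed
  have int: "integrable lborel (\<lambda>t. indicator {a..b} t * h t)"
    by (rule integrableI_nonneg) (use nnh[of b] \<open>a < b\<close> in \<open>auto simp: h_def\<close>)
  show ?thesis
  proof
    show "h \<in> borel_measurable borel" by measurable
    show "0 \<le> h x" for x by (simp add: h_def)
    show "set_integrable lborel {a..b} h" using int by (simp add: set_integrable_def)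
    show "G x - G a = (LINT t:{a..x}|lborel. h t)" if "x \<in> {a..b}" for x
    proof -
      have "(LINT t|lborel. indicator {a..x} t * h t) = enn2real (\<integral>\<^sup>+t. ennreal (indicator {a..x} t * h t) \<partial>lborel)"
        by (rule integral_eq_nn_integral) (auto simp: h_def)
      also have "\<dots> = G x - G a" using nnh[OF that] mono[of a x] that by simp
      finally show ?thesis by (simp add: set_lebesgue_integral_def)
    qed
  qed
qed


text \<open>Lebesgue differentiation. The library theorem controls averages over intervals to the
  right of a point; applying it also to the reflected function gives averages to the left, and the
  two together give the two-sided derivative.\<close>

lemma AE_indefinite_integral_deriv:
  fixes h :: "real \<Rightarrow> real"
  assumes "set_integrable lborel {a..b} h"
  shows "AE x in lborel. x \<in> {a<..<b} \<longrightarrow> ((\<lambda>x. LINT t:{a..x}|lborel. h t) has_real_derivative h x) (at x)"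
proof -
  \<comment> \<open>Cut off outside \<open>{a..b}\<close>, so that integrability holds on every
    box.\<close>
  define g where "g t = indicator {a..b} t * h t" for t
  have g_eq: "g = (\<lambda>t. indicator {a..b} t * h t)" by (simp add: g_def fun_eq_iff)
  have ig: "integrable lborel g" using assms unfolding g_eq set_integrable_def by simp
  have sig: "set_integrable lborel S g" if "S \<in> sets borel" for S
    unfolding set_integrable_def using integrable_mult_indicator[OF _ ig, of S] that by simp
  have io: "g integrable_on cbox c d" for c d
    using set_borel_integral_eq_integral(1)[OF sig] by simp
  have io': "(\<lambda>x. g (- x)) integrable_on cbox c d" for c d
  proof -
    have "integrable lborel (\<lambda>x. g (- x))"
      using lborel_integrable_real_affine[OF ig, of "-1" 0] by simp
    then have "set_integrable lborel {c..d} (\<lambda>x. g (- x))"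
      unfolding set_integrable_def using integrable_mult_indicator[of "{c..d}" lborel "\<lambda>x. g (- x)"] by simp
    then show ?thesis using set_borel_integral_eq_integral(1) by simp
  qed
  obtain N where N: "negligible N" "\<And>x e. \<lbrakk>x \<notin> N; 0 < e\<rbrakk> \<Longrightarrow>
       \<exists>d>0. \<forall>k. 0 < k \<and> k < d \<longrightarrow> norm (integral (cbox x (x + k *\<^sub>R One)) g /\<^sub>R k ^ DIM(real) - g x) < e"
    using integrable_ccontinuous_explicit[of g, OF io] by metis
  obtain N' where N': "negligible N'" "\<And>x e. \<lbrakk>x \<notin> N'; 0 < e\<rbrakk> \<Longrightarrow>
       \<exists>d>0. \<forall>k. 0 < k \<and> k < d \<longrightarrow> norm (integral (cbox x (x + k *\<^sub>R One)) (\<lambda>x. g (- x)) /\<^sub>R k ^ DIM(real) - g (- x)) < e"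
    using integrable_ccontinuous_explicit[of "\<lambda>x. g (- x)", OF io'] by metis
  define F where "F x = (LINT t:{a..x}|lborel. h t)" for x
  have Fdiff: "F y - F x = integral {x..y} g" if "a \<le> x" "x \<le> y" "y \<le> b" for x y
  proof -
    have si: "set_integrable lborel {c..d} h" if "a \<le> c" "d \<le> b" for c d
      by (rule set_integrable_subset[OF assms]) (use that in auto)
    have "F y = F x + (LINT t:{x<..y}|lborel. h t)"
    proof -
      have "{a..y} = {a..x} \<union> {x<..y}" using that by auto
      then show ?thesis unfolding F_def
        by (simp, intro set_integral_Un) (use that si[of a x] in \<open>auto intro!: set_integrable_subset[OF assms]\<close>)
    qed
    also have "(LINT t:{x<..y}|lborel. h t) = (LINT t:{x..y}|lborel. g t)"
      unfolding set_lebesgue_integral_def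
    proof (rule integral_cong_AE)
      have "AE t in lborel. t \<noteq> x" using AE_lborel_singleton[of x] by simp
      then show "AE t in lborel. indicator {x<..y} t *\<^sub>R h t = indicator {x..y} t *\<^sub>R g t"
        by eventually_elim (use that in \<open>auto simp: g_def indicator_def\<close>)
      have "set_integrable lborel {x<..y} h" by (rule set_integrable_subset[OF assms]) (use that in auto)
      then show "(\<lambda>t. indicator {x<..y} t *\<^sub>R h t) \<in> borel_measurable lborel"
        unfolding set_integrable_def by (rule borel_measurable_integrable)
      show "(\<lambda>t. indicator {x..y} t *\<^sub>R g t) \<in> borel_measurable lborel"
        using sig[of "{x..y}"] unfolding set_integrable_def by (intro borel_measurable_integrable) auto
    qed
    also have "\<dots> = integral {x..y} g"
      by (rule set_borel_integral_eq_integral(2)[OF sig]) auto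
    finally show ?thesis by simp
  qed
  have "((\<lambda>x. LINT t:{a..x}|lborel. h t) has_real_derivative h x) (at x)"
    if x: "x \<notin> N" "x \<notin> uminus ` N'" "x \<in> {a<..<b}" for x
  proof -
    have gx: "g x = h x" using x by (simp add: g_def)
    have "-x \<notin> N'" using x by force
    have "((\<lambda>k. (F (x + k) - F x) / k) \<longlongrightarrow> h x) (at 0)"
      unfolding tendsto_iff
    proof (intro allI impI)
      fix e :: real assume "e > 0"
      obtain d where d: "d > 0" "\<And>k. 0 < k \<Longrightarrow> k < d \<Longrightarrow> \<bar>integral {x..x+k} g / k - h x\<bar> < e"
        using N(2)[OF x(1) \<open>e > 0\<close>] gx by (auto simp: divide_inverse_commute)
      obtain d' where d': "d' > 0" "\<And>k. 0 < k \<Longrightarrow> k < d' \<Longrightarrow> \<bar>integral {-x..-x+k} (\<lambda>x. g (- x)) / k - h x\<bar> < e"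
        using N'(2)[OF \<open>-x \<notin> N'\<close> \<open>e > 0\<close>] gx by (auto simp: divide_inverse_commute)
      define r where "r = Min {d, d', x - a, b - x}"
      have r: "r > 0" "r \<le> d" "r \<le> d'" "r \<le> x - a" "r \<le> b - x" using d d' x by (auto simp: r_def)
      have "dist ((F (x + k) - F x) / k) (h x) < e" if "k \<noteq> 0" "\<bar>k\<bar> < r" for k
      proof (cases "k > 0")
        case True
        then have "F (x + k) - F x = integral {x..x+k} g" using Fdiff[of x "x+k"] r that by simp
        then show ?thesis using d(2)[of k] True that r by (simp add: dist_real_def)
      next
        case False
        then have k: "k < 0" using that by simp
        then have "F x - F (x + k) = integral {x+k..x} g" using Fdiff[of "x+k" x] r that x by simp
        also have "\<dots> = integral {-x..-x+(-k)} (\<lambda>x. g (- x))"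
          using Henstock_Kurzweil_Integration.integral_reflect_real[where f=g and a="x+k" and b=x] by simp
        finally have "(F (x + k) - F x) / k = integral {-x..-x+(-k)} (\<lambda>x. g (- x)) / (-k)"
          by (simp add: field_simps)
        then show ?thesis using d'(2)[of "-k"] k that r by (simp add: dist_real_def)
      qed
      then show "\<forall>\<^sub>F k in at 0. dist ((F (x + k) - F x) / k) (h x) < e"
        unfolding eventually_at using r(1) by (intro exI[of _ r]) (auto simp: dist_real_def)
    qed
    then show ?thesis unfolding DERIV_def F_def .
  qed
  moreover have "negligible (N \<union> uminus ` N')"
    using N(1) negligible_differentiable_image_negligible[OF _ N'(1), of uminus] by (simp add: differentiable_on_minus)
  ultimately have "AE x in lebesgue. x \<in> {a<..<b} \<longrightarrow> ((\<lambda>x. LINT t:{a..x}|lborel. h t) has_real_derivative h x) (at x)"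
    by (intro AE_I'[of "N \<union> uminus ` N'"]) (auto simp: negligible_iff_null_sets)
  then show ?thesis by (simp add: AE_completion_iff)
qed

text \<open>Jordan decomposition: both \<open>?P\<close> and \<open>?Q\<close> are nondecreasing and
  absolutely continuous, so each has a density, and the difference of the two densities is a density
  of \<open>f\<close>.\<close>

lemma abs_cont_on_density:
  assumes ac: "abs_cont_on a b f" and ab: "a < b"
  obtains h :: "real \<Rightarrow> real" where "h \<in> borel_measurable borel" "set_integrable lborel {a..b} h"
    "\<And>x. x \<in> {a..b} \<Longrightarrow> f x - f a = (LINT t:{a..x}|lborel. h t)"
    "AE x in lborel. x \<in> {a<..<b} \<longrightarrow> (f has_real_derivative h x) (at x)"
proof -
  let ?P = "pos_variation f a"
  let ?Q = "\<lambda>x. ?P x - f x"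
  have inc: "f y - f x \<le> ?P y - ?P x \<and> 0 \<le> ?P y - ?P x" if "a \<le> x" "x \<le> y" "y \<le> b" for x y
  proof (cases "x < y")
    case True
    then show ?thesis using pos_variation_diff(1)[OF ac that, of "{(x,y)}"] pos_variation_diff(1)[OF ac that, of "{}"] 
      by (simp add: nonoverlapping_def increment_sum_def)
  qed (use that in simp)
  have acP: "ac_increments a b ?P" by (rule ac_increments_pos_variation[OF ac])
  have acQ: "ac_increments a b ?Q"
    unfolding ac_increments_def
  proof (intro allI impI)
    fix e :: real assume "e > 0"
    obtain d where d: "d > 0" "\<And>F. nonoverlapping a b F \<Longrightarrow> increment_sum (\<lambda>x. x) F < d \<Longrightarrow> \<bar>increment_sum f F\<bar> < e/2"
      using abs_cont_on_nonoverlapping[OF ac, of "e/2"] \<open>e > 0\<close> by auto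
    obtain d' where d': "d' > 0" "\<And>F. nonoverlapping a b F \<Longrightarrow> increment_sum (\<lambda>x. x) F < d' \<Longrightarrow> increment_sum ?P F < e/2"
      using acP \<open>e > 0\<close> unfolding ac_increments_def by (meson half_gt_zero)
    have "increment_sum ?Q F < e" if "nonoverlapping a b F" "increment_sum (\<lambda>x. x) F < min d d'" for F
    proof -
      have "increment_sum ?Q F = increment_sum ?P F - increment_sum f F"
        unfolding increment_sum_def sum_subtractf[symmetric] by (rule sum.cong) auto
      then show ?thesis using d(2)[OF that(1)] d'(2)[OF that(1)] that(2) by linarith
    qed
    then show "\<exists>d>0. \<forall>F. nonoverlapping a b F \<longrightarrow> increment_sum (\<lambda>x. x) F < d \<longrightarrow> increment_sum ?Q F < e"
      using d(1) d'(1) by (intro exI[of _ "min d d'"]) auto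
  qed
  obtain p where p: "p \<in> borel_measurable borel" "set_integrable lborel {a..b} p"
    "\<And>x. x \<in> {a..b} \<Longrightarrow> ?P x - ?P a = (LINT t:{a..x}|lborel. p t)"
  proof (rule mono_ac_increments_density[OF ab _ acP])
    show "?P x \<le> ?P y" if "a \<le> x" "x \<le> y" "y \<le> b" for x y using inc[OF that] by simp
  qed blast
  obtain q where q: "q \<in> borel_measurable borel" "set_integrable lborel {a..b} q"
    "\<And>x. x \<in> {a..b} \<Longrightarrow> ?Q x - ?Q a = (LINT t:{a..x}|lborel. q t)"
  proof (rule mono_ac_increments_density[OF ab _ acQ])
    show "?Q x \<le> ?Q y" if "a \<le> x" "x \<le> y" "y \<le> b" for x y using inc[OF that] by simp
  qed blast
  let ?h = "\<lambda>t. p t - q t"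
  have int: "set_integrable lborel {a..b} ?h" by (rule set_integral_diff(1)[OF p(2) q(2)])
  have eq: "f x - f a = (LINT t:{a..x}|lborel. ?h t)" if "x \<in> {a..b}" for x
  proof -
    have "set_integrable lborel {a..x} p" "set_integrable lborel {a..x} q"
      using that by (auto intro: set_integrable_subset[OF p(2)] set_integrable_subset[OF q(2)])
    from set_integral_diff(2)[OF this] p(3)[OF that] q(3)[OF that] show ?thesis by linarith
  qed
  show ?thesis
  proof
    show "?h \<in> borel_measurable borel" using p(1) q(1) by measurable
    show "AE x in lborel. x \<in> {a<..<b} \<longrightarrow> (f has_real_derivative ?h x) (at x)"
      using AE_indefinite_integral_deriv[OF int]
    proof eventually_elim
      case (elim x)
      show ?case
      proof
        assume x: "x \<in> {a<..<b}"
        with elim have "((\<lambda>x. f a + (LINT t:{a..x}|lborel. ?h t)) has_real_derivative ?h x) (at x)"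
          by (auto intro!: derivative_eq_intros)
        then show "(f has_real_derivative ?h x) (at x)"
        proof (rule DERIV_cong_ev[THEN iffD1, rotated -1])
          show "\<forall>\<^sub>F y in nhds x. f a + (LINT t:{a..y}|lborel. ?h t) = f y"
            using eventually_nhds_in_open[of "{a<..<b}" x] x by (auto elim!: eventually_mono simp: eq[symmetric])
        qed auto
      qed
    qed
  qed (use int eq in auto)
qed

section \<open>Occupancy functions as Lipschitz paths\<close>

text \<open>The integral of the rate \<theta>_j over [s,t]. Adding the differential equations for
  levels 0 to j telescopes to minus \<theta>_j, so this integral can be read off from the two end
  states. The top level receives the remainder because the rates sum to one.\<close>

definition occ_flow :: "nat \<Rightarrow> (real \<Rightarrow> nat \<Rightarrow> real) \<Rightarrow> real \<Rightarrow> real \<Rightarrow> nat \<Rightarrow> real" where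
  "occ_flow I g s t j = (if j \<le> I then (\<Sum>k\<le>j. g s k) - (\<Sum>k\<le>j. g t k)
     else (t - s) - (\<Sum>i\<le>I. (\<Sum>k\<le>i. g s k) - (\<Sum>k\<le>i. g t k)))"

text \<open>With \<open>c = 0\<close> these are the valid occupancy functions. The slack \<open>c = 1/n\<close> accommodates the
  sample paths, whose jumps can run ahead of the clock by one ball.\<close>

definition admissible_paths :: "nat \<Rightarrow> real \<Rightarrow> real \<Rightarrow> (real \<Rightarrow> nat \<Rightarrow> real) set" where
  "admissible_paths I \<beta> c = {g. (\<forall>t. g t \<in> occ_simplex I) \<and> (\<forall>t<0. g t = g 0) \<and> (\<forall>t>\<beta>. g t = g \<beta>) \<and>
     (\<forall>s t. 0 \<le> s \<and> s \<le> t \<and> t \<le> \<beta> \<longrightarrow>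
        (\<forall>j\<le>I. 0 \<le> occ_flow I g s t j) \<and> - c \<le> occ_flow I g s t (I+1))}"

section \<open>Flows and regularity of admissible paths\<close>

lemma occ_simplexD:
  assumes "v \<in> occ_simplex I"
  shows "0 \<le> v j" "j > I + 1 \<Longrightarrow> v j = 0" "(\<Sum>j\<le>I+1. v j) = 1" "v j \<le> 1"
proof -
  show 1: "0 \<le> v j" and 2: "j > I + 1 \<Longrightarrow> v j = 0" and 3: "(\<Sum>j\<le>I+1. v j) = 1" for j
    using assms by (auto simp: occ_simplex_def)
  show "v j \<le> 1"
  proof (cases "j \<le> I + 1")
    case True
    then have "v j \<le> (\<Sum>j\<le>I+1. v j)" by (intro member_le_sum) (use 1 in auto)
    then show ?thesis using 3 by simp
  qed (use 2 in auto)
qed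

lemma sum_occ_flow: "(\<Sum>j\<le>I+1. occ_flow I g s t j) = t - s"
  by (simp add: occ_flow_def)

lemma occ_flow_add: "occ_flow I g s t j + occ_flow I g t u j = occ_flow I g s u j"
  by (auto simp: occ_flow_def sum_subtractf algebra_simps)

lemma occ_flow_same [simp]: "occ_flow I g s s j = 0"
  by (simp add: occ_flow_def)

lemma admD:
  assumes "g \<in> admissible_paths I \<beta> c"
  shows "g t \<in> occ_simplex I" "t < 0 \<Longrightarrow> g t = g 0" "t > \<beta> \<Longrightarrow> g t = g \<beta>"
    "\<lbrakk>0 \<le> s; s \<le> t; t \<le> \<beta>; j \<le> I\<rbrakk> \<Longrightarrow> 0 \<le> occ_flow I g s t j"
    "\<lbrakk>0 \<le> s; s \<le> t; t \<le> \<beta>\<rbrakk> \<Longrightarrow> - c \<le> occ_flow I g s t (I+1)"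
  using assms by (auto simp: admissible_paths_def)

text \<open>The flows add up to \<open>t - s\<close> and only the one at the top level can be
  negative, by at most \<open>c\<close>; so no flow exceeds \<open>t - s + c\<close>.\<close>

lemma adm_flow_le:
  assumes "g \<in> admissible_paths I \<beta> c" "0 \<le> s" "s \<le> t" "t \<le> \<beta>" "j \<le> I + 1" "0 \<le> c"
  shows "occ_flow I g s t j \<le> t - s + c" "- c \<le> occ_flow I g s t j"
proof -
  have sum: "(\<Sum>i\<le>I. occ_flow I g s t i) + occ_flow I g s t (I+1) = t - s"
    using sum_occ_flow[of I g s t] by simp
  have nn: "0 \<le> occ_flow I g s t i" if "i \<le> I" for i using admD(4)[OF assms(1-4) that] .
  have last: "- c \<le> occ_flow I g s t (I+1)" using admD(5)[OF assms(1-4)] .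
  have "0 \<le> (\<Sum>i\<le>I. occ_flow I g s t i)" by (rule sum_nonneg) (use nn in auto)
  moreover have "occ_flow I g s t j \<le> (\<Sum>i\<le>I. occ_flow I g s t i)" if "j \<le> I"
    by (rule member_le_sum) (use nn that in auto)
  ultimately show "occ_flow I g s t j \<le> t - s + c"
    using sum last \<open>0 \<le> c\<close> \<open>j \<le> I + 1\<close> by (cases "j \<le> I") (auto simp: le_Suc_eq)
  show "- c \<le> occ_flow I g s t j" using nn[of j] last assms(5,6) by (cases "j \<le> I") (auto simp: le_Suc_eq)
qed

lemma simplex_diff_flow:
  fixes g :: "real \<Rightarrow> nat \<Rightarrow> real"
  assumes "g s \<in> occ_simplex I" "g t \<in> occ_simplex I" "j \<le> I + 1"
  shows "g t j - g s j = (if j = 0 then 0 else occ_flow I g s t (j-1)) - (if j \<le> I then occ_flow I g s t j else 0)"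
proof (cases "j \<le> I")
  case True
  then show ?thesis by (cases j) (simp_all add: occ_flow_def sum.atMost_Suc)
next
  case False
  then have j: "j = I + 1" using assms by simp
  have "(\<Sum>k\<le>I. g s k) + g s (I+1) = 1" "(\<Sum>k\<le>I. g t k) + g t (I+1) = 1"
    using occ_simplexD(3)[OF assms(1)] occ_simplexD(3)[OF assms(2)] by simp_all
  then show ?thesis using j by (simp add: occ_flow_def)
qed

text \<open>A component changes by the flow entering it minus the flow leaving it, two numbers
  between 0 and \<open>t - s + c\<close>. For sample paths the slack \<open>c\<close> accounts for
  the jumps.\<close>

lemma adm_near_Lipschitz:
  assumes "g \<in> admissible_paths I \<beta> c" "0 \<le> s" "s \<le> t" "t \<le> \<beta>" "0 \<le> c"
  shows "\<bar>g t j - g s j\<bar> \<le> t - s + c"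
proof (cases "j \<le> I + 1")
  case True
  define A where "A = (if j = 0 then 0 else occ_flow I g s t (j-1))"
  define B where "B = (if j \<le> I then occ_flow I g s t j else 0)"
  have "0 \<le> A" "A \<le> t - s + c" "0 \<le> B" "B \<le> t - s + c"
    using adm_flow_le(1)[OF assms(1-4), of j] adm_flow_le(1)[OF assms(1-4), of "j-1"] assms True
       admD(4)[OF assms(1-4), of j] admD(4)[OF assms(1-4), of "j-1"] by (auto simp: A_def B_def)
  moreover have "g t j - g s j = A - B"
    using simplex_diff_flow[of g s I t j, OF admD(1)[OF assms(1)] admD(1)[OF assms(1)] True] by (simp add: A_def B_def)
  ultimately show ?thesis by linarith
next
  case False
  then show ?thesis using occ_simplexD(2)[OF admD(1)[OF assms(1)]] assms by simp
qed

lemma adm_clamp: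
  assumes "g \<in> admissible_paths I \<beta> c" "0 \<le> \<beta>"
  shows "g t = g (max 0 (min \<beta> t))"
proof -
  consider "t < 0" | "0 \<le> t" "t \<le> \<beta>" | "\<beta> < t" by linarith
  then show ?thesis
  proof cases
    case 1
    then show ?thesis using admD(2)[OF assms(1)] assms(2) by (simp add: max_def min_def)
  next
    case 2
    then show ?thesis by simp
  next
    case 3
    then show ?thesis using admD(3)[OF assms(1)] assms(2) by (simp add: max_def min_def)
  qed
qed

lemma adm_0_Lipschitz:
  assumes "g \<in> admissible_paths I \<beta> 0" "0 \<le> \<beta>"
  shows "\<bar>g t j - g s j\<bar> \<le> \<bar>t - s\<bar>"
proof -
  have *: "\<bar>g v j - g u j\<bar> \<le> v - u" if "u \<le> v" for u v
  proof -
    have "0 \<le> max 0 (min \<beta> u)" "max 0 (min \<beta> u) \<le> max 0 (min \<beta> v)" "max 0 (min \<beta> v) \<le> \<beta>"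
      and le: "max 0 (min \<beta> v) - max 0 (min \<beta> u) \<le> v - u"
      using assms(2) that by linarith+
    from adm_near_Lipschitz[OF assms(1) this(1-3), of j] le
    show ?thesis using adm_clamp[OF assms, of u] adm_clamp[OF assms, of v] by simp
  qed
  show ?thesis using *[of s t] *[of t s] by (cases "s \<le> t") (auto simp: abs_minus_commute)
qed

lemma tendsto_fun_componentwise:
  fixes f :: "'a \<Rightarrow> 'b \<Rightarrow> 'c::topological_space"
  shows "(f \<longlongrightarrow> l) F \<longleftrightarrow> (\<forall>j. ((\<lambda>x. f x j) \<longlongrightarrow> l j) F)"
proof -
  have "(f \<longlongrightarrow> l) F \<longleftrightarrow> limitin (product_topology (\<lambda>i. euclidean) UNIV) f l F"
    by (simp add: euclidean_product_topology)
  then show ?thesis by (simp add: limitin_componentwise del: limitin_canonical_iff) (simp add: limitin_canonical_iff)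
qed

lemma adm_0_continuous:
  assumes "g \<in> admissible_paths I \<beta> 0" "0 \<le> \<beta>"
  shows "isCont (\<lambda>x. g x j) x"
  unfolding isCont_def tendsto_iff
proof (intro allI impI)
  fix e :: real assume "e > 0"
  then show "\<forall>\<^sub>F y in at x. dist (g y j) (g x j) < e"
    unfolding eventually_at using adm_0_Lipschitz[OF assms, of _ j x]
    by (intro exI[of _ e]) (auto simp: dist_real_def intro: le_less_trans)
qed

lemma adm_0_Dsp:
  assumes "g \<in> admissible_paths I \<beta> 0" "0 \<le> \<beta>"
  shows "g \<in> Dsp I \<beta>"
proof -
  have *: "(g \<longlongrightarrow> g t) (at t within S)" for t S
    unfolding tendsto_fun_componentwise by (use adm_0_continuous[OF assms] in \<open>auto simp: isCont_def intro: tendsto_within_subset\<close>)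
  then show ?thesis
    unfolding Dsp_def using admD(2,3)[OF assms(1)] occ_simplexD(2)[OF admD(1)[OF assms(1)]] * by blast
qed

section \<open>Rates as densities of the flows\<close>

lemma set_integrable_uminus: "set_integrable M A f \<Longrightarrow> set_integrable M A (\<lambda>x. - f x)"
  by (simp add: set_integrable_def)

lemma set_integrable_sum:
  fixes f :: "_ \<Rightarrow> _ \<Rightarrow> _::{banach, second_countable_topology}"
  shows "(\<And>i. i \<in> S \<Longrightarrow> set_integrable M A (f i)) \<Longrightarrow> set_integrable M A (\<lambda>x. \<Sum>i\<in>S. f i x)"
  by (simp add: set_integrable_def scaleR_sum_right)

lemma set_integral_sum:
  fixes f :: "_ \<Rightarrow> _ \<Rightarrow> _::{banach, second_countable_topology}"
  shows "(\<And>i. i \<in> S \<Longrightarrow> set_integrable M A (f i)) \<Longrightarrow>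
    (LINT x:A|M. (\<Sum>i\<in>S. f i x)) = (\<Sum>i\<in>S. LINT x:A|M. f i x)"
  by (simp add: set_integrable_def set_lebesgue_integral_def scaleR_sum_right)

text \<open>\<open>occ_rate\<close> is built from \<open>deriv\<close>, which has a meaning only
  where the path is differentiable. The functions \<open>th\<close> are integrable, agree with it
  almost everywhere, and integrate to the flow over every interval.\<close>

lemma occ_rate_density:
  assumes "\<beta> > 0" and ac: "\<And>j. j \<le> I + 1 \<Longrightarrow> abs_cont_on 0 \<beta> (\<lambda>x. g x j)"
  obtains th :: "nat \<Rightarrow> real \<Rightarrow> real" where
    "\<forall>j\<le>I+1. set_integrable lborel {0..\<beta>} (th j)"
    "\<forall>j s t. j \<le> I + 1 \<and> 0 \<le> s \<and> s \<le> t \<and> t \<le> \<beta> \<longrightarrow> occ_flow I g s t j = (LINT x:{s..t}|lborel. th j x)"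
    "AE x in lborel. x \<in> {0<..<\<beta>} \<longrightarrow> (\<forall>j\<le>I+1. ((\<lambda>y. occ_flow I g 0 y j) has_real_derivative th j x) (at x) \<and> occ_rate I g x j = th j x)"
proof -
  have ex: "\<exists>h. set_integrable lborel {0..\<beta>} h \<and> (\<forall>x\<in>{0..\<beta>}. g x j - g 0 j = (LINT t:{0..x}|lborel. h t)) \<and>
      (AE x in lborel. x \<in> {0<..<\<beta>} \<longrightarrow> ((\<lambda>x. g x j) has_real_derivative h x) (at x))" if "j \<le> I + 1" for j
    by (rule abs_cont_on_density[OF ac[OF that] \<open>\<beta> > 0\<close>]) blast
  obtain h where h: "\<And>j. j \<le> I + 1 \<Longrightarrow> set_integrable lborel {0..\<beta>} (h j)"
    "\<And>j x. j \<le> I + 1 \<Longrightarrow> x \<in> {0..\<beta>} \<Longrightarrow> g x j - g 0 j = (LINT t:{0..x}|lborel. h j t)"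
    "\<And>j. j \<le> I + 1 \<Longrightarrow> AE x in lborel. x \<in> {0<..<\<beta>} \<longrightarrow> ((\<lambda>x. g x j) has_real_derivative h j x) (at x)"
  proof -
    assume a: "\<And>h. (\<And>j. j \<le> I + 1 \<Longrightarrow> set_integrable lborel {0..\<beta>} (h j)) \<Longrightarrow>
      (\<And>j x. j \<le> I + 1 \<Longrightarrow> x \<in> {0..\<beta>} \<Longrightarrow> g x j - g 0 j = (LINT t:{0..x}|lborel. h j t)) \<Longrightarrow>
      (\<And>j. j \<le> I + 1 \<Longrightarrow> AE x in lborel. x \<in> {0<..<\<beta>} \<longrightarrow> ((\<lambda>x. g x j) has_real_derivative h j x) (at x)) \<Longrightarrow> thesis"
    show thesis
    proof (rule a[of "\<lambda>j. SOME h. set_integrable lborel {0..\<beta>} h \<and> (\<forall>x\<in>{0..\<beta>}. g x j - g 0 j = (LINT t:{0..x}|lborel. h t)) \<and>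
      (AE x in lborel. x \<in> {0<..<\<beta>} \<longrightarrow> ((\<lambda>x. g x j) has_real_derivative h x) (at x))"])
    qed (use someI_ex[OF ex] in blast)+
  qed
  define th where "th j x = (if j \<le> I then - (\<Sum>k\<le>j. h k x) else 1 - (\<Sum>i\<le>I. - (\<Sum>k\<le>i. h k x)))" for j x
  have int_st: "set_integrable lborel {s..t} (h j)" if "j \<le> I + 1" "0 \<le> s" "t \<le> \<beta>" for j s t
    by (rule set_integrable_subset[OF h(1)[OF that(1)]]) (use that in auto)
  have diff: "g t j - g s j = (LINT x:{s..t}|lborel. h j x)" if "j \<le> I + 1" "0 \<le> s" "s \<le> t" "t \<le> \<beta>" for j s t
  proof -
    have "(LINT x:{0..t}|lborel. h j x) = (LINT x:{0..s}|lborel. h j x) + (LINT x:{s..t}|lborel. h j x)"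
    proof -
      have "AE x in lborel. x \<noteq> s" using AE_lborel_singleton[of s] by simp
      then have "AE x in lborel. \<not> (x \<in> {0..s} \<and> x \<in> {s..t})" by eventually_elim auto
      moreover have "{0..t} = {0..s} \<union> {s..t}" using that by auto
      ultimately show ?thesis
        using set_integral_Un_AE[where M=lborel and A="{0..s}" and B="{s..t}" and f="h j"] int_st[of j 0 s] int_st[of j s t] that by simp
    qed
    then show ?thesis using h(2)[of j t] h(2)[of j s] that by simp
  qed
  have one: "set_integrable lborel {s..t} (\<lambda>x. 1::real)" for s t :: real
    unfolding set_integrable_def by (simp add: integrable_indicator_iff emeasure_lborel_Icc_eq less_top[symmetric])
  have int_th: "set_integrable lborel {s..t} (th j)" if "0 \<le> s" "t \<le> \<beta>" "j \<le> I + 1" for s t j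
  proof (cases "j \<le> I")
    case True
    then show ?thesis unfolding th_def using that int_st by (auto intro!: set_integrable_uminus set_integrable_sum)
  next
    case False
    have "set_integrable lborel {s..t} (\<lambda>x. 1 - (\<Sum>i\<le>I. - (\<Sum>k\<le>i. h k x)))"
      using that int_st by (intro set_integral_diff(1)[OF one] set_integrable_uminus set_integrable_sum) auto
    then show ?thesis unfolding th_def using False by simp
  qed
  have flow: "occ_flow I g s t j = (LINT x:{s..t}|lborel. th j x)" if "j \<le> I + 1" "0 \<le> s" "s \<le> t" "t \<le> \<beta>" for j s t
  proof -
    have 1: "(LINT x:{s..t}|lborel. - (\<Sum>k\<le>j. h k x)) = (\<Sum>k\<le>j. g s k) - (\<Sum>k\<le>j. g t k)" if "j \<le> I" for j
    proof -
      have "(LINT x:{s..t}|lborel. - (\<Sum>k\<le>j. h k x)) = - (LINT x:{s..t}|lborel. (\<Sum>k\<le>j. h k x))"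
        by (rule set_integral_uminus) (use int_st \<open>0 \<le> s\<close> \<open>t \<le> \<beta>\<close> that in \<open>auto intro!: set_integrable_sum\<close>)
      also have "(LINT x:{s..t}|lborel. (\<Sum>k\<le>j. h k x)) = (\<Sum>k\<le>j. LINT x:{s..t}|lborel. h k x)"
        by (rule set_integral_sum) (use int_st \<open>0 \<le> s\<close> \<open>t \<le> \<beta>\<close> that in auto)
      also have "\<dots> = (\<Sum>k\<le>j. g t k - g s k)"
        by (rule sum.cong) (use diff \<open>0 \<le> s\<close> \<open>s \<le> t\<close> \<open>t \<le> \<beta>\<close> that in auto)
      finally show ?thesis by (simp add: sum_subtractf)
    qed
    show ?thesis
    proof (cases "j \<le> I")
      case True
      then show ?thesis using 1[OF True] by (simp add: th_def occ_flow_def)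
    next
      case False
      have i2: "set_integrable lborel {s..t} (\<lambda>x. \<Sum>i\<le>I. - (\<Sum>k\<le>i. h k x))"
        using int_st that by (auto intro!: set_integrable_uminus set_integrable_sum)
      have "(LINT x:{s..t}|lborel. th j x) = (LINT x:{s..t}|lborel. 1) - (LINT x:{s..t}|lborel. \<Sum>i\<le>I. - (\<Sum>k\<le>i. h k x))"
        unfolding th_def using False by (simp add: set_integral_diff(2)[OF one i2])
      also have "(LINT x:{s..t}|lborel. \<Sum>i\<le>I. - (\<Sum>k\<le>i. h k x)) = (\<Sum>i\<le>I. LINT x:{s..t}|lborel. - (\<Sum>k\<le>i. h k x))"
        by (rule set_integral_sum) (use int_st that in \<open>auto intro!: set_integrable_uminus set_integrable_sum\<close>)
      also have "\<dots> = (\<Sum>i\<le>I. (\<Sum>k\<le>i. g s k) - (\<Sum>k\<le>i. g t k))"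
        by (rule sum.cong) (use 1 in auto)
      also have "(LINT x:{s..t}|lborel. 1::real) = t - s" using that by (simp add: set_lebesgue_integral_def)
      finally show ?thesis using False by (simp add: occ_flow_def)
    qed
  qed
  have ae: "AE x in lborel. \<forall>j\<in>{..I+1}. x \<in> {0<..<\<beta>} \<longrightarrow> ((\<lambda>x. g x j) has_real_derivative h j x) (at x)"
    by (rule AE_finite_allI) (use h(3) in auto)
  have ae': "AE x in lborel. x \<in> {0<..<\<beta>} \<longrightarrow> (\<forall>j\<le>I+1. ((\<lambda>y. occ_flow I g 0 y j) has_real_derivative th j x) (at x) \<and> occ_rate I g x j = th j x)"
    using ae
  proof eventually_elim
    case (elim x)
    show ?case
    proof (intro impI allI)
      fix j assume x: "x \<in> {0<..<\<beta>}" and j: "j \<le> I + 1"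
      have d: "((\<lambda>x. g x k) has_real_derivative h k x) (at x)" if "k \<le> I + 1" for k using elim x that by auto
      have dv: "deriv (\<lambda>y. g y k) x = h k x" if "k \<le> I + 1" for k using DERIV_imp_deriv[OF d[OF that]] .
      have s: "((\<lambda>y. (\<Sum>k\<le>j. g 0 k) - (\<Sum>k\<le>j. g y k)) has_real_derivative - (\<Sum>k\<le>j. h k x)) (at x)" if "j \<le> I" for j
        using that by (auto intro!: derivative_eq_intros d)
      have D: "((\<lambda>y. occ_flow I g 0 y j) has_real_derivative th j x) (at x)"
      proof (cases "j \<le> I")
        case True
        then show ?thesis using s[OF True] by (simp add: occ_flow_def th_def)
      next
        case False
        have "((\<lambda>y. (y - 0) - (\<Sum>i\<le>I. (\<Sum>k\<le>i. g 0 k) - (\<Sum>k\<le>i. g y k))) has_real_derivative 1 - (\<Sum>i\<le>I. - (\<Sum>k\<le>i. h k x))) (at x)"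
          by (intro DERIV_diff DERIV_sum s) (auto intro!: derivative_eq_intros)
        then show ?thesis using False by (simp add: occ_flow_def th_def)
      qed
      moreover have "occ_rate I g x j = th j x"
      proof -
        have "(\<Sum>k\<le>i. deriv (\<lambda>y. g y k) x) = (\<Sum>k\<le>i. h k x)" if "i \<le> I + 1" for i
          by (rule sum.cong) (use dv that in auto)
        then show ?thesis using j by (auto simp: occ_rate_def th_def Let_def intro!: sum.cong)
      qed
      ultimately show "((\<lambda>y. occ_flow I g 0 y j) has_real_derivative th j x) (at x) \<and> occ_rate I g x j = th j x"
        by blast
    qed
  qed
  show ?thesis by (rule that[of th]) (use int_th flow ae' in auto)
qed


lemma adm_0_abs_cont:
  assumes "g \<in> admissible_paths I \<beta> 0" "0 \<le> \<beta>"
  shows "abs_cont_on 0 \<beta> (\<lambda>x. g x j)"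
  unfolding abs_cont_on_def
proof (intro allI impI)
  fix e :: real assume "e > 0"
  show "\<exists>d>0. \<forall>(m::nat) (u::nat \<Rightarrow> real) v. (\<forall>k<m. 0 \<le> u k \<and> u k \<le> v k \<and> v k \<le> \<beta>) \<and>
      (\<forall>k<m. \<forall>l<m. k \<noteq> l \<longrightarrow> v k \<le> u l \<or> v l \<le> u k) \<and> (\<Sum>k<m. v k - u k) < d \<longrightarrow>
      (\<Sum>k<m. \<bar>g (v k) j - g (u k) j\<bar>) < e"
  proof (rule exI[of _ e], intro conjI allI impI, goal_cases)
    case (2 m u v)
    then have uv: "\<forall>k<m. 0 \<le> u k \<and> u k \<le> v k \<and> v k \<le> \<beta>" and s: "(\<Sum>k<m. v k - u k) < e" by auto
    have "(\<Sum>k<m. \<bar>g (v k) j - g (u k) j\<bar>) \<le> (\<Sum>k<m. v k - u k)"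
      
    proof (rule sum_mono)
      fix k assume "k \<in> {..<m}"
      then show "\<bar>g (v k) j - g (u k) j\<bar> \<le> v k - u k"
        using adm_0_Lipschitz[OF assms, of "v k" j "u k"] uv by auto
    qed
    with s show ?case by simp
  qed (use \<open>e > 0\<close> in auto)
qed

lemma AE_interior: "(AE x in lborel. x \<in> {a<..<b::real} \<longrightarrow> P x) \<longleftrightarrow> (AE x in lborel. x \<in> {a..b} \<longrightarrow> P x)"
proof
  assume P: "AE x in lborel. x \<in> {a<..<b} \<longrightarrow> P x"
  have "AE x in lborel. x \<noteq> a" "AE x in lborel. x \<noteq> b" using AE_lborel_singleton by auto
  with P show "AE x in lborel. x \<in> {a..b} \<longrightarrow> P x"
    by eventually_elim auto
next
  assume "AE x in lborel. x \<in> {a..b} \<longrightarrow> P x"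
  then show "AE x in lborel. x \<in> {a<..<b} \<longrightarrow> P x" by eventually_elim auto
qed

text \<open>Each endpoint contributes an error of at most \<open>e/2\<close> times its distance from
  \<open>x\<close>, and the two distances add up to \<open>b n - a n\<close> because
  \<open>x\<close> lies between. This permits difference quotients over the grid cells that contain
  \<open>x\<close>.\<close>

lemma straddle_quotient_tendsto:
  fixes f :: "real \<Rightarrow> real"
  assumes f: "(f has_real_derivative D) (at x)"
    and ab: "\<And>n. a n \<le> x" "\<And>n. x \<le> b n" "\<And>n::nat. a n < b n" and lim: "(\<lambda>n. b n - a n) \<longlonglongrightarrow> 0"
  shows "(\<lambda>n. (f (b n) - f (a n)) / (b n - a n)) \<longlonglongrightarrow> D"
  unfolding tendsto_iff
proof (intro allI impI)
  fix e :: real assume "e > 0"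
  from f have "(f has_derivative (\<lambda>h. D * h)) (at x)" by (simp add: has_field_derivative_def)
  then obtain d where d: "d > 0" "\<And>y. \<bar>y - x\<bar> < d \<Longrightarrow> \<bar>f y - f x - D * (y - x)\<bar> \<le> e/2 * \<bar>y - x\<bar>"
    using \<open>e > 0\<close> unfolding has_derivative_at_alt by (metis half_gt_zero real_norm_def)
  have "\<forall>\<^sub>F n in sequentially. \<bar>b n - a n\<bar> < d"
    using lim d(1) unfolding tendsto_iff by (auto simp: dist_real_def)
  then show "\<forall>\<^sub>F n in sequentially. dist ((f (b n) - f (a n)) / (b n - a n)) D < e"
  proof eventually_elim
    case (elim n)
    have "\<bar>a n - x\<bar> < d" "\<bar>b n - x\<bar> < d" using elim ab(1,2)[of n] by auto
    then have "\<bar>f (a n) - f x - D * (a n - x)\<bar> \<le> e/2 * (x - a n)" "\<bar>f (b n) - f x - D * (b n - x)\<bar> \<le> e/2 * (b n - x)"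
      using d(2)[of "a n"] d(2)[of "b n"] ab(1,2)[of n] by simp_all
    moreover have "f (b n) - f (a n) - D * (b n - a n) = (f (b n) - f x - D * (b n - x)) - (f (a n) - f x - D * (a n - x))"
      by (simp add: algebra_simps)
    ultimately have "\<bar>f (b n) - f (a n) - D * (b n - a n)\<bar> \<le> e/2 * (b n - x) + e/2 * (x - a n)" by linarith
    then have *: "\<bar>f (b n) - f (a n) - D * (b n - a n)\<bar> \<le> e/2 * (b n - a n)" by (simp add: field_simps)
    have pos: "b n - a n > 0" using ab(3)[of n] by simp
    have "\<bar>(f (b n) - f (a n)) / (b n - a n) - D\<bar> = \<bar>f (b n) - f (a n) - D * (b n - a n)\<bar> / (b n - a n)"
      using pos by (simp add: field_simps abs_if)
    also have "\<dots> \<le> e/2" using * pos by (simp add: pos_divide_le_eq)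
    finally show ?case using \<open>e > 0\<close> by (simp add: dist_real_def)
  qed
qed

lemma occ_flow_from_0: "occ_flow I g 0 t j - occ_flow I g 0 s j = occ_flow I g s t j"
  using occ_flow_add[of I g 0 s j t] by simp

text \<open>The almost-everywhere condition on rates becomes a family of inequalities between
  finitely many values of the path. In one direction a rate is a limit of nonnegative flow
  quotients, in the other a flow is the integral of a nonnegative rate; the normalisation of the
  rates is built into both definitions.\<close>

lemma valid_occ_iff_adm:
  assumes "\<beta> > 0"
  shows "valid_occ I \<beta> g \<longleftrightarrow> g \<in> admissible_paths I \<beta> 0"
proof
  assume g: "g \<in> admissible_paths I \<beta> 0"
  have b: "0 \<le> \<beta>" using assms by simp
  have ac: "abs_cont_on 0 \<beta> (\<lambda>x. g x j)" for j by (rule adm_0_abs_cont[OF g b])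
  obtain th where th: "AE x in lborel. x \<in> {0<..<\<beta>} \<longrightarrow> (\<forall>j\<le>I+1. ((\<lambda>y. occ_flow I g 0 y j) has_real_derivative th j x) (at x) \<and> occ_rate I g x j = th j x)"
    by (rule occ_rate_density[of \<beta> I g, OF assms ac]) blast
  have "AE x in lborel. x \<in> {0<..<\<beta>} \<longrightarrow> occ_rate I g x \<in> occ_simplex I"
    using th
  proof eventually_elim
    case (elim x)
    show ?case
    proof
      assume x: "x \<in> {0<..<\<beta>}"
      have nn: "0 \<le> occ_rate I g x j" if j: "j \<le> I + 1" for j
      proof -
        have D: "((\<lambda>y. occ_flow I g 0 y j) has_real_derivative occ_rate I g x j) (at x)" using elim x j by auto
        let ?b = "\<lambda>n. x + (\<beta> - x) / (real n + 2)"
        have "?b n \<le> x + (\<beta> - x)" for n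
        proof -
          have "(\<beta> - x) * 1 \<le> (\<beta> - x) * (real n + 2)" using x by (intro mult_left_mono) auto
          then have "(\<beta> - x) / (real n + 2) \<le> \<beta> - x" by (subst pos_divide_le_eq) auto
          then show ?thesis by simp
        qed
        then have bn: "x < ?b n" "?b n \<le> \<beta>" for n using x by auto
        have l: "(\<lambda>n. ?b n - x) \<longlonglongrightarrow> 0" by real_asymp
        have "(\<lambda>n. (occ_flow I g 0 (?b n) j - occ_flow I g 0 x j) / (?b n - x)) \<longlonglongrightarrow> occ_rate I g x j"
          by (rule straddle_quotient_tendsto[OF D _ _ _ l]) (use bn less_imp_le in auto)
        moreover have "0 \<le> (occ_flow I g 0 (?b n) j - occ_flow I g 0 x j) / (?b n - x)" for n
          unfolding occ_flow_from_0 using adm_flow_le(2)[OF g, of x "?b n" j] x bn[of n] j by auto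
        ultimately show ?thesis by (intro LIMSEQ_le_const) auto
      qed
      moreover have "(\<Sum>j\<le>I+1. occ_rate I g x j) = 1" by (simp add: occ_rate_def Let_def)
      moreover have "occ_rate I g x j = 0" if "j > I + 1" for j using that by (simp add: occ_rate_def Let_def)
      ultimately show "occ_rate I g x \<in> occ_simplex I" 
        unfolding occ_simplex_def by (auto, metis linorder_le_less_linear order_refl Suc_eq_plus1)
    qed
  qed
  then show "valid_occ I \<beta> g"
    unfolding valid_occ_def using adm_0_Dsp[OF g b] ac admD(1)[OF g] unfolding AE_interior by auto
next
  assume v: "valid_occ I \<beta> g"
  then have ac: "\<And>j. j \<le> I + 1 \<Longrightarrow> abs_cont_on 0 \<beta> (\<lambda>x. g x j)" by (simp add: valid_occ_def)
  obtain th where th: 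
    "\<forall>j\<le>I+1. set_integrable lborel {0..\<beta>} (th j)"
    "\<forall>j s t. j \<le> I + 1 \<and> 0 \<le> s \<and> s \<le> t \<and> t \<le> \<beta> \<longrightarrow> occ_flow I g s t j = (LINT x:{s..t}|lborel. th j x)"
    "AE x in lborel. x \<in> {0<..<\<beta>} \<longrightarrow> (\<forall>j\<le>I+1. ((\<lambda>y. occ_flow I g 0 y j) has_real_derivative th j x) (at x) \<and> occ_rate I g x j = th j x)"
    by (rule occ_rate_density[of \<beta> I g, OF assms ac]) blast+
  have rate: "AE x in lborel. x \<in> {0..\<beta>} \<longrightarrow> occ_rate I g x \<in> occ_simplex I" using v by (simp add: valid_occ_def)
  have th_nn: "AE x in lborel. x \<in> {0..\<beta>} \<longrightarrow> 0 \<le> th j x" if "j \<le> I + 1" for j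
    using th(3) rate unfolding AE_interior[symmetric]
  proof eventually_elim
    case (elim x)
    then show ?case using occ_simplexD(1)[of "occ_rate I g x" I j] that by auto
  qed
  have flow: "0 \<le> occ_flow I g s t j" if "0 \<le> s" "s \<le> t" "t \<le> \<beta>" "j \<le> I + 1" for s t j
  proof -
    have "occ_flow I g s t j = (LINT x:{s..t}|lborel. th j x)" using th(2) that by simp
    also have "\<dots> \<ge> 0" unfolding set_lebesgue_integral_def
      by (rule integral_nonneg_AE) (use th_nn[OF that(4)] in eventually_elim, use that in \<open>auto simp: indicator_def\<close>)
    finally show ?thesis .
  qed
  have D: "g \<in> Dsp I \<beta>" and s: "\<forall>x\<in>{0..\<beta>}. g x \<in> occ_simplex I" using v by (auto simp: valid_occ_def)
  have "g t \<in> occ_simplex I" for t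
  proof -
    consider "t < 0" | "t \<in> {0..\<beta>}" | "t > \<beta>" by fastforce
    then show ?thesis by cases (use D s assms in \<open>auto simp: Dsp_def\<close>)
  qed
  then show "g \<in> admissible_paths I \<beta> 0" using D flow by (auto simp: admissible_paths_def Dsp_def)
qed

section \<open>The rate function and its discretisation\<close>

text \<open>At fixed \<open>th\<close> and \<open>g\<close> the maximum over \<open>s\<close> is
  attained at \<open>s = th/g\<close>, where the last two terms cancel and the relative entropy is
  left. At fixed \<open>s\<close> the functional is linear in \<open>th\<close> and \<open>g\<close>
  together.\<close>

definition gibbs :: "nat \<Rightarrow> (nat \<Rightarrow> real) \<Rightarrow> (nat \<Rightarrow> real) \<Rightarrow> (nat \<Rightarrow> real) \<Rightarrow> real" where
  "gibbs I s th g = (\<Sum>j\<le>I+1. th j * ln (s j) + th j - s j * g j)"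

lemma ln_ge_tangent:
  fixes r s :: real
  assumes "r > 0" "s > 0"
  shows "ln s + 1 - s / r \<le> ln r"
  using ln_le_minus_one[of "s / r"] assms by (simp add: ln_div)

lemma gibbs_le_rel_entropy:
  assumes "\<And>j. j \<le> I + 1 \<Longrightarrow> 0 \<le> th j" "\<And>j. j \<le> I + 1 \<Longrightarrow> 0 \<le> g j" "\<And>j. j \<le> I + 1 \<Longrightarrow> 0 < s j"
  shows "ereal (gibbs I s th g) \<le> rel_entropy I th g"
proof (cases "\<exists>i\<le>I+1. th i > 0 \<and> g i = 0")
  case True
  then show ?thesis by (simp add: rel_entropy_def)
next
  case False
  have "gibbs I s th g \<le> (\<Sum>i\<le>I+1. if th i = 0 then 0 else th i * ln (th i / g i))"
    unfolding gibbs_def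
  proof (rule sum_mono)
    fix j assume "j \<in> {..I+1}"
    then have j: "j \<le> I + 1" by simp
    show "th j * ln (s j) + th j - s j * g j \<le> (if th j = 0 then 0 else th j * ln (th j / g j))"
    proof (cases "th j = 0")
      case True
      then show ?thesis using assms(2,3)[OF j] by simp
    next
      case c: False
      then have pos: "th j > 0" "g j > 0" using assms(1,2)[OF j] False j by (auto simp: less_le)
      have "th j * (ln (s j) + 1 - s j / (th j / g j)) \<le> th j * ln (th j / g j)"
        using pos assms(3)[OF j] by (intro mult_left_mono ln_ge_tangent) auto
      then show ?thesis using pos by (simp add: algebra_simps)
    qed
  qed
  then show ?thesis using False by (simp only: rel_entropy_def if_False ereal_less_eq)
qed

text \<open>The optimal multiplier \<open>th/g\<close> has to be replaced where it is infinite or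
  zero, since multipliers must be finite and positive.\<close>

lemma rel_entropy_gibbs_approx:
  fixes M :: real
  assumes M: "ereal M < rel_entropy I th g"
    and nn: "\<And>j. j \<le> I + 1 \<Longrightarrow> 0 \<le> th j" "\<And>j. j \<le> I + 1 \<Longrightarrow> 0 \<le> g j"
  obtains s where "\<And>j. 0 < s j" "M < gibbs I s th g"
proof (cases "\<exists>i\<le>I+1. th i > 0 \<and> g i = 0")
  case True
  then obtain i where i: "i \<le> I + 1" "th i > 0" "g i = 0" by auto
  define c where "c = (\<Sum>j\<le>I+1. th j - g j)"
  \<comment> \<open>The exponent is solved so that the functional equals \<open>M + 1\<close>. A
    large multiplier at \<open>i\<close> has no price because \<open>g i = 0\<close>.\<close>
  define s where "s j = (if j = i then exp ((M + 1 - c) / th i) else 1)" for j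
  have "gibbs I s th g = (\<Sum>j\<le>I+1. (th j - g j) + (if j = i then M + 1 - c else 0))"
    unfolding gibbs_def by (rule sum.cong) (use i in \<open>auto simp: s_def\<close>)
  also have "\<dots> = M + 1" using i by (simp add: sum.distrib c_def del: sum.atMost_Suc)
  finally have "M < gibbs I s th g" by simp
  with that[of s] show ?thesis by (simp add: s_def)
next
  case False
  define D where "D = (\<Sum>i\<le>I+1. if th i = 0 then 0 else th i * ln (th i / g i))"
  have MD: "M < D" using M False by (simp only: rel_entropy_def if_False D_def less_ereal.simps)
  define c where "c = (\<Sum>j\<le>I+1. g j)"
  have c: "0 \<le> c" unfolding c_def by (rule sum_nonneg) (use nn in auto)
  \<comment> \<open>Where \<open>th j = 0\<close> the multiplier \<open>e\<close> costs
    \<open>e * g j\<close>; this size keeps the total cost within half of the gap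
    \<open>D - M\<close>.\<close>
  define e where "e = (D - M) / (2 * (c + 1))"
  have e: "e > 0" using MD c by (simp add: e_def)
  define s where "s j = (if j \<le> I + 1 \<and> th j \<noteq> 0 then th j / g j else e)" for j
  have pos: "th j > 0 \<and> g j > 0" if "j \<le> I + 1" "th j \<noteq> 0" for j
    using nn[OF that(1)] that False by (auto simp: less_le)
  have s: "0 < s j" for j using pos e by (auto simp: s_def)
  have "D - e * c \<le> gibbs I s th g"
    unfolding D_def c_def gibbs_def sum_distrib_left sum_subtractf[symmetric]
  proof (rule sum_mono)
    fix j assume "j \<in> {..I+1}"
    then have j: "j \<le> I + 1" by simp
    show "(if th j = 0 then 0 else th j * ln (th j / g j)) - e * g j \<le> th j * ln (s j) + th j - s j * g j"
      using j pos[OF j] nn[OF j] e by (auto simp: s_def)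
  qed
  moreover have "e * c < D - M"
  proof -
    have "e * c \<le> e * (c + 1)" using e by simp
    also have "\<dots> = (D - M) / 2" using c by (simp add: e_def field_simps)
    also have "\<dots> < D - M" using MD by simp
    finally show ?thesis .
  qed
  ultimately have "M < gibbs I s th g" by simp
  with s that show ?thesis by blast
qed

section \<open>Bounding the rate function by costs on a grid\<close>

lemma ereal_le_enn2ereal: "ennreal r \<le> X \<Longrightarrow> ereal r \<le> enn2ereal X"
proof -
  assume "ennreal r \<le> X"
  then have "enn2ereal (ennreal r) \<le> enn2ereal X" by (simp add: less_eq_ennreal.rep_eq)
  moreover have "ereal r \<le> enn2ereal (ennreal r)" by (cases "0 \<le> r") (auto simp: enn2ereal_ennreal ennreal_neg zero_ennreal.rep_eq)
  ultimately show ?thesis by (rule order_trans[rotated])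
qed

lemma ennreal_integral_le_nn_integral:
  assumes "integrable M f"
  shows "ennreal (integral\<^sup>L M f) \<le> (\<integral>\<^sup>+x. ennreal (f x) \<partial>M)"
proof -
  have i: "integrable M (\<lambda>x. max 0 (f x))" using assms by simp
  have "integral\<^sup>L M f \<le> integral\<^sup>L M (\<lambda>x. max 0 (f x))"
    by (rule integral_mono[OF assms i]) simp
  then have "ennreal (integral\<^sup>L M f) \<le> ennreal (integral\<^sup>L M (\<lambda>x. max 0 (f x)))" by (rule ennreal_leI)
  also have "\<dots> = (\<integral>\<^sup>+x. ennreal (max 0 (f x)) \<partial>M)"
    by (rule nn_integral_eq_integral[symmetric, OF i]) simp
  also have "\<dots> = (\<integral>\<^sup>+x. ennreal (f x) \<partial>M)"
    by (rule nn_integral_cong) (simp add: max_def ennreal_neg)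
  finally show ?thesis .
qed

text \<open>Gibbs' inequality with multipliers that are constant on each block. The rates integrate
  to flows, and the occupancy inside a block is replaced by its value at the left end plus the block
  length, which dominates it by the Lipschitz property. The grid may cover only a part of the time
  interval, which the lower bound uses to omit the initial layer.\<close>

lemma occ_J_ge_gibbs:
  assumes "\<beta> > 0" and g: "g \<in> admissible_paths I \<beta> 0" and t: "mono t" "0 \<le> t 0" "t N \<le> \<beta>" and s: "\<And>k j. 0 < s k j"
  shows "ereal (\<Sum>k<N. \<Sum>j\<le>I+1. occ_flow I g (t k) (t (Suc k)) j * (ln (s k j) + 1)
      - (t (Suc k) - t k) * (s k j * (g (t k) j + (t (Suc k) - t k)))) \<le> occ_J I \<beta> g"
proof -
  have b: "0 \<le> \<beta>" using assms by simp
  have v: "valid_occ I \<beta> g" using valid_occ_iff_adm[OF assms(1)] g by simp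
  obtain th where th: "\<forall>j\<le>I+1. set_integrable lborel {0..\<beta>} (th j)"
    "\<forall>j s t. j \<le> I + 1 \<and> 0 \<le> s \<and> s \<le> t \<and> t \<le> \<beta> \<longrightarrow> occ_flow I g s t j = (LINT x:{s..t}|lborel. th j x)"
    "AE x in lborel. x \<in> {0<..<\<beta>} \<longrightarrow> (\<forall>j\<le>I+1. ((\<lambda>y. occ_flow I g 0 y j) has_real_derivative th j x) (at x) \<and> occ_rate I g x j = th j x)"
    by (rule occ_rate_density[of \<beta> I g, OF assms(1) adm_0_abs_cont[OF g b]]) blast+
  have tk: "0 \<le> t k" "t k \<le> t (Suc k)" for k using t by (auto simp: mono_def intro: order_trans)
  have tkN: "t k \<le> \<beta>" if "k \<le> N" for k using t that by (meson monoD order_trans)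
  define q where "q k x = (\<Sum>j\<le>I+1. th j x * (ln (s k j) + 1) - s k j * (g (t k) j + (t (Suc k) - t k)))" for k x
  \<comment> \<open>Half-open blocks are disjoint, so at every time at most one summand of
    \<open>r\<close> is nonzero.\<close>
  define B where "B k = {t k<..t (Suc k)}" for k
  define r where "r x = (\<Sum>k<N. indicator (B k) x * q k x)" for x
  have si: "set_integrable lborel (B k) (th j)" if "k < N" "j \<le> I + 1" for k j
    by (rule set_integrable_subset[of _ "{0..\<beta>}"]) (use th(1) that tk[of k] tkN[of "Suc k"] in \<open>auto simp: B_def\<close>)
  have one: "set_integrable lborel (B k) (\<lambda>x. c::real)" for k c
    unfolding set_integrable_def B_def using tk[of k] by (auto simp: integrable_indicator_iff)
  have sq: "set_integrable lborel (B k) (q k)" if "k < N" for k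
    unfolding q_def by (intro set_integrable_sum set_integral_diff(1) one set_integrable_mult_left) (use si[OF that] in auto)
  have flow: "(LINT x:B k|lborel. th j x) = occ_flow I g (t k) (t (Suc k)) j" if "k < N" "j \<le> I + 1" for k j
  proof -
    have "(LINT x:B k|lborel. th j x) = (LINT x:{t k..t (Suc k)}|lborel. th j x)"
    proof (rule set_integral_discrete_difference[of "{t k}"])
      show "B k - {t k..t (Suc k)} \<union> ({t k..t (Suc k)} - B k) \<subseteq> {t k}" by (auto simp: B_def)
    qed (auto simp: sets.sets_Collect)
    also have "\<dots> = occ_flow I g (t k) (t (Suc k)) j" using th(2) that tk[of k] tkN[of "Suc k"] by auto
    finally show ?thesis .
  qed
  have cB: "(LINT x:B k|lborel. c) = (t (Suc k) - t k) * c" for k and c :: real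
    using tk[of k] by (simp add: set_lebesgue_integral_def B_def)
  have iq: "(LINT x:B k|lborel. q k x) = (\<Sum>j\<le>I+1. occ_flow I g (t k) (t (Suc k)) j * (ln (s k j) + 1)
      - (t (Suc k) - t k) * (s k j * (g (t k) j + (t (Suc k) - t k))))" if "k < N" for k
  proof -
    have "(LINT x:B k|lborel. q k x) = (\<Sum>j\<le>I+1. LINT x:B k|lborel. th j x * (ln (s k j) + 1) - s k j * (g (t k) j + (t (Suc k) - t k)))"
      unfolding q_def by (rule set_integral_sum) (intro set_integral_diff(1) one set_integrable_mult_left, use si[OF that] in auto)
    also have "\<dots> = (\<Sum>j\<le>I+1. occ_flow I g (t k) (t (Suc k)) j * (ln (s k j) + 1)
      - (t (Suc k) - t k) * (s k j * (g (t k) j + (t (Suc k) - t k))))"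
    proof (rule sum.cong)
      fix j assume "j \<in> {..I+1}"
      then have j: "j \<le> I + 1" by simp
      have "set_integrable lborel (B k) (\<lambda>x. th j x * (ln (s k j) + 1))" using si[OF that j] by simp
      then show "(LINT x:B k|lborel. th j x * (ln (s k j) + 1) - s k j * (g (t k) j + (t (Suc k) - t k)))
        = occ_flow I g (t k) (t (Suc k)) j * (ln (s k j) + 1) - (t (Suc k) - t k) * (s k j * (g (t k) j + (t (Suc k) - t k)))"
        using flow[OF that j] by (simp add: set_integral_diff(2)[OF _ one] cB)
    qed simp
    finally show ?thesis .
  qed
  have ir: "integrable lborel r"
    unfolding r_def using sq by (intro Bochner_Integration.integrable_sum) (auto simp: set_integrable_def)
  have intr: "integral\<^sup>L lborel r = (\<Sum>k<N. LINT x:B k|lborel. q k x)"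
    unfolding r_def set_lebesgue_integral_def using sq
    by (subst Bochner_Integration.integral_sum) (auto simp: set_integrable_def)
  have disj: "l = k" if "x \<in> B k" "x \<in> B l" for x k l
  proof (rule ccontr)
    assume "l \<noteq> k"
    then consider "Suc l \<le> k" | "Suc k \<le> l" by linarith
    then show False
    proof cases
      case 1
      then have "t (Suc l) \<le> t k" using t(1) by (simp add: monoD)
      then show False using that by (simp add: B_def)
    next
      case 2
      then have "t (Suc k) \<le> t l" using t(1) by (simp add: monoD)
      then show False using that by (simp add: B_def)
    qed
  qed
  have rate: "AE x in lborel. x \<in> {0<..<\<beta>} \<longrightarrow> occ_rate I g x \<in> occ_simplex I"
    using v unfolding valid_occ_def AE_interior by blast
  have neq: "AE x in lborel. x \<noteq> \<beta>" using AE_lborel_singleton[of \<beta>] by simp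
  have "ennreal (integral\<^sup>L lborel r) \<le> (\<integral>\<^sup>+x. ennreal (r x) \<partial>lborel)"
    by (rule ennreal_integral_le_nn_integral[OF ir])
  also have "\<dots> \<le> (\<integral>\<^sup>+ x. indicator {0..\<beta>} x * e2ennreal (rel_entropy I (occ_rate I g x) (g x)) \<partial>lborel)"
  proof (rule nn_integral_mono_AE)
    show "AE x in lborel. ennreal (r x) \<le> indicator {0..\<beta>} x * e2ennreal (rel_entropy I (occ_rate I g x) (g x))"
      using th(3) rate neq
    proof eventually_elim
      case (elim x)
      show ?case
      proof (cases "\<exists>k<N. x \<in> B k")
        case False
        then have "r x = 0" unfolding r_def by (intro sum.neutral) (auto simp: indicator_def)
        then show ?thesis by simp
      next
        case True
        then obtain k where k: "k < N" "x \<in> B k" by auto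
        then have x: "x \<in> {0<..<\<beta>}" "t k \<le> x" "x \<le> t (Suc k)" using tk[of k] tkN[of "Suc k"] elim(3) by (auto simp: B_def)
        have "occ_rate I g x \<in> occ_simplex I" using elim(2) x(1) by simp
        note th_nn = occ_simplexD(1)[OF this]
        have "indicator (B l) x = (if l = k then 1 else 0 :: real)" for l
          using disj[OF k(2), of l] k(2) by (cases "x \<in> B l") auto
        then have "r x = (\<Sum>l<N. if l = k then q k x else 0)"
          unfolding r_def by (intro sum.cong) simp_all
        also have "\<dots> = q k x" using k(1) by simp
        also have "\<dots> \<le> gibbs I (s k) (occ_rate I g x) (g x)"
          unfolding q_def gibbs_def
        proof (rule sum_mono)
          fix j assume "j \<in> {..I+1}"
          then have j: "j \<le> I + 1" by simp
          have "g x j \<le> g (t k) j + (t (Suc k) - t k)"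
            using adm_0_Lipschitz[OF g b, of x j "t k"] x by auto
          then have "s k j * g x j \<le> s k j * (g (t k) j + (t (Suc k) - t k))"
            using s[of k j] by (intro mult_left_mono) auto
          then show "th j x * (ln (s k j) + 1) - s k j * (g (t k) j + (t (Suc k) - t k))
            \<le> occ_rate I g x j * ln (s k j) + occ_rate I g x j - s k j * g x j"
            using elim(1) x(1) j by (simp add: algebra_simps)
        qed
        finally have "ereal (r x) \<le> ereal (gibbs I (s k) (occ_rate I g x) (g x))" by simp
        also have "\<dots> \<le> rel_entropy I (occ_rate I g x) (g x)"
          by (rule gibbs_le_rel_entropy) (use th_nn s occ_simplexD(1)[OF admD(1)[OF g]] in auto)
        finally have "e2ennreal (ereal (r x)) \<le> e2ennreal (rel_entropy I (occ_rate I g x) (g x))" by (rule e2ennreal_mono)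
        then show ?thesis using x by simp
      qed
    qed
  qed
  finally have "ereal (integral\<^sup>L lborel r) \<le> occ_J I \<beta> g"
    using v by (simp add: occ_J_def ereal_le_enn2ereal)
  then show ?thesis unfolding intr using iq by simp
qed

definition block_rate :: "nat \<Rightarrow> real \<Rightarrow> nat \<Rightarrow> (real \<Rightarrow> nat \<Rightarrow> real) \<Rightarrow> nat \<Rightarrow> nat \<Rightarrow> real" where
  "block_rate I \<beta> N g k j = occ_flow I g (real k * (\<beta> / real N)) (real (Suc k) * (\<beta> / real N)) j / (\<beta> / real N)"

text \<open>The shift by the mesh \<open>\<beta>/N\<close> in numerator and denominator makes the cost continuous in the path
  even where rates or occupancies vanish.\<close>

definition block_cost :: "nat \<Rightarrow> real \<Rightarrow> nat \<Rightarrow> (real \<Rightarrow> nat \<Rightarrow> real) \<Rightarrow> nat \<Rightarrow> real" where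
  "block_cost I \<beta> N g k = (\<Sum>j\<le>I+1. block_rate I \<beta> N g k j *
     ln ((block_rate I \<beta> N g k j + \<beta> / real N) / (g (real k * (\<beta> / real N)) j + \<beta> / real N)))"

definition disc_cost :: "nat \<Rightarrow> real \<Rightarrow> nat \<Rightarrow> (real \<Rightarrow> nat \<Rightarrow> real) \<Rightarrow> real" where
  "disc_cost I \<beta> N g = (\<Sum>k<N. \<beta> / real N * block_cost I \<beta> N g k)"

lemma grid_le: "\<beta> > 0 \<Longrightarrow> k \<le> N \<Longrightarrow> N > 0 \<Longrightarrow> real k * (\<beta> / real N) \<le> \<beta>"
  by (simp add: field_simps)

lemma block_rate_simplex:
  assumes "\<beta> > 0" "g \<in> admissible_paths I \<beta> 0" "k < N"
  shows "j \<le> I + 1 \<Longrightarrow> 0 \<le> block_rate I \<beta> N g k j" "(\<Sum>j\<le>I+1. block_rate I \<beta> N g k j) = 1"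
proof -
  have N: "N > 0" using assms by simp
  then have d: "0 < \<beta> / real N" using assms by simp
  have m: "real k * (\<beta> / real N) \<le> real (Suc k) * (\<beta> / real N)" using d by (intro mult_right_mono) auto
  show "0 \<le> block_rate I \<beta> N g k j" if "j \<le> I + 1"
    unfolding block_rate_def
    using adm_flow_le(2)[OF assms(2) _ m _ that] grid_le[of \<beta> "Suc k" N] assms N d by (auto intro!: divide_nonneg_pos)
  have "(\<Sum>j\<le>I+1. block_rate I \<beta> N g k j) = (real (Suc k) * (\<beta> / real N) - real k * (\<beta> / real N)) / (\<beta> / real N)"
    unfolding block_rate_def sum_divide_distrib[symmetric] sum_occ_flow ..
  also have "real (Suc k) * (\<beta> / real N) - real k * (\<beta> / real N) = \<beta> / real N"
    by (simp only: of_nat_Suc distrib_right mult_1_left add_diff_cancel_right' add.commute)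
  finally show "(\<Sum>j\<le>I+1. block_rate I \<beta> N g k j) = 1" using assms(1) N by simp
qed

text \<open>The tangent bound produces the term \<open>s * (y + d)\<close> with a factor
  \<open>a / (a + d)\<close>, which is at most 1. Hence the shifted block terms dominate every Gibbs
  functional with occupancy \<open>y + d\<close>.\<close>

lemma mult_ln_shift_ge:
  fixes a d y s :: real
  assumes "0 \<le> a" "0 < d" "0 \<le> y" "0 < s"
  shows "a * ln s + a - s * (y + d) \<le> a * ln ((a + d) / (y + d))"
proof -
  have "a * (ln s + 1 - s / ((a + d) / (y + d))) \<le> a * ln ((a + d) / (y + d))"
    using assms by (intro mult_left_mono ln_ge_tangent) auto
  moreover have "a * (s / ((a + d) / (y + d))) \<le> s * (y + d)"
  proof -
    have "a * (s / ((a + d) / (y + d))) = s * (y + d) * (a / (a + d))" by simp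
    also have "\<dots> \<le> s * (y + d) * 1" using assms by (intro mult_left_mono) auto
    finally show ?thesis by simp
  qed
  ultimately show ?thesis by (simp add: algebra_simps)
qed

lemma block_cost_ge:
  assumes "\<beta> > 0" "g \<in> admissible_paths I \<beta> 0" "k < N" "\<And>j. 0 < s j"
  shows "(\<Sum>j\<le>I+1. block_rate I \<beta> N g k j * ln (s j) + block_rate I \<beta> N g k j
      - s j * (g (real k * (\<beta> / real N)) j + \<beta> / real N)) \<le> block_cost I \<beta> N g k"
  unfolding block_cost_def
  by (intro sum_mono mult_ln_shift_ge) (use assms block_rate_simplex(1)[OF assms(1-3)] occ_simplexD(1)[OF admD(1)[OF assms(2)]] in auto)

text \<open>With all multipliers equal to 1 the rates and occupancies each sum to one and cancel;
  only one mesh width per level is left.\<close>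

lemma block_cost_lower:
  assumes "\<beta> > 0" "g \<in> admissible_paths I \<beta> 0" "k < N"
  shows "- (real (I+2) * (\<beta> / real N)) \<le> block_cost I \<beta> N g k"
proof -
  have "(\<Sum>j\<le>I+1. block_rate I \<beta> N g k j * ln 1 + block_rate I \<beta> N g k j
      - 1 * (g (real k * (\<beta> / real N)) j + \<beta> / real N)) = - (real (I+2) * (\<beta> / real N))"
    using block_rate_simplex(2)[OF assms] occ_simplexD(3)[OF admD(1)[OF assms(2)], of "real k * (\<beta> / real N)"]
    by (simp add: sum_subtractf sum.distrib del: sum.atMost_Suc)
  with block_cost_ge[OF assms, of "\<lambda>j. 1"] show ?thesis by simp
qed

text \<open>The multipliers \<open>(a + d) / (y + d)\<close> reproduce the block cost, and
  \<open>s * (y + d) = a + d\<close> exceeds \<open>a\<close> by \<open>d\<close> for each of the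
  \<open>I + 2\<close> levels. Over time \<beta> this accumulates to the stated error.\<close>

lemma disc_cost_le_occ_J:
  assumes "\<beta> > 0" "g \<in> admissible_paths I \<beta> 0" "N > 0"
  shows "ereal (disc_cost I \<beta> N g - \<beta> * real (I+2) * (\<beta> / real N)) \<le> occ_J I \<beta> g"
proof -
  define d where "d = \<beta> / real N"
  have d: "d > 0" using assms by (simp add: d_def)
  define t where "t k = real k * d" for k
  define a where "a k j = occ_flow I g (t k) (t (Suc k)) j / d" for k j
  \<comment> \<open>The value 1 is a filler: positivity is required for all indices.\<close>
  define s where "s k j = (if k < N \<and> j \<le> I + 1 then (a k j + d) / (g (t k) j + d) else 1)" for k j
  have ar: "a k j = block_rate I \<beta> N g k j" for k j by (simp add: a_def block_rate_def t_def d_def)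
  have ann: "0 \<le> a k j" if "k < N" "j \<le> I + 1" for k j
    unfolding ar using block_rate_simplex(1)[OF assms(1,2) that] .
  have gnn: "0 \<le> g x j" for x j using occ_simplexD(1)[OF admD(1)[OF assms(2)]] .
  have m: "mono t" using d by (auto simp: mono_def t_def intro!: mult_right_mono)
  have tN: "t N \<le> \<beta>" using assms by (simp add: t_def d_def)
  have dt: "t (Suc k) - t k = d" for k by (simp add: t_def algebra_simps)
  have s: "0 < s k j" for k j using ann gnn d by (auto simp: s_def intro!: divide_pos_pos add_nonneg_pos)
  have "(\<Sum>j\<le>I+1. occ_flow I g (t k) (t (Suc k)) j * (ln (s k j) + 1)
      - (t (Suc k) - t k) * (s k j * (g (t k) j + (t (Suc k) - t k)))) = d * block_cost I \<beta> N g k - d * (real (I+2) * d)" if k: "k < N" for k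
  proof -
    have "(\<Sum>j\<le>I+1. occ_flow I g (t k) (t (Suc k)) j * (ln (s k j) + 1)
      - (t (Suc k) - t k) * (s k j * (g (t k) j + (t (Suc k) - t k)))) = (\<Sum>j\<le>I+1. d * (a k j * ln ((a k j + d) / (g (t k) j + d))) - d * d)"
    proof (rule sum.cong)
      fix j assume "j \<in> {..I+1}"
      then have j: "j \<le> I + 1" by simp
      have f: "occ_flow I g (t k) (t (Suc k)) j = d * a k j" using d by (simp add: a_def)
      have sj: "s k j = (a k j + d) / (g (t k) j + d)" using j k by (simp add: s_def)
      have "s k j * (g (t k) j + d) = a k j + d" unfolding sj using gnn[of "t k" j] d by simp
      then show "occ_flow I g (t k) (t (Suc k)) j * (ln (s k j) + 1)
        - (t (Suc k) - t k) * (s k j * (g (t k) j + (t (Suc k) - t k))) = d * (a k j * ln ((a k j + d) / (g (t k) j + d))) - d * d"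
        unfolding dt f sj[symmetric] using \<open>s k j * (g (t k) j + d) = a k j + d\<close>
        by (simp only: distrib_left right_diff_distrib mult_1_right mult.assoc)
    qed simp
    also have "\<dots> = d * block_cost I \<beta> N g k - d * (real (I+2) * d)"
      unfolding block_cost_def ar[symmetric] d_def[symmetric] t_def
      by (simp add: sum_subtractf sum_distrib_left algebra_simps del: sum.atMost_Suc)
    finally show ?thesis .
  qed
  then have "(\<Sum>k<N. \<Sum>j\<le>I+1. occ_flow I g (t k) (t (Suc k)) j * (ln (s k j) + 1)
      - (t (Suc k) - t k) * (s k j * (g (t k) j + (t (Suc k) - t k)))) = (\<Sum>k<N. d * block_cost I \<beta> N g k - d * (real (I+2) * d))"
    by simp
  also have "\<dots> = disc_cost I \<beta> N g - \<beta> * real (I+2) * d"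
    unfolding disc_cost_def d_def[symmetric] using assms by (simp add: sum_subtractf d_def)
  finally show ?thesis using occ_J_ge_gibbs[where s=s, OF assms(1,2) m _ tN s] d by (simp add: d_def t_def)
qed

text \<open>Fatou's lemma for the step functions \<open>X n\<close> formed by the block costs. At
  almost every \<open>x\<close> the rates and occupancies of the cell around \<open>x\<close>
  converge, so every fixed Gibbs functional passes to the limit, and the supremum over multipliers
  bounds the lower limit by the entropy.\<close>

lemma disc_cost_eventually_gt:
  assumes "\<beta> > 0" "g \<in> admissible_paths I \<beta> 0" and M: "ereal M < occ_J I \<beta> g"
  shows "eventually (\<lambda>N. M < disc_cost I \<beta> N g) sequentially"
proof -
  have b: "0 \<le> \<beta>" using assms by simp
  note g = assms(2)
  have v: "valid_occ I \<beta> g" using valid_occ_iff_adm[OF assms(1)] g by simp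
  define d where "d n = \<beta> / real (Suc n)" for n
  have d: "d n > 0" for n using assms by (simp add: d_def)
  have dlim: "d \<longlonglongrightarrow> 0" unfolding d_def by real_asymp
  \<comment> \<open>The added term is the bound of \<open>block_cost_lower\<close>. It makes the
    integrands nonnegative, and its integral \<open>err n\<close> vanishes in the limit.\<close>
  define c where "c n k = block_cost I \<beta> (Suc n) g k + real (I+2) * d n" for n k
  have c: "0 \<le> c n k" if "k < Suc n" for n k
    using block_cost_lower[OF assms(1) g that] by (simp add: c_def d_def)
  define X where "X n x = (\<Sum>k<Suc n. ennreal (c n k) * indicator {real k * d n..<real (Suc k) * d n} x)" for n x
  define err where "err n = \<beta> * real (I+2) * d n" for n
  have len: "real (Suc k) * d n - real k * d n = d n" "real k * d n \<le> real (Suc k) * d n" for k n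
    using d[of n] by (simp_all add: algebra_simps)
  have sum_c: "(\<Sum>k<Suc n. c n k * d n) = disc_cost I \<beta> (Suc n) g + err n" for n
  proof -
    have "(\<Sum>k<Suc n. c n k * d n) = (\<Sum>k<Suc n. d n * block_cost I \<beta> (Suc n) g k) + real (Suc n) * (real (I+2) * d n * d n)"
      by (simp add: c_def sum.distrib algebra_simps del: sum.lessThan_Suc)
    also have "real (Suc n) * (real (I+2) * d n * d n) = (real (Suc n) * d n) * real (I+2) * d n" by (simp only: mult_ac)
    also have "\<dots> = err n" by (simp add: err_def d_def)
    finally show ?thesis by (simp add: disc_cost_def d_def)
  qed
  have intX: "(\<integral>\<^sup>+x. X n x \<partial>lborel) = ennreal (disc_cost I \<beta> (Suc n) g + err n)" for n
  proof -
    have "(\<integral>\<^sup>+x. X n x \<partial>lborel) = (\<Sum>k<Suc n. ennreal (c n k) * ennreal (d n))"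
      unfolding X_def by (subst nn_integral_sum) (auto simp: nn_integral_cmult_indicator len d less_imp_le simp del: sum.lessThan_Suc of_nat_Suc)
    also have "\<dots> = (\<Sum>k<Suc n. ennreal (c n k * d n))"
    proof (rule sum.cong)
      fix k assume "k \<in> {..<Suc n}"
      then show "ennreal (c n k) * ennreal (d n) = ennreal (c n k * d n)"
        using c[of k n] d[of n] by (simp add: ennreal_mult less_imp_le)
    qed simp
    also have "\<dots> = ennreal (\<Sum>k<Suc n. c n k * d n)"
    proof (rule sum_ennreal)
      show "0 \<le> c n k * d n" if "k \<in> {..<Suc n}" for k
        using that c[of k n] d[of n] by (simp add: less_imp_le)
    qed
    also note sum_c
    finally show ?thesis .
  qed
  obtain th where th: 
    "AE x in lborel. x \<in> {0<..<\<beta>} \<longrightarrow> (\<forall>j\<le>I+1. ((\<lambda>y. occ_flow I g 0 y j) has_real_derivative th j x) (at x) \<and> occ_rate I g x j = th j x)"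
    by (rule occ_rate_density[of \<beta> I g, OF assms(1) adm_0_abs_cont[OF g b]]) blast+
  have rate: "AE x in lborel. x \<in> {0<..<\<beta>} \<longrightarrow> occ_rate I g x \<in> occ_simplex I"
    using v unfolding valid_occ_def AE_interior by blast
  have neq: "AE x in lborel. x \<noteq> \<beta>" "AE x in lborel. x \<noteq> 0" using AE_lborel_singleton by auto
  have "(\<integral>\<^sup>+ x. indicator {0..\<beta>} x * e2ennreal (rel_entropy I (occ_rate I g x) (g x)) \<partial>lborel)
      \<le> (\<integral>\<^sup>+ x. liminf (\<lambda>n. X n x) \<partial>lborel)"
  proof (rule nn_integral_mono_AE)
    show "AE x in lborel. indicator {0..\<beta>} x * e2ennreal (rel_entropy I (occ_rate I g x) (g x)) \<le> liminf (\<lambda>n. X n x)"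
      using th rate neq
    proof eventually_elim
      case (elim x)
      show ?case
      proof (cases "x \<in> {0..\<beta>}")
        case False
        then show ?thesis by simp
      next
        case True
        then have x: "x \<in> {0<..<\<beta>}" using elim by auto
        \<comment> \<open>The cell of the grid that contains \<open>x\<close>, possibly as its left
          end.\<close>
        define k where "k n = nat \<lfloor>x / d n\<rfloor>" for n
        have kx: "real (k n) * d n \<le> x" "x < real (Suc (k n)) * d n" "k n < Suc n" for n
        proof -
          have fl: "real (k n) = of_int \<lfloor>x / d n\<rfloor>" using x d[of n] by (simp add: k_def)
          have "real (k n) \<le> x / d n" "x / d n < real (Suc (k n))" using fl by linarith+
          then show 1: "real (k n) * d n \<le> x" "x < real (Suc (k n)) * d n" using d[of n] by (simp_all only: pos_le_divide_eq pos_divide_less_eq)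
          have "real (k n) * d n < real (Suc n) * d n"
            using 1(1) x by (simp add: d_def)
          then show "k n < Suc n" using d[of n] by (simp add: mult_less_cancel_right)
        qed
        have la: "(\<lambda>n. block_rate I \<beta> (Suc n) g (k n) j) \<longlonglongrightarrow> occ_rate I g x j" if "j \<le> I + 1" for j
        proof -
          have D: "((\<lambda>y. occ_flow I g 0 y j) has_real_derivative occ_rate I g x j) (at x)" using elim(1) x that by auto
          have "(\<lambda>n. (occ_flow I g 0 (real (Suc (k n)) * d n) j - occ_flow I g 0 (real (k n) * d n) j) / (real (Suc (k n)) * d n - real (k n) * d n)) \<longlonglongrightarrow> occ_rate I g x j"
          proof (rule straddle_quotient_tendsto[OF D])
            show "real (k n) * d n < real (Suc (k n)) * d n" for n using d[of n] by simp
            show "(\<lambda>n. real (Suc (k n)) * d n - real (k n) * d n) \<longlonglongrightarrow> 0" unfolding len(1) by (rule dlim)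
          qed (use kx less_imp_le in blast)+
          then show ?thesis unfolding occ_flow_from_0 len(1) by (simp only: block_rate_def d_def)
        qed
        have lg: "(\<lambda>n. g (real (k n) * d n) j) \<longlonglongrightarrow> g x j" for j
        proof (rule LIM_zero_cancel, rule Lim_null_comparison[OF _ dlim])
          show "\<forall>\<^sub>F n in sequentially. norm (g (real (k n) * d n) j - g x j) \<le> d n"
          proof (rule always_eventually, rule allI)
            fix n
            have "\<bar>g (real (k n) * d n) j - g x j\<bar> \<le> \<bar>real (k n) * d n - x\<bar>" by (rule adm_0_Lipschitz[OF g b])
            also have "\<dots> \<le> d n" using kx(1,2)[of n] len(1)[of "k n" n] by auto
            finally show "norm (g (real (k n) * d n) j - g x j) \<le> d n" by simp
          qed
        qed
        have "e2ennreal (rel_entropy I (occ_rate I g x) (g x)) \<le> liminf (\<lambda>n. X n x)"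
          unfolding le_Liminf_iff
        proof (intro allI impI)
          fix y assume y: "y < e2ennreal (rel_entropy I (occ_rate I g x) (g x))"
          then obtain m where m: "y = ennreal m" "0 \<le> m" by (cases y) auto
          have "ereal m < rel_entropy I (occ_rate I g x) (g x)"
          proof (rule ccontr)
            assume "\<not> ereal m < rel_entropy I (occ_rate I g x) (g x)"
            then have "e2ennreal (rel_entropy I (occ_rate I g x) (g x)) \<le> e2ennreal (ereal m)" by (intro e2ennreal_mono) simp
            with y m show False by simp
          qed
          then obtain s where s: "\<And>j. 0 < s j" "m < gibbs I s (occ_rate I g x) (g x)"
            
          proof (rule rel_entropy_gibbs_approx)
            show "0 \<le> occ_rate I g x j" for j using elim(2) x occ_simplexD(1) by simp
            show "0 \<le> g x j" for j by (rule occ_simplexD(1)[OF admD(1)[OF g]])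
          qed blast
          let ?G = "\<lambda>n. \<Sum>j\<le>I+1. block_rate I \<beta> (Suc n) g (k n) j * ln (s j) + block_rate I \<beta> (Suc n) g (k n) j - s j * (g (real (k n) * d n) j + d n)"
          have "?G \<longlonglongrightarrow> (\<Sum>j\<le>I+1. occ_rate I g x j * ln (s j) + occ_rate I g x j - s j * (g x j + 0))"
            by (intro tendsto_intros la lg dlim) auto
          then have "?G \<longlonglongrightarrow> gibbs I s (occ_rate I g x) (g x)" by (simp add: gibbs_def)
          then have "\<forall>\<^sub>F n in sequentially. m < ?G n" using s(2) by (rule order_tendstoD(1))
          then show "\<forall>\<^sub>F n in sequentially. y < X n x"
          proof eventually_elim
            case (elim n)
            have "?G n \<le> block_cost I \<beta> (Suc n) g (k n)"
              using block_cost_ge[OF assms(1) g kx(3) s(1)] by (simp only: d_def)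
            moreover have "0 < real (I+2) * d n" using d[of n] by simp
            ultimately have "m < c n (k n)" using elim unfolding c_def by linarith
            then have "y < ennreal (c n (k n))" using m by (simp add: ennreal_less_iff)
            also have "\<dots> = ennreal (c n (k n)) * indicator {real (k n) * d n..<real (Suc (k n)) * d n} x"
              using kx(1,2)[of n] by (simp del: of_nat_Suc)
            also have "\<dots> \<le> X n x"
              unfolding X_def by (rule member_le_sum) (use kx(3) in auto)
            finally show ?case .
          qed
        qed
        then show ?thesis using True by simp
      qed
    qed
  qed
  also have "\<dots> \<le> liminf (\<lambda>n. (\<integral>\<^sup>+x. X n x \<partial>lborel))"
  proof (rule nn_integral_liminf)
    show "X n \<in> borel_measurable lborel" for n
      unfolding X_def by (intro borel_measurable_sum borel_measurable_times borel_measurable_indicator) auto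
  qed
  finally have J: "e2ennreal (occ_J I \<beta> g) \<le> liminf (\<lambda>n. ennreal (disc_cost I \<beta> (Suc n) g + err n))"
    unfolding intX using v by (simp add: occ_J_def)
  have errlim: "err \<longlonglongrightarrow> 0" unfolding err_def using tendsto_mult_right_zero[OF dlim] by simp
  have nn: "0 \<le> disc_cost I \<beta> (Suc n) g + err n" for n
  proof -
    have "0 \<le> (\<Sum>k<Suc n. c n k * d n)" 
    proof (rule sum_nonneg)
      show "0 \<le> c n k * d n" if "k \<in> {..<Suc n}" for k
        using that c[of k n] d[of n] by (simp add: less_imp_le)
    qed
    also note sum_c
    finally show ?thesis .
  qed
  \<comment> \<open>The room between \<open>M\<close> and \<open>M'\<close> absorbs
    \<open>err n\<close>. Negative \<open>M'\<close> is treated apart because \<open>ennreal\<close>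
    would send it to 0.\<close>
  obtain M' where M': "ereal M < ereal M'" "ereal M' < occ_J I \<beta> g" using M ereal_dense2 by blast
  have "\<forall>\<^sub>F n in sequentially. M' < disc_cost I \<beta> (Suc n) g + err n \<or> M' < 0"
  proof (cases "M' < 0")
    case False
    have "ennreal M' < e2ennreal (occ_J I \<beta> g)"
    proof (rule ccontr)
      assume "\<not> ennreal M' < e2ennreal (occ_J I \<beta> g)"
      then have "enn2ereal (e2ennreal (occ_J I \<beta> g)) \<le> enn2ereal (ennreal M')" by (simp add: less_eq_ennreal.rep_eq[symmetric] not_less)
      moreover have "0 \<le> occ_J I \<beta> g" by (simp add: occ_J_def)
      ultimately show False using M' False by (simp add: enn2ereal_e2ennreal enn2ereal_ennreal)
    qed
    then have "ennreal M' < liminf (\<lambda>n. ennreal (disc_cost I \<beta> (Suc n) g + err n))" using J by simp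
    then have "\<forall>\<^sub>F n in sequentially. ennreal M' < ennreal (disc_cost I \<beta> (Suc n) g + err n)" by (rule less_LiminfD)
    then show ?thesis by eventually_elim (use False nn in \<open>auto simp: ennreal_less_iff\<close>)
  qed simp
  moreover have "\<forall>\<^sub>F n in sequentially. err n < M' - M"
    using errlim by (rule order_tendstoD(2)) (use M' in simp)
  ultimately have "\<forall>\<^sub>F n in sequentially. M < disc_cost I \<beta> (Suc n) g"
  proof eventually_elim
    case (elim n)
    then show ?case using nn[of n] by auto
  qed
  then show ?thesis by (rule eventually_sequentially_Suc[THEN iffD1])
qed

section \<open>Compactness of the level sets\<close>

text \<open>The identity is an admissible time change, so the Skorokhod distance is at most the
  uniform one.\<close>

lemma skor_dist_le:
  assumes "0 \<le> \<beta>" "\<And>t j. t \<in> {0..\<beta>} \<Longrightarrow> j \<le> I + 1 \<Longrightarrow> \<bar>f t j - g t j\<bar> \<le> e" "0 \<le> e"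
  shows "skor_dist I \<beta> f g \<le> e"
  unfolding skor_dist_def
proof (rule cInf_lower)
  have "(\<lambda>t. t) \<in> time_changes \<beta>" by (auto simp: time_changes_def strict_mono_on_def)
  then show "e \<in> {e. \<exists>tc\<in>time_changes \<beta>. \<forall>t\<in>{0..\<beta>}. \<bar>tc t - t\<bar> \<le> e \<and> (\<forall>j\<le>I+1. \<bar>f t j - g (tc t) j\<bar> \<le> e)}"
    using assms by (auto intro!: bexI[of _ "\<lambda>t. t"])
  show "bdd_below {e. \<exists>tc\<in>time_changes \<beta>. \<forall>t\<in>{0..\<beta>}. \<bar>tc t - t\<bar> \<le> e \<and> (\<forall>j\<le>I+1. \<bar>f t j - g (tc t) j\<bar> \<le> e)}"
  proof (rule bdd_belowI[of _ 0])
    fix e assume "e \<in> {e. \<exists>tc\<in>time_changes \<beta>. \<forall>t\<in>{0..\<beta>}. \<bar>tc t - t\<bar> \<le> e \<and> (\<forall>j\<le>I+1. \<bar>f t j - g (tc t) j\<bar> \<le> e)}"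
    then obtain tc where "\<forall>t\<in>{0..\<beta>}. \<bar>tc t - t\<bar> \<le> e" by auto
    then have "\<bar>tc 0 - 0\<bar> \<le> e" using assms(1) by fastforce
    then show "0 \<le> e" by linarith
  qed
qed

definition sup_close :: "nat \<Rightarrow> real \<Rightarrow> real \<Rightarrow> (real \<Rightarrow> nat \<Rightarrow> real) \<Rightarrow> (real \<Rightarrow> nat \<Rightarrow> real) \<Rightarrow> bool" where
  "sup_close I \<beta> e g h \<longleftrightarrow> (\<forall>t\<in>{0..\<beta>}. \<forall>j\<le>I+1. \<bar>g t j - h t j\<bar> \<le> e)"

lemma skor_open_sup_close:
  assumes "0 \<le> \<beta>" "skor_open I \<beta> U" "f \<in> U"
  shows "\<exists>e>0. \<forall>g\<in>Dsp I \<beta>. sup_close I \<beta> e f g \<longrightarrow> g \<in> U"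
proof -
  obtain e where e: "e > 0" "\<forall>g\<in>Dsp I \<beta>. skor_dist I \<beta> f g < e \<longrightarrow> g \<in> U"
    using assms(2,3) unfolding skor_open_def by blast
  have "g \<in> U" if g: "g \<in> Dsp I \<beta>" "sup_close I \<beta> (e/2) f g" for g
  proof -
    have "skor_dist I \<beta> f g \<le> e/2"
      by (rule skor_dist_le) (use assms(1) e(1) g(2) in \<open>auto simp: sup_close_def\<close>)
    then show "g \<in> U" using e g(1) by auto
  qed
  then show ?thesis using e(1) by (intro exI[of _ "e/2"]) auto
qed

lemma skor_interior_sup_close:
  assumes "0 \<le> \<beta>" "g \<in> skor_interior I \<beta> A"
  shows "\<exists>e>0. \<forall>h\<in>Dsp I \<beta>. sup_close I \<beta> e g h \<longrightarrow> h \<in> A"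
proof -
  obtain U where U: "skor_open I \<beta> U" "U \<subseteq> A" "g \<in> U" using assms(2) unfolding skor_interior_def by blast
  from skor_open_sup_close[OF assms(1) U(1,3)] U(2) show ?thesis by (meson subsetD)
qed

lemma skor_closure_sup_close:
  assumes "0 \<le> \<beta>" "g \<in> Dsp I \<beta>" "g \<notin> skor_closure I \<beta> A"
  shows "\<exists>e>0. \<forall>h\<in>Dsp I \<beta>. sup_close I \<beta> e g h \<longrightarrow> h \<notin> A"
proof -
  have "g \<in> skor_interior I \<beta> (Dsp I \<beta> - A)" using assms(2,3) by (simp add: skor_closure_def)
  from skor_interior_sup_close[OF assms(1) this] show ?thesis by (meson DiffD2)
qed

section \<open>Compactness in the topology of pointwise convergence\<close>

lemma continuous_on_eval [continuous_intros]:
  "continuous_on S (\<lambda>g::'a \<Rightarrow> 'b \<Rightarrow> 'c::topological_space. g t j)"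
  by (rule continuous_on_subset[OF continuous_on_product_then_coordinatewise[OF continuous_on_product_coordinates]]) simp

lemma continuous_on_occ_flow [continuous_intros]:
  "continuous_on S (\<lambda>g. occ_flow I g s t j)"
  unfolding occ_flow_def by (cases "j \<le> I") (auto intro!: continuous_intros)

lemma compact_PiE_UNIV:
  fixes S :: "'a \<Rightarrow> 'b::topological_space set"
  assumes "\<And>i. compact (S i)"
  shows "compact {f. \<forall>i. f i \<in> S i}"
proof -
  have "compactin (product_topology (\<lambda>i. euclidean) UNIV) (PiE UNIV S)"
    using assms by (subst compactin_PiE) auto
  moreover have "PiE UNIV S = {f. \<forall>i. f i \<in> S i}" by (auto simp: PiE_def extensional_def)
  ultimately show ?thesis by (simp add: euclidean_product_topology)
qed

lemma closed_Collect_imp_const: "(P \<Longrightarrow> closed {x. Q x}) \<Longrightarrow> closed {x. P \<longrightarrow> Q x}"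
  by (cases P) auto

text \<open>All conditions are equations and non-strict inequalities between continuous functions of
  finitely many evaluations; \<open>compact_adm\<close> then follows by Tychonoff's theorem, the
  components being in the unit interval.\<close>

lemma closed_adm: "closed (admissible_paths I \<beta> c)"
  unfolding admissible_paths_def occ_simplex_def mem_Collect_eq fun_eq_iff
  by (intro closed_Collect_conj closed_Collect_all closed_Collect_imp_const closed_Collect_le closed_Collect_eq continuous_intros)

lemma adm_mono: "c \<le> c' \<Longrightarrow> admissible_paths I \<beta> c \<subseteq> admissible_paths I \<beta> c'"
  unfolding admissible_paths_def by fastforce

lemma compact_adm: "compact (admissible_paths I \<beta> c)"
proof -
  define S where "S = {g :: real \<Rightarrow> nat \<Rightarrow> real. \<forall>t. g t \<in> {v. \<forall>j. v j \<in> {0..1}}}"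
  have "compact S" unfolding S_def by (intro compact_PiE_UNIV) auto
  moreover have "admissible_paths I \<beta> c \<subseteq> S" unfolding S_def using occ_simplexD(1,4)[OF admD(1)] by auto
  ultimately show ?thesis using compact_Int_closed[OF _ closed_adm[of I \<beta> c], of S] by (simp only: Int_absorb1)
qed

lemma adm_0_if:
  assumes "\<And>c. c > 0 \<Longrightarrow> g \<in> admissible_paths I \<beta> c"
  shows "g \<in> admissible_paths I \<beta> 0"
proof -
  have "0 \<le> occ_flow I g s t (I+1)" if "0 \<le> s" "s \<le> t" "t \<le> \<beta>" for s t
  proof (rule field_le_epsilon)
    fix e :: real assume "e > 0"
    from admD(5)[OF assms[OF this] that] show "0 \<le> occ_flow I g s t (I+1) + e" by simp
  qed
  then show ?thesis using assms[of 1] by (simp add: admissible_paths_def)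
qed

text \<open>The modulus of continuity is common to all admissible paths, so closeness at finitely
  many grid points spreads to the whole interval.\<close>

lemma adm_0_nhd:
  assumes "\<beta> > 0" "g \<in> admissible_paths I \<beta> 0" "e > 0"
  shows "\<exists>W c. open W \<and> g \<in> W \<and> c > 0 \<and>
    (\<forall>h c'. h \<in> W \<longrightarrow> h \<in> admissible_paths I \<beta> c' \<longrightarrow> 0 \<le> c' \<longrightarrow> c' \<le> c \<longrightarrow> sup_close I \<beta> e g h)"
proof -
  \<comment> \<open>Makes the mesh at most \<open>e/4\<close>. The error \<open>e\<close> is then
    made up of the distance at the grid point, the movement of \<open>g\<close>, the movement of
    \<open>h\<close> and the slack \<open>c'\<close>, each at most \<open>e/4\<close>.\<close>
  obtain N :: nat where N: "4 * \<beta> / e < real N" using reals_Archimedean2 by blast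
  then have "0 < real N" using assms by (meson divide_pos_pos less_trans mult_pos_pos zero_less_numeral)
  then have N0: "N > 0" by simp
  define d where "d = \<beta> / real N"
  have d: "d > 0" "d \<le> e/4" using N N0 assms by (auto simp: d_def field_simps)
  define W where "W = (\<Inter>k\<in>{..N}. \<Inter>j\<in>{..I+1}. {h :: real \<Rightarrow> nat \<Rightarrow> real. \<bar>h (real k * d) j - g (real k * d) j\<bar> < e/4})"
  have "open W" unfolding W_def
    by (intro open_INT ballI finite_atMost open_Collect_less continuous_intros)
  moreover have "g \<in> W" using assms by (simp add: W_def)
  moreover have "sup_close I \<beta> e g h" if h: "h \<in> W" "h \<in> admissible_paths I \<beta> c'" "0 \<le> c'" "c' \<le> e/4" for h c'
    unfolding sup_close_def
  proof (intro ballI allI impI)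
    fix t j assume t: "t \<in> {0..\<beta>}" and j: "j \<le> I + 1"
    define k where "k = nat \<lfloor>t / d\<rfloor>"
    have fl: "real k = of_int \<lfloor>t / d\<rfloor>" using t d by (simp add: k_def)
    then have "real k \<le> t / d" by linarith
    then have k1: "real k * d \<le> t" using d(1) by (simp only: pos_le_divide_eq)
    have "t / d < real k + 1" using fl by linarith
    then have k2: "t \<le> real k * d + d" using d by (simp add: pos_divide_less_eq algebra_simps)
    have "t / d \<le> real N" using t N0 assms by (simp add: d_def field_simps)
    then have "real k \<le> real N" using fl by linarith
    then have kN: "k \<le> N" by simp
    have 1: "\<bar>h (real k * d) j - g (real k * d) j\<bar> < e/4" using h(1) kN j by (auto simp: W_def)
    have 2: "\<bar>h t j - h (real k * d) j\<bar> \<le> t - real k * d + c'"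
      by (rule adm_near_Lipschitz[OF h(2)]) (use k1 t d h in auto)
    have 3: "\<bar>g t j - g (real k * d) j\<bar> \<le> t - real k * d + 0"
      by (rule adm_near_Lipschitz[OF assms(2)]) (use k1 t d in auto)
    show "\<bar>g t j - h t j\<bar> \<le> e" using 1 2 3 k2 d h(4) by linarith
  qed
  ultimately show ?thesis using assms(3) by (intro exI[of _ W] exI[of _ "e/4"]) simp
qed

lemma continuous_on_disc_cost:
  assumes "\<beta> > 0"
  shows "continuous_on (admissible_paths I \<beta> 0) (disc_cost I \<beta> N)"
  unfolding disc_cost_def block_cost_def
proof (intro continuous_on_sum continuous_on_mult continuous_on_const)
  fix k j assume k: "k \<in> {..<N}" and j: "j \<in> {..I+1}"
  then have d: "\<beta> / real N > 0" using assms by auto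
  show "continuous_on (admissible_paths I \<beta> 0) (\<lambda>g. block_rate I \<beta> N g k j)"
    unfolding block_rate_def divide_inverse by (intro continuous_intros)
  then have br: "continuous_on (admissible_paths I \<beta> 0) (\<lambda>g. block_rate I \<beta> N g k j + \<beta> / real N)" by (intro continuous_intros)
  have gr: "continuous_on (admissible_paths I \<beta> 0) (\<lambda>g. g (real k * (\<beta> / real N)) j + \<beta> / real N)" by (intro continuous_intros)
  have pos: "0 < block_rate I \<beta> N g k j + \<beta> / real N" "0 < g (real k * (\<beta> / real N)) j + \<beta> / real N" if g: "g \<in> admissible_paths I \<beta> 0" for g
    using block_rate_simplex(1)[OF assms g, of k N j] k j occ_simplexD(1)[OF admD(1)[OF g], of "real k * (\<beta> / real N)" j] d by auto
  show "continuous_on (admissible_paths I \<beta> 0) (\<lambda>g. ln ((block_rate I \<beta> N g k j + \<beta> / real N) / (g (real k * (\<beta> / real N)) j + \<beta> / real N)))"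
  proof (rule continuous_on_ln)
    show "continuous_on (admissible_paths I \<beta> 0) (\<lambda>g. (block_rate I \<beta> N g k j + \<beta> / real N) / (g (real k * (\<beta> / real N)) j + \<beta> / real N))"
      by (rule continuous_on_divide[OF br gr]) (use pos(2) in \<open>metis less_irrefl\<close>)
    show "\<forall>g\<in>admissible_paths I \<beta> 0. (block_rate I \<beta> N g k j + \<beta> / real N) / (g (real k * (\<beta> / real N)) j + \<beta> / real N) \<noteq> 0"
      using divide_pos_pos[OF pos] less_imp_neq by metis
  qed
qed

lemma occ_J_finite_adm: "\<beta> > 0 \<Longrightarrow> occ_J I \<beta> g \<noteq> \<infinity> \<Longrightarrow> g \<in> admissible_paths I \<beta> 0"
  using valid_occ_iff_adm by (auto simp: occ_J_def split: if_splits)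

text \<open>If the cost of a path exceeds \<open>C\<close>, some \<open>disc_cost\<close> exceeds
  \<open>C\<close> by more than its discretisation error. By continuity this persists for all
  admissible paths in a neighbourhood, so the level set is closed in a compact set.\<close>

lemma occ_J_levelset_compact:
  assumes "\<beta> > 0" "compact K"
  shows "compact {g. occ_J I \<beta> g \<le> ereal C \<and> g 0 \<in> K}"
proof -
  define S where "S = {g. occ_J I \<beta> g \<le> ereal C \<and> g 0 \<in> K}"
  have sub: "S \<subseteq> admissible_paths I \<beta> 0" unfolding S_def using occ_J_finite_adm[OF assms(1)] by force
  have "\<exists>W. open W \<and> g \<in> W \<and> W \<inter> S = {}" if g: "g \<in> admissible_paths I \<beta> 0 - S" for g
  proof (cases "g 0 \<in> K")
    case False
    have "closed ((\<lambda>g::real \<Rightarrow> nat \<Rightarrow> real. g 0) -` K)"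
      using compact_imp_closed[OF assms(2)] by (intro closed_vimage continuous_on_product_coordinates)
    then show ?thesis using False by (intro exI[of _ "- ((\<lambda>g. g 0) -` K)"]) (auto simp: open_Compl S_def)
  next
    case True
    then have "ereal C < occ_J I \<beta> g" using g by (auto simp: S_def)
    then obtain M where M: "ereal C < ereal M" "ereal M < occ_J I \<beta> g" using ereal_dense2 by blast
    have ev1: "\<forall>\<^sub>F N in sequentially. M < disc_cost I \<beta> N g"
      using disc_cost_eventually_gt[OF assms(1) _ M(2)] g by blast
    have "(\<lambda>N. \<beta> * real (I+2) * (\<beta> / real N)) \<longlonglongrightarrow> 0" by real_asymp
    then have ev2: "\<forall>\<^sub>F N in sequentially. \<beta> * real (I+2) * (\<beta> / real N) < M - C"
      by (rule order_tendstoD(2)) (use M in simp)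
    have "\<forall>\<^sub>F N in sequentially. N > 0 \<and> M < disc_cost I \<beta> N g \<and> \<beta> * real (I+2) * (\<beta> / real N) < M - C"
      using ev1 ev2 eventually_gt_at_top[of 0] by eventually_elim auto
    then obtain N where N: "N > 0" "M < disc_cost I \<beta> N g" "\<beta> * real (I+2) * (\<beta> / real N) < M - C"
      using eventually_happens'[OF sequentially_bot] by blast
    obtain W where W: "open W" "W \<inter> admissible_paths I \<beta> 0 = disc_cost I \<beta> N -` {M<..} \<inter> admissible_paths I \<beta> 0"
      using continuous_on_disc_cost[OF assms(1), unfolded continuous_on_open_invariant, rule_format, OF open_greaterThan[of M]] by blast
    have "W \<inter> S = {}"
    proof (rule ccontr)
      assume "W \<inter> S \<noteq> {}"
      then obtain h where h: "h \<in> W" "h \<in> S" by auto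
      then have "h \<in> admissible_paths I \<beta> 0" using sub by blast
      then have "M < disc_cost I \<beta> N h" "ereal (disc_cost I \<beta> N h - \<beta> * real (I+2) * (\<beta> / real N)) \<le> occ_J I \<beta> h"
        using W(2) h(1) disc_cost_le_occ_J[OF assms(1) _ N(1)] by blast+
      moreover have "occ_J I \<beta> h \<le> ereal C" using h(2) by (simp add: S_def)
      ultimately have "ereal (disc_cost I \<beta> N h - \<beta> * real (I+2) * (\<beta> / real N)) \<le> ereal C" by (meson order_trans)
      then show False using N(3) \<open>M < disc_cost I \<beta> N h\<close> by simp
    qed
    moreover have "g \<in> W" using W(2) g N(2) by blast
    ultimately show ?thesis using W(1) by blast
  qed
  then have "\<forall>g\<in>admissible_paths I \<beta> 0 - S. \<exists>W. open W \<and> g \<in> W \<and> W \<inter> S = {}" by (rule ballI)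
  from bchoice[OF this] obtain W where W: "\<forall>g\<in>admissible_paths I \<beta> 0 - S. open (W g) \<and> g \<in> W g \<and> W g \<inter> S = {}" ..
  have "S = admissible_paths I \<beta> 0 \<inter> - (\<Union>g\<in>admissible_paths I \<beta> 0 - S. W g)" using W sub by blast
  moreover have "closed (- (\<Union>g\<in>admissible_paths I \<beta> 0 - S. W g))" using W by (intro closed_Compl open_UN) blast
  ultimately show ?thesis using compact_Int_closed[OF compact_adm, of "- (\<Union>g\<in>admissible_paths I \<beta> 0 - S. W g)" I \<beta> 0] by (simp add: S_def[symmetric])
qed

text \<open>Among admissible paths, pointwise neighbourhoods are contained in uniform balls and
  these in Skorokhod-open sets, so a Skorokhod cover is refined by a pointwise one.\<close>

lemma occ_J_levelset_skor_compact:
  assumes "\<beta> > 0" "compact K"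
  shows "skor_compact I \<beta> {g. occ_J I \<beta> g \<le> ereal C \<and> g 0 \<in> K}"
proof -
  let ?S = "{g. occ_J I \<beta> g \<le> ereal C \<and> g 0 \<in> K}"
  have b: "0 \<le> \<beta>" using assms by simp
  have sub: "?S \<subseteq> admissible_paths I \<beta> 0" using occ_J_finite_adm[OF assms(1)] by force
  show ?thesis
    unfolding skor_compact_def
  proof (intro conjI allI impI)
    show "?S \<subseteq> Dsp I \<beta>" using sub adm_0_Dsp[OF _ b] by blast
    fix \<U> assume "(\<forall>U\<in>\<U>. skor_open I \<beta> U) \<and> ?S \<subseteq> \<Union>\<U>"
    then have \<U>: "\<And>U. U \<in> \<U> \<Longrightarrow> skor_open I \<beta> U" "?S \<subseteq> \<Union>\<U>" by auto
    have "\<exists>W U. open W \<and> g \<in> W \<and> U \<in> \<U> \<and> W \<inter> admissible_paths I \<beta> 0 \<subseteq> U" if g: "g \<in> ?S" for g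
    proof -
      obtain U where U: "U \<in> \<U>" "g \<in> U" using \<U>(2) g by blast
      obtain e where e: "e > 0" "\<forall>h\<in>Dsp I \<beta>. sup_close I \<beta> e g h \<longrightarrow> h \<in> U"
        using skor_open_sup_close[OF b \<U>(1)[OF U(1)] U(2)] by blast
      have ga: "g \<in> admissible_paths I \<beta> 0" using g sub by blast
      obtain W c where W: "open W" "g \<in> W" "c > 0"
        "\<forall>h c'. h \<in> W \<longrightarrow> h \<in> admissible_paths I \<beta> c' \<longrightarrow> 0 \<le> c' \<longrightarrow> c' \<le> c \<longrightarrow> sup_close I \<beta> e g h"
        using adm_0_nhd[OF assms(1) ga e(1)] by blast
      have "W \<inter> admissible_paths I \<beta> 0 \<subseteq> U" using W(3,4) e(2) adm_0_Dsp[OF _ b] less_imp_le by blast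
      with W U show ?thesis by blast
    qed
    then have "\<forall>g\<in>?S. \<exists>p. open (fst p) \<and> g \<in> fst p \<and> snd p \<in> \<U> \<and> fst p \<inter> admissible_paths I \<beta> 0 \<subseteq> snd p" 
      unfolding split_paired_Ex fst_conv snd_conv by (intro ballI) fast
    from bchoice[OF this] obtain p where p: "\<forall>g\<in>?S. open (fst (p g)) \<and> g \<in> fst (p g) \<and> snd (p g) \<in> \<U> \<and> fst (p g) \<inter> admissible_paths I \<beta> 0 \<subseteq> snd (p g)" ..
    define W where "W g = fst (p g)" for g
    define U where "U g = snd (p g)" for g
    have WU: "\<And>g. g \<in> ?S \<Longrightarrow> open (W g) \<and> g \<in> W g \<and> U g \<in> \<U> \<and> W g \<inter> admissible_paths I \<beta> 0 \<subseteq> U g"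
      using p unfolding W_def U_def by blast
    have c: "compact ?S" by (rule occ_J_levelset_compact[OF assms])
    obtain D where D: "D \<subseteq> ?S" "finite D" "?S \<subseteq> (\<Union>g\<in>D. W g)"
    proof (rule compactE_image[OF c, of ?S W])
      show "open (W g)" if "g \<in> ?S" for g using WU[OF that] by blast
      show "?S \<subseteq> (\<Union>g\<in>?S. W g)" using WU by blast
    qed blast
    show "\<exists>\<F>\<subseteq>\<U>. finite \<F> \<and> ?S \<subseteq> \<Union>\<F>"
    proof (intro exI[of _ "U ` D"] conjI)
      show "U ` D \<subseteq> \<U>" using WU D(1) by blast
      show "?S \<subseteq> \<Union>(U ` D)"
      proof
        fix h assume h: "h \<in> ?S"
        then obtain g where "g \<in> D" "h \<in> W g" using D(3) by blast
        then show "h \<in> \<Union>(U ` D)" using WU[of g] D(1) sub h by blast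
      qed
    qed (use D in auto)
  qed
qed

section \<open>The occupancy chain\<close>

definition occ_lattice :: "nat \<Rightarrow> nat \<Rightarrow> (nat \<Rightarrow> real) set" where
  "occ_lattice I n = {g \<in> occ_simplex I. \<forall>j. \<exists>k::nat. real n * g j = real k}"

definition occ_shift :: "nat \<Rightarrow> nat \<Rightarrow> (nat \<Rightarrow> real) \<Rightarrow> nat \<Rightarrow> nat \<Rightarrow> real" where
  "occ_shift I n g j = (\<lambda>i. g i + occ_incr I n j i)"

definition occ_count :: "nat \<Rightarrow> nat \<Rightarrow> real \<Rightarrow> (nat \<Rightarrow> real) \<Rightarrow> (nat \<Rightarrow> real) \<Rightarrow> nat \<Rightarrow> real" where
  "occ_count I n L x y l = (if l \<le> I then real n * ((\<Sum>k\<le>l. x k) - (\<Sum>k\<le>l. y k))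
     else L - (\<Sum>i\<le>I. real n * ((\<Sum>k\<le>i. x k) - (\<Sum>k\<le>i. y k))))"

lemma occ_count_add: "occ_count I n L x y l + occ_count I n L' y z l = occ_count I n (L + L') x z l"
proof (cases "l \<le> I")
  case True
  then show ?thesis by (simp add: occ_count_def right_diff_distrib)
next
  case False
  have "(\<Sum>i\<le>I. real n * ((\<Sum>k\<le>i. x k) - (\<Sum>k\<le>i. y k))) + (\<Sum>i\<le>I. real n * ((\<Sum>k\<le>i. y k) - (\<Sum>k\<le>i. z k)))
    = (\<Sum>i\<le>I. real n * ((\<Sum>k\<le>i. x k) - (\<Sum>k\<le>i. z k)))"
    unfolding sum.distrib[symmetric] by (rule sum.cong) (auto simp: right_diff_distrib)
  then show ?thesis using False by (simp add: occ_count_def)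
qed

lemma occ_count_zero: "occ_count I n 0 x x l = 0"
  by (simp add: occ_count_def)

lemma sum_occ_incr:
  assumes "n > 0" "j \<le> I + 1" "l \<le> I"
  shows "(\<Sum>k\<le>l. occ_incr I n j k) = (if l = j then - 1 / real n else 0)"
proof (cases "j \<le> I")
  case True
  have "(\<Sum>k\<le>l. occ_incr I n j k) = (\<Sum>k\<le>l. (if k = j + 1 then 1 / real n else 0) + (if k = j then - 1 / real n else 0))"
    by (rule sum.cong) (use True in \<open>auto simp: occ_incr_def\<close>)
  also have "\<dots> = (if j + 1 \<le> l then 1 / real n else 0) + (if j \<le> l then - 1 / real n else 0)"
    by (simp add: sum.distrib)
  finally show ?thesis by auto
next
  case False
  then show ?thesis using assms by (auto simp: occ_incr_def)
qed

lemma occ_count_shift: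
  assumes "n > 0" "j \<le> I + 1" "l \<le> I + 1"
  shows "occ_count I n 1 x (occ_shift I n x j) l = (if l = j then 1 else 0)"
proof -
  have s: "real n * ((\<Sum>k\<le>i. x k) - (\<Sum>k\<le>i. occ_shift I n x j k)) = (if i = j then 1 else 0)" if "i \<le> I" for i
    using sum_occ_incr[OF assms(1,2) that] assms(1) by (simp add: occ_shift_def sum.distrib)
  show ?thesis
  proof (cases "l \<le> I")
    case True
    then show ?thesis using s[OF True] by (simp add: occ_count_def)
  next
    case False
    have "(\<Sum>i\<le>I. real n * ((\<Sum>k\<le>i. x k) - (\<Sum>k\<le>i. occ_shift I n x j k))) = (\<Sum>i\<le>I. if i = j then 1 else 0)"
      by (rule sum.cong) (use s in auto)
    then show ?thesis using False assms by (auto simp: occ_count_def)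
  qed
qed

section \<open>The law of a single throw\<close>

lemma pmf_occ_choice:
  assumes "g \<in> occ_simplex I"
  shows "pmf (occ_choice I g) j = g j"
proof -
  let ?f = "\<lambda>j. if j \<le> I + 1 then g j else 0"
  have nn: "0 \<le> ?f j" for j using occ_simplexD(1)[OF assms] by simp
  have "(\<integral>\<^sup>+ x. ennreal (?f x) \<partial>count_space UNIV) = (\<Sum>x\<in>{..I+1}. ennreal (?f x))"
    by (rule nn_integral_count_space') auto
  also have "\<dots> = ennreal (\<Sum>x\<in>{..I+1}. ?f x)" by (rule sum_ennreal) (rule nn)
  also have "(\<Sum>x\<in>{..I+1}. ?f x) = (\<Sum>x\<le>I+1. g x)" by (rule sum.cong) auto
  also have "\<dots> = 1" by (rule occ_simplexD(3)[OF assms])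
  finally have "(\<integral>\<^sup>+ x. ennreal (?f x) \<partial>count_space UNIV) = 1" by simp
  then have "pmf (occ_choice I g) j = ?f j" unfolding occ_choice_def by (intro pmf_embed_pmf nn)
  then show ?thesis using occ_simplexD(2)[OF assms, of j] by auto
qed

lemma set_occ_choice:
  assumes "g \<in> occ_simplex I" "j \<in> set_pmf (occ_choice I g)"
  shows "j \<le> I + 1" "g j > 0"
proof -
  have "g j \<noteq> 0" using assms pmf_occ_choice[OF assms(1)] by (simp add: set_pmf_eq)
  then show "g j > 0" using occ_simplexD(1)[OF assms(1), of j] by simp
  show "j \<le> I + 1" using \<open>g j \<noteq> 0\<close> occ_simplexD(2)[OF assms(1), of j] by force
qed

lemma nn_integral_occ_choice:
  assumes "g \<in> occ_simplex I"
  shows "(\<integral>\<^sup>+j. f j \<partial>measure_pmf (occ_choice I g)) = (\<Sum>j\<le>I+1. ennreal (g j) * f j)"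
proof -
  have "(\<integral>\<^sup>+j. f j \<partial>measure_pmf (occ_choice I g)) = (\<integral>\<^sup>+j. ennreal (g j) * f j \<partial>count_space UNIV)"
    by (simp add: nn_integral_measure_pmf pmf_occ_choice[OF assms])
  also have "\<dots> = (\<Sum>j\<in>{..I+1}. ennreal (g j) * f j)"
    by (rule nn_integral_count_space') (use occ_simplexD(2)[OF assms] in auto)
  finally show ?thesis .
qed

text \<open>A positive component of a lattice point is at least \<open>1/n\<close>, so moving one
  cell out of it cannot make it negative.\<close>

lemma occ_shift_lattice:
  assumes n: "n > 0" and g: "g \<in> occ_lattice I n" and j: "j \<le> I + 1" "g j > 0"
  shows "occ_shift I n g j \<in> occ_lattice I n"
proof -
  have gs: "g \<in> occ_simplex I" and gi: "\<And>i. \<exists>k::nat. real n * g i = real k" using g by (auto simp: occ_lattice_def)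
  have *: "\<exists>k::nat. real n * occ_shift I n g j i = real k" for i
  proof -
    obtain k :: nat where k: "real n * g i = real k" using gi by blast
    have inc: "real n * occ_incr I n j i = (if j \<le> I then (if i = j + 1 then 1 else if i = j then -1 else 0) else 0)"
      using n by (simp add: occ_incr_def)
    have eq: "real n * occ_shift I n g j i = real k + (if j \<le> I then (if i = j + 1 then 1 else if i = j then -1 else 0) else 0)"
      unfolding occ_shift_def distrib_left k inc ..
    show ?thesis
    proof (cases "i = j \<and> j \<le> I")
      case True
      then have "real k > 0" using k j(2) n by (metis mult_pos_pos of_nat_0_less_iff)
      then have "real n * occ_shift I n g j i = real (k - 1)" using eq True by (simp add: of_nat_diff)
      then show ?thesis by blast
    next
      case False
      then have "real n * occ_shift I n g j i = real k \<or> real n * occ_shift I n g j i = real (k + 1)" using eq by auto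
      then show ?thesis by blast
    qed
  qed
  have nn: "0 \<le> occ_shift I n g j i" for i
  proof -
    have "0 \<le> real n * occ_shift I n g j i" using *[of i] by auto
    then show ?thesis using n by (simp add: zero_le_mult_iff)
  qed
  have "(\<Sum>i\<le>I+1. occ_incr I n j i) = 0"
  proof (cases "j \<le> I")
    case True
    have "(\<Sum>i\<le>I+1. occ_incr I n j i) = (\<Sum>i\<le>I+1. (if i = j + 1 then 1 / real n else 0) + (if i = j then - 1 / real n else 0))"
      by (rule sum.cong) (use True in \<open>auto simp: occ_incr_def\<close>)
    also have "\<dots> = (if j + 1 \<le> I + 1 then 1 / real n else 0) + (if j \<le> I + 1 then - 1 / real n else 0)"
      unfolding sum.distrib by (simp del: sum.atMost_Suc)
    finally show ?thesis using True by simp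
  qed (simp add: occ_incr_def)
  then have "(\<Sum>i\<le>I+1. occ_shift I n g j i) = 1"
    using occ_simplexD(3)[OF gs] by (simp add: occ_shift_def sum.distrib del: sum.atMost_Suc)
  moreover have "occ_shift I n g j i = 0" if "i > I + 1" for i
    using that occ_simplexD(2)[OF gs that] by (simp add: occ_shift_def occ_incr_def)
  ultimately show ?thesis using nn * by (simp add: occ_lattice_def occ_simplex_def del: sum.atMost_Suc)
qed

section \<open>Trajectories of the chain and the paths they define\<close>

definition occ_traj :: "nat \<Rightarrow> nat \<Rightarrow> (nat \<Rightarrow> real) \<Rightarrow> nat \<Rightarrow> (nat \<Rightarrow> real) list \<Rightarrow> bool" where
  "occ_traj I n g0 m xs \<longleftrightarrow> length xs = Suc m \<and> xs ! 0 = g0 \<and> (\<forall>i\<le>m. xs ! i \<in> occ_lattice I n) \<and>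
     (\<forall>i<m. \<exists>j\<le>I+1. xs ! Suc i = occ_shift I n (xs ! i) j)"

lemma occ_step_shift: "occ_step I n g = map_pmf (occ_shift I n g) (occ_choice I g)"
  by (simp add: occ_step_def occ_shift_def[abs_def])

lemma occ_traj_snoc:
  assumes "n > 0" "occ_traj I n g0 m xs" "j \<le> I + 1" "last xs j > 0"
  shows "occ_traj I n g0 (Suc m) (xs @ [occ_shift I n (last xs) j])"
proof -
  have len: "length xs = Suc m" using assms(2) by (simp add: occ_traj_def)
  then have last: "last xs = xs ! m" by (metis diff_Suc_1 last_conv_nth list.size(3) nat.distinct(1))
  have "last xs \<in> occ_lattice I n" using assms(2) unfolding last occ_traj_def by blast
  then have "occ_shift I n (last xs) j \<in> occ_lattice I n" using occ_shift_lattice assms by blast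
  then show ?thesis using assms(2,3) len last by (auto simp: occ_traj_def nth_append less_Suc_eq le_Suc_eq)
qed

lemma occ_states_traj:
  assumes "n > 0" "g0 \<in> occ_lattice I n" "xs \<in> set_pmf (occ_states I n g0 m)"
  shows "occ_traj I n g0 m xs"
  using assms(3)
proof (induction m arbitrary: xs)
  case 0
  then show ?case using assms by (simp add: occ_traj_def)
next
  case (Suc m)
  then obtain ys j where ys: "ys \<in> set_pmf (occ_states I n g0 m)" "j \<in> set_pmf (occ_choice I (last ys))"
    "xs = ys @ [occ_shift I n (last ys) j]"
    by (auto simp: occ_step_shift)
  have t: "occ_traj I n g0 m ys" using Suc.IH ys(1) .
  have "last ys = ys ! m" using t by (metis diff_Suc_1 last_conv_nth list.size(3) nat.distinct(1) occ_traj_def)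
  then have "last ys \<in> occ_simplex I" using t by (auto simp: occ_traj_def occ_lattice_def)
  with ys(2) have "j \<le> I + 1" "last ys j > 0" using set_occ_choice by blast+
  then show ?case using occ_traj_snoc[OF assms(1) t] ys(3) by blast
qed

lemma occ_traj_simplex: "occ_traj I n g0 m xs \<Longrightarrow> i \<le> m \<Longrightarrow> xs ! i \<in> occ_simplex I"
  by (auto simp: occ_traj_def occ_lattice_def)

lemma occ_traj_last: "occ_traj I n g0 m xs \<Longrightarrow> last xs = xs ! m"
  by (metis diff_Suc_1 last_conv_nth list.size(3) nat.distinct(1) occ_traj_def)

lemma occ_traj_count_nonneg:
  assumes "n > 0" "occ_traj I n g0 m xs" "l \<le> I + 1" "a + L \<le> m"
  shows "0 \<le> occ_count I n (real L) (xs ! a) (xs ! (a + L)) l"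
  using assms(4)
proof (induction L)
  case 0
  then show ?case by (simp add: occ_count_zero)
next
  case (Suc L)
  have "a + L < m" using Suc.prems by simp
  then obtain j where j: "j \<le> I + 1" "xs ! Suc (a + L) = occ_shift I n (xs ! (a + L)) j"
    using assms(2) unfolding occ_traj_def by blast
  have "occ_count I n (real (Suc L)) (xs ! a) (xs ! (a + Suc L)) l
    = occ_count I n (real L) (xs ! a) (xs ! (a + L)) l + occ_count I n 1 (xs ! (a + L)) (xs ! Suc (a + L)) l"
    unfolding occ_count_add by (simp add: add.commute)
  also have "\<dots> \<ge> 0" using Suc occ_count_shift[OF assms(1) j(1) assms(3)] by (simp add: j(2))
  finally show ?case .
qed

lemma occ_traj_count_sum:
  assumes "a \<le> b"
  shows "(\<Sum>i=a..<b. occ_count I n 1 (xs ! i) (xs ! Suc i) l) = occ_count I n (real (b - a)) (xs ! a) (xs ! b) l"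
  using assms
proof (induction b rule: dec_induct)
  case base
  then show ?case by (simp add: occ_count_zero)
next
  case (step b)
  then show ?case using occ_count_add[of I n "real (b - a)" "xs ! a" "xs ! b" l 1 "xs ! Suc b"]
    by (simp add: Suc_diff_le add.commute)
qed

text \<open>Between times \<open>s\<close> and \<open>t\<close> at most
  \<open>n * (t - s) + 1\<close> balls are thrown. Hence the flows through levels up to
  \<open>I\<close> can exceed the clock by at most \<open>1/n\<close>, which bounds the remainder
  assigned to the top level from below.\<close>

lemma occ_path_adm:
  assumes "n > 0" "\<beta> > 0" "occ_traj I n g0 (nat \<lfloor>real n * \<beta>\<rfloor>) xs"
  shows "occ_path \<beta> n xs \<in> admissible_paths I \<beta> (1 / real n)"
proof -
  let ?m = "nat \<lfloor>real n * \<beta>\<rfloor>"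
  define ix where "ix x = nat \<lfloor>real n * max 0 (min \<beta> x)\<rfloor>" for x
  have p: "occ_path \<beta> n xs x = xs ! ix x" for x by (simp add: occ_path_def ix_def)
  have ixm: "ix x \<le> ?m" for x unfolding ix_def using assms by (intro nat_mono floor_mono mult_left_mono) auto
  have "occ_path \<beta> n xs \<in> admissible_paths I \<beta> (1 / real n) \<longleftrightarrow>
    (\<forall>s t. 0 \<le> s \<and> s \<le> t \<and> t \<le> \<beta> \<longrightarrow>
        (\<forall>j\<le>I. 0 \<le> occ_flow I (occ_path \<beta> n xs) s t j) \<and> - (1 / real n) \<le> occ_flow I (occ_path \<beta> n xs) s t (I+1))"
    unfolding admissible_paths_def using occ_traj_simplex[OF assms(3) ixm] assms(2)
    by (auto simp: p) (auto simp: ix_def)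
  moreover have "(\<forall>j\<le>I. 0 \<le> occ_flow I (occ_path \<beta> n xs) s t j) \<and> - (1 / real n) \<le> occ_flow I (occ_path \<beta> n xs) s t (I+1)"
    if st: "0 \<le> s" "s \<le> t" "t \<le> \<beta>" for s t
  proof -
    have i1: "ix s = nat \<lfloor>real n * s\<rfloor>" "ix t = nat \<lfloor>real n * t\<rfloor>" using st by (simp_all add: ix_def)
    have "real n * s \<le> real n * t" using st by (simp add: mult_left_mono)
    then have le: "ix s \<le> ix t" unfolding i1 by (intro nat_mono floor_mono)
    define L where "L = ix t - ix s"
    have L: "ix t = ix s + L" using le by (simp add: L_def)
    have "real (ix s) = of_int \<lfloor>real n * s\<rfloor>" "real (ix t) = of_int \<lfloor>real n * t\<rfloor>" using st i1 by simp_all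
    then have Ln: "real L \<le> real n * (t - s) + 1" unfolding L_def of_nat_diff[OF le] right_diff_distrib by linarith
    have cnt: "0 \<le> occ_count I n (real L) (xs ! ix s) (xs ! ix t) l" if "l \<le> I + 1" for l
      using occ_traj_count_nonneg[OF assms(1,3) that, of "ix s" L] ixm[of t] L by simp
    have "0 \<le> occ_flow I (occ_path \<beta> n xs) s t j" if "j \<le> I" for j
    proof -
      have "0 \<le> real n * occ_flow I (occ_path \<beta> n xs) s t j"
        using cnt[of j] that by (simp add: occ_count_def occ_flow_def p)
      then show ?thesis using assms(1) by (simp add: zero_le_mult_iff)
    qed
    moreover have "- (1 / real n) \<le> occ_flow I (occ_path \<beta> n xs) s t (I+1)"
    proof -
      have "0 \<le> real L - real n * (\<Sum>i\<le>I. (\<Sum>k\<le>i. (xs ! ix s) k) - (\<Sum>k\<le>i. (xs ! ix t) k))"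
        using cnt[of "I+1"] by (simp add: occ_count_def sum_distrib_left)
      then have "0 \<le> real n * (t - s) + 1 - real n * (\<Sum>i\<le>I. (\<Sum>k\<le>i. (xs ! ix s) k) - (\<Sum>k\<le>i. (xs ! ix t) k))"
        using Ln by linarith
      also have "\<dots> = real n * (occ_flow I (occ_path \<beta> n xs) s t (I+1) + 1 / real n)"
        using assms(1) by (simp add: occ_flow_def p algebra_simps)
      finally have "0 \<le> occ_flow I (occ_path \<beta> n xs) s t (I+1) + 1 / real n"
        using assms(1) by (simp add: zero_le_mult_iff)
      then show ?thesis by linarith
    qed
    ultimately show ?thesis by blast
  qed
  ultimately show ?thesis by blast
qed

lemma eventually_floor_at_right: "eventually (\<lambda>x. \<lfloor>c * x\<rfloor> = \<lfloor>c * t :: real\<rfloor>) (at_right t)" if "c > 0" for c t :: real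
proof -
  have "t < (of_int \<lfloor>c * t\<rfloor> + 1) / c" using that by (simp add: pos_less_divide_eq mult.commute)
  then show ?thesis
    unfolding eventually_at_right_field
  proof (intro exI conjI allI impI)
    fix y assume y: "t < y" "y < (of_int \<lfloor>c * t\<rfloor> + 1) / c"
    then have "c * y < of_int \<lfloor>c * t\<rfloor> + 1" using that by (simp add: pos_less_divide_eq mult.commute)
    moreover have "c * t < c * y" using y that by simp
    ultimately show "\<lfloor>c * y\<rfloor> = \<lfloor>c * t\<rfloor>" by linarith
  qed
qed

lemma eventually_floor_at_left: "eventually (\<lambda>x. \<lfloor>c * x\<rfloor> = \<lceil>c * t :: real\<rceil> - 1) (at_left t)" if "c > 0" for c t :: real
proof -
  have "(of_int \<lceil>c * t\<rceil> - 1) / c < t" using that by (simp add: pos_divide_less_eq mult.commute) linarith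
  then show ?thesis
    unfolding eventually_at_left_field
  proof (intro exI conjI allI impI)
    fix y assume y: "y < t" "(of_int \<lceil>c * t\<rceil> - 1) / c < y"
    then have "of_int \<lceil>c * t\<rceil> - 1 < c * y" using that by (simp add: pos_divide_less_eq mult.commute)
    moreover have "c * y < c * t" using y that by simp
    ultimately show "\<lfloor>c * y\<rfloor> = \<lceil>c * t\<rceil> - 1" by linarith
  qed
qed

lemma occ_path_Dsp:
  assumes "n > 0" "\<beta> > 0" "occ_traj I n g0 (nat \<lfloor>real n * \<beta>\<rfloor>) xs"
  shows "occ_path \<beta> n xs \<in> Dsp I \<beta>"
proof -
  note a = occ_path_adm[OF assms]
  have n: "real n > 0" using assms by simp
  have p: "occ_path \<beta> n xs x = xs ! nat \<lfloor>real n * x\<rfloor>" if "0 \<le> x" "x \<le> \<beta>" for x using that by (simp add: occ_path_def)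
  have "(occ_path \<beta> n xs \<longlongrightarrow> occ_path \<beta> n xs t) (at_right t)" if t: "t \<in> {0..<\<beta>}" for t
  proof (rule tendsto_eventually)
    have "eventually (\<lambda>x. x \<in> {t<..<\<beta>}) (at_right t)" using t by (intro eventually_at_right_real) auto
    with eventually_floor_at_right[OF n, of t] show "eventually (\<lambda>x. occ_path \<beta> n xs x = occ_path \<beta> n xs t) (at_right t)"
      by eventually_elim (use t p in auto)
  qed
  moreover have "\<exists>l. (occ_path \<beta> n xs \<longlongrightarrow> l) (at_left t)" if t: "t \<in> {0<..\<beta>}" for t
  proof (intro exI tendsto_eventually)
    have "eventually (\<lambda>x. x \<in> {0<..<t}) (at_left t)" using t by (intro eventually_at_left_real) auto
    with eventually_floor_at_left[OF n, of t] show "eventually (\<lambda>x. occ_path \<beta> n xs x = xs ! nat (\<lceil>real n * t\<rceil> - 1)) (at_left t)"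
      by eventually_elim (use t p in auto)
  qed
  ultimately show ?thesis
    unfolding Dsp_def using admD(2,3)[OF a] occ_simplexD(2)[OF admD(1)[OF a]] by blast
qed

text \<open>Induction over the last throw. On the event that the current state is dominated by
  \<open>u m\<close>, the conditional expectation of the new exponential factor is at most the sum
  of \<open>u m l * exp (w m l)\<close>. The indicator keeps this domination available at every
  earlier step.\<close>

lemma occ_states_exp_bound:
  assumes n: "n > 0" and g0: "g0 \<in> occ_lattice I n" and u: "\<And>i j. 0 \<le> u i j"
  shows "(\<integral>\<^sup>+xs. indicator {xs. \<forall>i<m. \<forall>j\<le>I+1. (xs ! i) j \<le> u i j} xs *
      ennreal (exp (\<Sum>i<m. \<Sum>l\<le>I+1. w i l * occ_count I n 1 (xs ! i) (xs ! Suc i) l)) \<partial>measure_pmf (occ_states I n g0 m))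
    \<le> ennreal (\<Prod>i<m. \<Sum>l\<le>I+1. u i l * exp (w i l))"
proof (induction m)
  case 0
  then show ?case by simp
next
  case (Suc m)
  let ?E = "\<lambda>m. {xs. \<forall>i<m. \<forall>j\<le>I+1. (xs ! i) j \<le> u i j}"
  let ?S = "\<lambda>m xs. \<Sum>i<m. \<Sum>l\<le>I+1. w i l * occ_count I n 1 (xs ! i) (xs ! Suc i) l"
  let ?c = "\<Sum>l\<le>I+1. u m l * exp (w m l)"
  have c: "0 \<le> ?c" by (rule sum_nonneg) (use u in auto)
  have "(\<integral>\<^sup>+xs. indicator (?E (Suc m)) xs * ennreal (exp (?S (Suc m) xs)) \<partial>measure_pmf (occ_states I n g0 (Suc m)))
    = (\<integral>\<^sup>+xs. (\<integral>\<^sup>+j. indicator (?E (Suc m)) (xs @ [occ_shift I n (last xs) j]) * ennreal (exp (?S (Suc m) (xs @ [occ_shift I n (last xs) j])))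
          \<partial>measure_pmf (occ_choice I (last xs))) \<partial>measure_pmf (occ_states I n g0 m))"
    by (simp add: nn_integral_bind_pmf nn_integral_map_pmf occ_step_shift del: sum.atMost_Suc sum.lessThan_Suc)
  also have "\<dots> \<le> (\<integral>\<^sup>+xs. ennreal ?c * (indicator (?E m) xs * ennreal (exp (?S m xs))) \<partial>measure_pmf (occ_states I n g0 m))"
  proof (rule nn_integral_mono_AE, rule AE_pmfI)
    fix xs assume "xs \<in> set_pmf (occ_states I n g0 m)"
    then have t: "occ_traj I n g0 m xs" by (rule occ_states_traj[OF n g0])
    have len: "length xs = Suc m" using t by (simp add: occ_traj_def)
    have lastm: "last xs = xs ! m" by (rule occ_traj_last[OF t])
    have sx: "last xs \<in> occ_simplex I" unfolding lastm by (rule occ_traj_simplex[OF t]) simp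
    have nthy: "(xs @ [y]) ! i = xs ! i" if "i \<le> m" for i y using that len by (simp add: nth_append)
    have nthy': "(xs @ [y]) ! Suc m = y" for y using len by (simp add: nth_append)
    show "(\<integral>\<^sup>+j. indicator (?E (Suc m)) (xs @ [occ_shift I n (last xs) j]) * ennreal (exp (?S (Suc m) (xs @ [occ_shift I n (last xs) j])))
          \<partial>measure_pmf (occ_choice I (last xs))) \<le> ennreal ?c * (indicator (?E m) xs * ennreal (exp (?S m xs)))"
    proof (cases "xs \<in> ?E (Suc m)")
      case False
      have "xs @ [y] \<notin> ?E (Suc m)" for y using False nthy by (auto simp: less_Suc_eq_le)
      then show ?thesis by simp
    next
      case True
      have Sj: "?S (Suc m) (xs @ [occ_shift I n (last xs) j]) = ?S m xs + w m j" if "j \<le> I + 1" for j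
      proof -
        have "(\<Sum>l\<le>I+1. w m l * occ_count I n 1 ((xs @ [occ_shift I n (last xs) j]) ! m) ((xs @ [occ_shift I n (last xs) j]) ! Suc m) l)
          = (\<Sum>l\<le>I+1. if l = j then w m j else 0)"
          by (rule sum.cong) (use that in \<open>auto simp: nthy nthy' lastm[symmetric] occ_count_shift[OF n]\<close>)
        also have "\<dots> = w m j" using that by (simp del: sum.atMost_Suc)
        finally have "(\<Sum>l\<le>I+1. w m l * occ_count I n 1 ((xs @ [occ_shift I n (last xs) j]) ! m) ((xs @ [occ_shift I n (last xs) j]) ! Suc m) l) = w m j" .
        moreover have "?S m (xs @ [occ_shift I n (last xs) j]) = ?S m xs"
          by (intro sum.cong) (auto simp: nthy)
        ultimately show ?thesis by (simp add: sum.lessThan_Suc del: sum.atMost_Suc)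
      qed
      have "(\<integral>\<^sup>+j. indicator (?E (Suc m)) (xs @ [occ_shift I n (last xs) j]) * ennreal (exp (?S (Suc m) (xs @ [occ_shift I n (last xs) j])))
          \<partial>measure_pmf (occ_choice I (last xs)))
        \<le> (\<Sum>j\<le>I+1. ennreal (last xs j) * ennreal (exp (?S m xs + w m j)))"
        unfolding nn_integral_occ_choice[OF sx]
        by (intro sum_mono mult_left_mono) (use Sj in \<open>auto simp: indicator_def simp del: sum.atMost_Suc sum.lessThan_Suc\<close>)
      also have "\<dots> \<le> (\<Sum>j\<le>I+1. ennreal (u m j * exp (w m j) * exp (?S m xs)))"
      proof (rule sum_mono)
        fix j assume "j \<in> {..I+1}"
        then have "last xs j \<le> u m j" using True lastm by auto
        then have "last xs j * exp (?S m xs + w m j) \<le> u m j * exp (?S m xs + w m j)" by (intro mult_right_mono) auto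
        then show "ennreal (last xs j) * ennreal (exp (?S m xs + w m j)) \<le> ennreal (u m j * exp (w m j) * exp (?S m xs))"
          using occ_simplexD(1)[OF sx, of j] by (simp add: ennreal_mult'[symmetric] exp_add mult_ac ennreal_leI del: sum.atMost_Suc)
      qed
      also have "\<dots> = ennreal (\<Sum>j\<le>I+1. u m j * exp (w m j) * exp (?S m xs))"
        by (rule sum_ennreal) (use u in auto)
      also have "\<dots> = ennreal ?c * ennreal (exp (?S m xs))"
        unfolding sum_distrib_right[symmetric] using c by (simp add: ennreal_mult' del: sum.atMost_Suc)
      also have "\<dots> = ennreal ?c * (indicator (?E m) xs * ennreal (exp (?S m xs)))" using True by simp
      finally show ?thesis .
    qed
  qed
  also have "\<dots> = ennreal ?c * (\<integral>\<^sup>+xs. indicator (?E m) xs * ennreal (exp (?S m xs)) \<partial>measure_pmf (occ_states I n g0 m))"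
    by (rule nn_integral_cmult) simp
  also have "\<dots> \<le> ennreal ?c * ennreal (\<Prod>i<m. \<Sum>l\<le>I+1. u i l * exp (w i l))"
    by (rule mult_left_mono[OF Suc.IH]) simp
  also have "\<dots> = ennreal (\<Prod>i<Suc m. \<Sum>l\<le>I+1. u i l * exp (w i l))"
    using c by (simp add: ennreal_mult'[symmetric] mult.commute del: sum.atMost_Suc)
  finally show ?case .
qed

section \<open>Local upper bound\<close>

text \<open>A flow combines at most \<open>I + 1\<close> differences of partial sums of at most
  \<open>I + 1\<close> terms, each term being off by at most \<open>2 * e\<close>.\<close>

lemma occ_flow_close:
  assumes "\<And>j. j \<le> I + 1 \<Longrightarrow> \<bar>g s j - h s j\<bar> \<le> e" "\<And>j. j \<le> I + 1 \<Longrightarrow> \<bar>g t j - h t j\<bar> \<le> e" "0 \<le> e"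
  shows "\<bar>occ_flow I g s t l - occ_flow I h s t l\<bar> \<le> 2 * real (I+2) ^ 2 * e"
proof -
  have 1: "\<bar>((\<Sum>k\<le>i. g s k) - (\<Sum>k\<le>i. g t k)) - ((\<Sum>k\<le>i. h s k) - (\<Sum>k\<le>i. h t k))\<bar> \<le> real (I+2) * (2 * e)" if "i \<le> I" for i
  proof -
    have "((\<Sum>k\<le>i. g s k) - (\<Sum>k\<le>i. g t k)) - ((\<Sum>k\<le>i. h s k) - (\<Sum>k\<le>i. h t k)) = (\<Sum>k\<le>i. (g s k - h s k) - (g t k - h t k))"
      by (simp add: sum_subtractf)
    also have "\<bar>\<dots>\<bar> \<le> (\<Sum>k\<le>i. 2 * e)"
    proof (rule order_trans[OF sum_abs sum_mono])
      fix k assume "k \<in> {..i}"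
      then have "k \<le> I + 1" using that by simp
      from assms(1)[OF this] assms(2)[OF this] show "\<bar>(g s k - h s k) - (g t k - h t k)\<bar> \<le> 2 * e" by linarith
    qed
    also have "\<dots> = real (i + 1) * (2 * e)" by simp
    also have "\<dots> \<le> real (I+2) * (2 * e)" using that assms(3) by (intro mult_right_mono) auto
    finally show ?thesis .
  qed
  have sq: "real (I+2) * (2 * e) \<le> 2 * real (I+2) ^ 2 * e"
  proof -
    have "real (I+2) * 1 \<le> real (I+2) * real (I+2)" by (intro mult_left_mono) auto
    then have "(real (I+2) * 1) * (2 * e) \<le> (real (I+2) * real (I+2)) * (2 * e)" using assms(3) by (intro mult_right_mono) auto
    then show ?thesis by (simp add: power2_eq_square mult_ac)
  qed
  show ?thesis
  proof (cases "l \<le> I")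
    case True
    then show ?thesis using 1[OF True] sq by (simp add: occ_flow_def)
  next
    case False
    have "occ_flow I g s t l - occ_flow I h s t l
      = - (\<Sum>i\<le>I. ((\<Sum>k\<le>i. g s k) - (\<Sum>k\<le>i. g t k)) - ((\<Sum>k\<le>i. h s k) - (\<Sum>k\<le>i. h t k)))"
      using False by (simp add: occ_flow_def sum_subtractf)
    also have "\<bar>\<dots>\<bar> \<le> (\<Sum>i\<le>I. real (I+2) * (2 * e))"
      unfolding abs_minus_cancel by (rule order_trans[OF sum_abs sum_mono]) (use 1 in auto)
    also have "\<dots> = real (I+1) * (real (I+2) * (2 * e))" by simp
    also have "\<dots> \<le> real (I+2) * (real (I+2) * (2 * e))" using assms(3) by (intro mult_right_mono) auto
    also have "\<dots> = 2 * real (I+2) ^ 2 * e" by (simp add: power2_eq_square)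
    finally show ?thesis .
  qed
qed

section \<open>Grid times in units of thrown balls\<close>

lemma sum_lessThan_blocks:
  fixes s :: "nat \<Rightarrow> nat"
  assumes "s 0 = 0" "mono s"
  shows "(\<Sum>i<s N. f i) = (\<Sum>k<N. \<Sum>i=s k..<s (Suc k). f i)"
proof (induction N)
  case 0
  then show ?case using assms by simp
next
  case (Suc N)
  have "s N \<le> s (Suc N)" using assms by (simp add: monoD)
  then have "(\<Sum>i<s (Suc N). f i) = (\<Sum>i<s N. f i) + (\<Sum>i=s N..<s (Suc N). f i)"
    by (simp add: lessThan_atLeast0 sum.atLeastLessThan_concat)
  then show ?case using Suc by simp
qed

definition step_grid :: "real \<Rightarrow> nat \<Rightarrow> nat \<Rightarrow> nat \<Rightarrow> nat" where
  "step_grid \<beta> N n k = nat \<lfloor>real n * (real k * (\<beta> / real N))\<rfloor>"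

lemma step_grid_0 [simp]: "step_grid \<beta> N n 0 = 0"
  by (simp add: step_grid_def)

lemma step_grid_mono: "\<beta> > 0 \<Longrightarrow> mono (step_grid \<beta> N n)"
  unfolding step_grid_def mono_def by (auto intro!: nat_mono floor_mono mult_left_mono divide_right_mono)

lemma step_grid_last: "N > 0 \<Longrightarrow> step_grid \<beta> N n N = nat \<lfloor>real n * \<beta>\<rfloor>"
  by (simp add: step_grid_def)

lemma step_grid_bounds:
  assumes "\<beta> > 0"
  shows "real (step_grid \<beta> N n k) \<le> real n * (real k * (\<beta> / real N))"
    "real n * (real k * (\<beta> / real N)) - 1 < real (step_grid \<beta> N n k)"
proof -
  have "real (step_grid \<beta> N n k) = of_int \<lfloor>real n * (real k * (\<beta> / real N))\<rfloor>"
    using assms by (simp add: step_grid_def)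
  then show "real (step_grid \<beta> N n k) \<le> real n * (real k * (\<beta> / real N))"
    "real n * (real k * (\<beta> / real N)) - 1 < real (step_grid \<beta> N n k)" by linarith+
qed

lemma occ_path_step:
  assumes "n > 0" "real i \<le> real n * \<beta>"
  shows "occ_path \<beta> n xs (real i / real n) = xs ! i"
proof -
  have "real i / real n \<le> \<beta>" using assms by (simp add: field_simps)
  then have "real n * max 0 (min \<beta> (real i / real n)) = real i" using assms(1) by simp
  then show ?thesis by (simp add: occ_path_def)
qed

lemma occ_path_grid:
  assumes "\<beta> > 0" "N > 0" "k \<le> N"
  shows "occ_path \<beta> n xs (real k * (\<beta> / real N)) = xs ! step_grid \<beta> N n k"
proof -
  have "0 \<le> real k * (\<beta> / real N)" "real k * (\<beta> / real N) \<le> \<beta>" using assms grid_le by auto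
  then show ?thesis by (simp add: occ_path_def step_grid_def)
qed

text \<open>Exponential Chebyshev bound: in the ball around \<open>g\<close> the tilted counts are
  almost \<open>n * disc_cost\<close>, while each step contributes at most
  \<open>exp (2 * (I + 2) * d)\<close> to the exponential moment. The second fact accounts for the
  term subtracted in the hypothesis on \<open>M\<close>.\<close>

lemma occ_prob_sup_close_le:
  assumes b: "\<beta> > 0" and g: "g \<in> admissible_paths I \<beta> 0" and N: "N > 0"
    and M: "M < disc_cost I \<beta> N g - 2 * real (I+2) * (\<beta> / real N) * \<beta>"
  shows "\<exists>e>0. \<exists>n0. \<forall>n\<ge>n0. \<forall>g0\<in>occ_lattice I n. occ_prob I \<beta> n g0 {h. sup_close I \<beta> e g h} \<le> exp (- real n * M)"
proof -
  define d where "d = \<beta> / real N"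
  have d: "d > 0" using b N by (simp add: d_def)
  define t where "t k = real k * d" for k
  define a where "a k l = block_rate I \<beta> N g k l" for k l
  define y where "y k l = g (t k) l" for k l
  have y: "0 \<le> y k l" for k l unfolding y_def by (rule occ_simplexD(1)[OF admD(1)[OF g]])
  have a: "0 \<le> a k l" if "k < N" "l \<le> I + 1" for k l unfolding a_def by (rule block_rate_simplex(1)[OF b g that])
  \<comment> \<open>The logarithm of the optimal multiplier of the block, so that the rates weighted
    by \<open>w'\<close> sum to \<open>disc_cost\<close>.\<close>
  define w' where "w' k l = (if k < N \<and> l \<le> I + 1 then ln ((a k l + d) / (y k l + d)) else 0)" for k l
  define \<Lambda> where "\<Lambda> = (\<Sum>k<N. \<Sum>l\<le>I+1. \<bar>w' k l\<bar>)"
  have \<Lambda>: "0 \<le> \<Lambda>" unfolding \<Lambda>_def by (intro sum_nonneg) auto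
  define \<eta> where "\<eta> = disc_cost I \<beta> N g - 2 * real (I+2) * d * \<beta> - M"
  have \<eta>: "\<eta> > 0" using M by (simp add: \<eta>_def d_def)
  \<comment> \<open>The first bound gives \<open>e / d <= (I + 2) * d\<close> in the moment
    estimate; the second keeps the total effect of the flow errors on the exponent below
    \<eta>/2.\<close>
  define e where "e = min (real (I+2) * d\<^sup>2) (\<eta> / (4 * real (I+2) ^ 2 * (\<Lambda> + 1)))"
  have "0 < \<eta> / (4 * real (I+2) ^ 2 * (\<Lambda> + 1))" using \<eta> \<Lambda> by (intro divide_pos_pos mult_pos_pos) auto
  then have e: "e > 0" "e \<le> real (I+2) * d\<^sup>2" "e \<le> \<eta> / (4 * real (I+2) ^ 2 * (\<Lambda> + 1))" using d by (auto simp: e_def)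
  have e2: "2 * real (I+2) ^ 2 * e * \<Lambda> \<le> \<eta> / 2"
  proof -
    have "e * (4 * real (I+2) ^ 2 * (\<Lambda> + 1)) \<le> \<eta>" using e(3) \<Lambda> by (subst (asm) pos_le_divide_eq) (auto intro!: mult_pos_pos)
    moreover have "e * (4 * real (I+2) ^ 2 * \<Lambda>) \<le> e * (4 * real (I+2) ^ 2 * (\<Lambda> + 1))" using e(1) by (intro mult_left_mono) auto
    ultimately show ?thesis by (simp add: mult_ac)
  qed
  \<comment> \<open>Beyond \<open>n0\<close> the lag \<open>1/n\<close> of the step grid is below
    the mesh, and the rounding of the counts, one ball each and \<Lambda> in total, costs at most
    \<eta>/2 after division by \<open>n\<close>.\<close>
  obtain n0 :: nat where n0: "max (1 / d) (2 * \<Lambda> / \<eta>) < real n0" using reals_Archimedean2 by blast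
  show ?thesis
  proof (rule exI[of _ e], intro conjI e(1) exI[of _ "max n0 1"] allI impI ballI)
    fix n g0 assume nn: "max n0 1 \<le> n" and g0: "g0 \<in> occ_lattice I n"
    have n: "n > 0" using nn by simp
    have "max (1 / d) (2 * \<Lambda> / \<eta>) < real n" using n0 nn by simp
    then have "1 < real n * d" "2 * \<Lambda> < real n * \<eta>" using d \<eta> by (simp_all add: pos_divide_less_eq)
    then have nd: "1 / real n \<le> d" and n\<Lambda>: "\<Lambda> \<le> real n * (\<eta> / 2)" using n by (simp_all add: field_simps)
    define s where "s = step_grid \<beta> N n"
    define m where "m = nat \<lfloor>real n * \<beta>\<rfloor>"
    have s0: "s 0 = 0" and ms: "mono s" and sN: "s N = m"
      using step_grid_mono[OF b] step_grid_last[OF N] by (simp_all add: s_def m_def)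
    have mle: "real m \<le> real n * \<beta>" using b by (simp add: m_def)
    \<comment> \<open>The block that contains step \<open>i\<close>; blocks without any step are
      skipped.\<close>
    define kk where "kk i = (LEAST k. i < s (Suc k))" for i
    have kk: "kk i = k" if "s k \<le> i" "i < s (Suc k)" for i k
      unfolding kk_def
    proof (rule Least_equality)
      show "i < s (Suc k)" by (rule that(2))
    next
      fix k' assume "i < s (Suc k')"
      show "k \<le> k'"
      proof (rule ccontr)
        assume "\<not> k \<le> k'"
        then have "s (Suc k') \<le> s k" by (intro monoD[OF ms]) simp
        then show False using \<open>i < s (Suc k')\<close> that(1) by simp
      qed
    qed
    have kkN: "s (kk i) \<le> i \<and> i < s (Suc (kk i)) \<and> kk i < N" if "i < m" for i
    proof -
      have "i < s (Suc (N - 1))" using that N sN by simp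
      then have 1: "i < s (Suc (kk i))" and 2: "kk i \<le> N - 1" 
        unfolding kk_def by (rule LeastI[of "\<lambda>k. i < s (Suc k)"], rule Least_le)
      have "s (kk i) \<le> i"
      proof (cases "kk i")
        case 0
        then show ?thesis using s0 by simp
      next
        case (Suc k')
        then show ?thesis using not_less_Least[of k' "\<lambda>k. i < s (Suc k)"] unfolding kk_def by simp
      qed
      with 1 2 N show ?thesis by auto
    qed
    \<comment> \<open>An upper bound for the occupancy at step \<open>i\<close>: the value of
      \<open>g\<close> at the start of the block, plus \<open>d\<close> for the distance in time,
      plus \<open>e\<close> for the distance between the paths.\<close>
    define u where "u i l = y (kk i) l + d + e" for i l
    define w where "w i l = w' (kk i) l" for i l
    have u: "0 \<le> u i l" for i l using y d e by (simp add: u_def add_nonneg_nonneg)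
    let ?E = "{xs. \<forall>i<m. \<forall>j\<le>I+1. (xs ! i) j \<le> u i j}"
    let ?S = "\<lambda>xs. \<Sum>i<m. \<Sum>l\<le>I+1. w i l * occ_count I n 1 (xs ! i) (xs ! Suc i) l"
    define bb where "bb = real n * (disc_cost I \<beta> N g - \<eta>)"
    have key: "xs \<in> ?E \<and> bb \<le> ?S xs"
      if xs: "xs \<in> set_pmf (occ_states I n g0 m)" and close: "sup_close I \<beta> e g (occ_path \<beta> n xs)" for xs
    proof
      have tr: "occ_traj I n g0 m xs" by (rule occ_states_traj[OF n g0 xs])
      have c: "\<bar>g x j - occ_path \<beta> n xs x j\<bar> \<le> e" if "0 \<le> x" "x \<le> \<beta>" "j \<le> I + 1" for x j
        using close that by (simp add: sup_close_def)
      show "xs \<in> ?E"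
      proof (intro CollectI allI impI)
        fix i j assume i: "i < m" and j: "j \<le> I + 1"
        define x where "x = real i / real n"
        have inb: "real i \<le> real n * \<beta>" using i mle by linarith
        have x: "0 \<le> x" "x \<le> \<beta>" using inb n by (simp_all add: x_def field_simps)
        have "\<bar>g x j - (xs ! i) j\<bar> \<le> e" using c[OF x j] occ_path_step[OF n inb] by (simp add: x_def)
        moreover have "g x j \<le> y (kk i) j + d"
        proof -
          note k = kkN[OF i]
          have "real n * t (kk i) - 1 < real i" using k step_grid_bounds(2)[OF b, of n "kk i" N] by (simp add: s_def t_def d_def)
          moreover have "real i \<le> real n * t (Suc (kk i))"
            using k step_grid_bounds(1)[OF b, of N n "Suc (kk i)"] by (simp add: s_def t_def d_def)
          moreover have "t (Suc (kk i)) = t (kk i) + d" by (simp add: t_def algebra_simps)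
          moreover have "real i = real n * x" using n by (simp add: x_def)
          ultimately have "real n * (t (kk i) - 1 / real n) \<le> real n * x" "real n * x \<le> real n * (t (kk i) + d)"
            using n by (simp_all add: right_diff_distrib)
          then have "t (kk i) - 1 / real n \<le> x" "x \<le> t (kk i) + d" using n by (simp_all only: mult_le_cancel_left_pos of_nat_0_less_iff)
          then have "\<bar>x - t (kk i)\<bar> \<le> d" using nd d by linarith
          moreover have "\<bar>g x j - g (t (kk i)) j\<bar> \<le> \<bar>x - t (kk i)\<bar>" by (rule adm_0_Lipschitz[OF g]) (use b in simp)
          ultimately show ?thesis unfolding y_def by linarith
        qed
        ultimately show "(xs ! i) j \<le> u i j" unfolding u_def by linarith
      qed
      define cnt where "cnt k l = occ_count I n (real (s (Suc k) - s k)) (xs ! s k) (xs ! s (Suc k)) l" for k l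
      \<comment> \<open>The error of one count divided by \<open>n\<close>: the flow error plus the
        rounding of the grid to whole balls.\<close>
      define \<kappa> where "\<kappa> = 2 * real (I+2) ^ 2 * e + 1 / real n"
      have cnt: "\<bar>cnt k l - real n * (d * a k l)\<bar> \<le> real n * \<kappa>" if k: "k < N" and l: "l \<le> I + 1" for k l
      proof -
        let ?p = "occ_path \<beta> n xs"
        have pk: "?p (t k) = xs ! s k" "?p (t (Suc k)) = xs ! s (Suc k)"
          using occ_path_grid[OF b N, of k] occ_path_grid[OF b N, of "Suc k"] k by (simp_all only: t_def d_def s_def less_imp_le Suc_leI)
        have tk: "0 \<le> t k" "0 \<le> t (Suc k)" using d unfolding t_def by (intro mult_nonneg_nonneg; simp)+
        have tk': "t k \<le> \<beta>" "t (Suc k) \<le> \<beta>"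
          using grid_le[OF b, of k N] grid_le[OF b, of "Suc k" N] k N by (simp_all only: t_def d_def less_imp_le Suc_leI)
        have f1: "\<bar>occ_flow I g (t k) (t (Suc k)) l - occ_flow I ?p (t k) (t (Suc k)) l\<bar> \<le> 2 * real (I+2) ^ 2 * e"
          by (rule occ_flow_close) (use c tk tk' e(1) in auto)
        have fa: "occ_flow I g (t k) (t (Suc k)) l = d * a k l" using d by (simp add: a_def block_rate_def t_def d_def)
        have sk: "s k \<le> s (Suc k)" using ms by (simp add: monoD)
        have sb: "\<bar>(real (s (Suc k)) - real (s k)) - real n * (t (Suc k) - t k)\<bar> \<le> 1"
          using step_grid_bounds(1)[OF b, of N n k] step_grid_bounds(1)[OF b, of N n "Suc k"]
            step_grid_bounds(2)[OF b, of n k N] step_grid_bounds(2)[OF b, of n "Suc k" N]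
          unfolding s_def t_def d_def right_diff_distrib by linarith
        have f2: "\<bar>cnt k l - real n * occ_flow I ?p (t k) (t (Suc k)) l\<bar> \<le> 1"
        proof (cases "l \<le> I")
          case True
          then show ?thesis by (simp add: cnt_def occ_count_def occ_flow_def pk)
        next
          case False
          have "cnt k l - real n * occ_flow I ?p (t k) (t (Suc k)) l = (real (s (Suc k)) - real (s k)) - real n * (t (Suc k) - t k)"
            using False sk by (simp add: cnt_def occ_count_def occ_flow_def pk of_nat_diff right_diff_distrib sum_distrib_left)
          then show ?thesis using sb by simp
        qed
        have "\<bar>real n * occ_flow I ?p (t k) (t (Suc k)) l - real n * (d * a k l)\<bar> \<le> real n * (2 * real (I+2) ^ 2 * e)"
          unfolding right_diff_distrib[symmetric] abs_mult using f1 fa by (simp add: abs_minus_commute mult_left_mono)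
        then have "\<bar>cnt k l - real n * (d * a k l)\<bar> \<le> 1 + real n * (2 * real (I+2) ^ 2 * e)" using f2 by linarith
        also have "\<dots> = real n * \<kappa>" using n by (simp add: \<kappa>_def distrib_left)
        finally show ?thesis .
      qed
      have "?S xs = (\<Sum>k<N. \<Sum>i=s k..<s (Suc k). \<Sum>l\<le>I+1. w i l * occ_count I n 1 (xs ! i) (xs ! Suc i) l)"
        unfolding sN[symmetric] by (rule sum_lessThan_blocks[OF s0 ms])
      also have "\<dots> = (\<Sum>k<N. \<Sum>l\<le>I+1. w' k l * cnt k l)"
      proof (rule sum.cong)
        fix k assume "k \<in> {..<N}"
        have "(\<Sum>i=s k..<s (Suc k). \<Sum>l\<le>I+1. w i l * occ_count I n 1 (xs ! i) (xs ! Suc i) l)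
          = (\<Sum>i=s k..<s (Suc k). \<Sum>l\<le>I+1. w' k l * occ_count I n 1 (xs ! i) (xs ! Suc i) l)"
          by (intro sum.cong) (auto simp: w_def kk)
        also have "\<dots> = (\<Sum>l\<le>I+1. \<Sum>i=s k..<s (Suc k). w' k l * occ_count I n 1 (xs ! i) (xs ! Suc i) l)"
          by (rule sum.swap)
        also have "\<dots> = (\<Sum>l\<le>I+1. w' k l * cnt k l)"
          unfolding sum_distrib_left[symmetric] cnt_def using ms by (subst occ_traj_count_sum) (auto simp: monoD)
        finally show "(\<Sum>i=s k..<s (Suc k). \<Sum>l\<le>I+1. w i l * occ_count I n 1 (xs ! i) (xs ! Suc i) l) = (\<Sum>l\<le>I+1. w' k l * cnt k l)" .
      qed simp
      also have "\<dots> \<ge> (\<Sum>k<N. \<Sum>l\<le>I+1. real n * (d * (a k l * w' k l)) - \<bar>w' k l\<bar> * (real n * \<kappa>))"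
      proof (intro sum_mono)
        fix k l assume "k \<in> {..<N}" "l \<in> {..I+1}"
        then have "\<bar>w' k l * (cnt k l - real n * (d * a k l))\<bar> \<le> \<bar>w' k l\<bar> * (real n * \<kappa>)"
          unfolding abs_mult using cnt[of k l] by (intro mult_left_mono) auto
        moreover have "w' k l * cnt k l = real n * (d * (a k l * w' k l)) + w' k l * (cnt k l - real n * (d * a k l))"
          by (simp add: algebra_simps)
        ultimately show "real n * (d * (a k l * w' k l)) - \<bar>w' k l\<bar> * (real n * \<kappa>) \<le> w' k l * cnt k l" by linarith
      qed
      also have "(\<Sum>k<N. \<Sum>l\<le>I+1. real n * (d * (a k l * w' k l)) - \<bar>w' k l\<bar> * (real n * \<kappa>))
        = real n * disc_cost I \<beta> N g - \<Lambda> * (real n * \<kappa>)"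
      proof -
        have "disc_cost I \<beta> N g = (\<Sum>k<N. \<Sum>l\<le>I+1. d * (a k l * w' k l))"
          unfolding disc_cost_def block_cost_def sum_distrib_left
          by (intro sum.cong) (auto simp: w'_def a_def y_def t_def d_def)
        then show ?thesis unfolding \<Lambda>_def by (simp add: sum_subtractf sum_distrib_left sum_distrib_right del: sum.atMost_Suc)
      qed
      finally have "real n * disc_cost I \<beta> N g - \<Lambda> * (real n * \<kappa>) \<le> ?S xs" .
      moreover have "\<Lambda> * (real n * \<kappa>) \<le> real n * \<eta>"
      proof -
        have "\<Lambda> * (real n * \<kappa>) = real n * (2 * real (I+2) ^ 2 * e * \<Lambda>) + \<Lambda>"
          using n by (simp add: \<kappa>_def algebra_simps)
        also have "\<dots> \<le> real n * (\<eta> / 2) + real n * (\<eta> / 2)"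
          using e2 n\<Lambda> by (intro add_mono mult_left_mono) auto
        also have "\<dots> = real n * \<eta>" by (simp add: field_simps)
        finally show ?thesis .
      qed
      ultimately show "bb \<le> ?S xs" by (simp add: bb_def algebra_simps)
    qed
    define c where "c = 2 * real (I+2) * d"
    have prodle: "(\<Prod>i<m. \<Sum>l\<le>I+1. u i l * exp (w i l)) \<le> exp (real n * \<beta> * c)"
    proof -
      have "(\<Prod>i<m. \<Sum>l\<le>I+1. u i l * exp (w i l)) \<le> (\<Prod>i<m. exp c)"
      proof (rule prod_mono)
        fix i assume "i \<in> {..<m}"
        then have k: "kk i < N" using kkN by auto
        \<comment> \<open>The tilt \<open>(a + d) / (y + d)\<close> turns the occupancy bound
          \<open>y + d + e\<close> into \<open>a + d\<close>, up to the factor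
          \<open>1 + e / d\<close>, and the rates \<open>a\<close> of a block sum to one.\<close>
        have "(\<Sum>l\<le>I+1. u i l * exp (w i l)) \<le> (\<Sum>l\<le>I+1. (a (kk i) l + d) * (1 + e / d))"
        proof (rule sum_mono)
          fix l assume "l \<in> {..I+1}"
          then have l: "l \<le> I + 1" by simp
          have ad: "0 < a (kk i) l + d" using a[OF k l] d by linarith
          have yd: "d \<le> y (kk i) l + d" "0 < y (kk i) l + d" using y[of "kk i" l] d by linarith+
          have "exp (w i l) = (a (kk i) l + d) / (y (kk i) l + d)"
            using k l ad yd by (simp add: w_def w'_def)
          then have "u i l * exp (w i l) = (a (kk i) l + d) * ((y (kk i) l + d + e) / (y (kk i) l + d))" by (simp add: u_def)
          also have "(y (kk i) l + d + e) / (y (kk i) l + d) = 1 + e / (y (kk i) l + d)" using yd by (simp add: add_divide_distrib)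
          also have "(a (kk i) l + d) * (1 + e / (y (kk i) l + d)) \<le> (a (kk i) l + d) * (1 + e / d)"
            using ad yd d e by (intro mult_left_mono add_left_mono divide_left_mono mult_pos_pos) auto
          finally show "u i l * exp (w i l) \<le> (a (kk i) l + d) * (1 + e / d)" .
        qed
        also have "\<dots> = (1 + real (I+2) * d) * (1 + e / d)"
          unfolding sum_distrib_right[symmetric] using block_rate_simplex(2)[OF b g k] by (simp add: sum.distrib a_def del: sum.atMost_Suc)
        also have "\<dots> \<le> exp (real (I+2) * d) * exp (real (I+2) * d)"
        proof (rule mult_mono)
          have "e / d \<le> real (I+2) * d" using e(2) d by (simp add: pos_divide_le_eq power2_eq_square mult.assoc)
          then show "1 + e / d \<le> exp (real (I+2) * d)" using exp_ge_add_one_self[of "real (I+2) * d"] by linarith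
        qed (use d e in \<open>auto intro!: exp_ge_add_one_self\<close>)
        also have "\<dots> = exp c" by (simp add: exp_add[symmetric] c_def)
        finally have "(\<Sum>l\<le>I+1. u i l * exp (w i l)) \<le> exp c" .
        moreover have "0 \<le> (\<Sum>l\<le>I+1. u i l * exp (w i l))" using u by (intro sum_nonneg) auto
        ultimately show "0 \<le> (\<Sum>l\<le>I+1. u i l * exp (w i l)) \<and> (\<Sum>l\<le>I+1. u i l * exp (w i l)) \<le> exp c" by blast
      qed
      also have "\<dots> = exp (real m * c)" by (simp add: exp_of_nat_mult)
      also have "\<dots> \<le> exp (real n * \<beta> * c)" using mle d by (simp add: c_def mult_right_mono)
      finally show ?thesis .
    qed
    let ?A = "{h. sup_close I \<beta> e g h}"
    have "ennreal (occ_prob I \<beta> n g0 ?A) = emeasure (measure_pmf (occ_states I n g0 m)) (occ_path \<beta> n -` ?A)"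
      unfolding occ_prob_def occ_law_def m_def[symmetric] by (simp add: measure_pmf.emeasure_eq_measure)
    also have "\<dots> = (\<integral>\<^sup>+xs. indicator (occ_path \<beta> n -` ?A) xs \<partial>measure_pmf (occ_states I n g0 m))" by simp
    also have "\<dots> \<le> (\<integral>\<^sup>+xs. ennreal (exp (- bb)) * (indicator ?E xs * ennreal (exp (?S xs))) \<partial>measure_pmf (occ_states I n g0 m))"
    proof (rule nn_integral_mono_AE, rule AE_pmfI)
      fix xs assume xs: "xs \<in> set_pmf (occ_states I n g0 m)"
      show "indicator (occ_path \<beta> n -` ?A) xs \<le> ennreal (exp (- bb)) * (indicator ?E xs * ennreal (exp (?S xs)))"
      proof (cases "sup_close I \<beta> e g (occ_path \<beta> n xs)")
        case True
        note k = key[OF xs True]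
        have "ennreal 1 \<le> ennreal (exp (- bb) * exp (?S xs))" using k by (intro ennreal_leI) (simp add: exp_add[symmetric])
        then show ?thesis using k True by (simp add: ennreal_mult')
      next
        case False
        then show ?thesis by simp
      qed
    qed
    also have "\<dots> = ennreal (exp (- bb)) * (\<integral>\<^sup>+xs. indicator ?E xs * ennreal (exp (?S xs)) \<partial>measure_pmf (occ_states I n g0 m))"
      by (rule nn_integral_cmult) simp
    also have "\<dots> \<le> ennreal (exp (- bb)) * ennreal (\<Prod>i<m. \<Sum>l\<le>I+1. u i l * exp (w i l))"
      by (rule mult_left_mono[OF occ_states_exp_bound[OF n g0 u]]) simp
    also have "\<dots> \<le> ennreal (exp (- bb)) * ennreal (exp (real n * \<beta> * c))"
      by (intro mult_left_mono ennreal_leI prodle) simp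
    also have "\<dots> = ennreal (exp (- bb + real n * \<beta> * c))" by (simp only: exp_add ennreal_mult'[OF exp_ge_zero])
    finally have "occ_prob I \<beta> n g0 ?A \<le> exp (- bb + real n * \<beta> * c)" by simp
    also have "- bb + real n * \<beta> * c = - real n * M"
      by (simp add: bb_def c_def \<eta>_def algebra_simps)
    finally show "occ_prob I \<beta> n g0 ?A \<le> exp (- real n * M)" .
  qed
qed

lemma occ_prob_local_upper:
  assumes b: "\<beta> > 0" and g: "g \<in> admissible_paths I \<beta> 0" and M: "ereal M < occ_J I \<beta> g"
  shows "\<exists>e>0. \<exists>n0. \<forall>n\<ge>n0. \<forall>g0\<in>occ_lattice I n. occ_prob I \<beta> n g0 {h. sup_close I \<beta> e g h} \<le> exp (- real n * M)"
proof -
  obtain M' where M': "ereal M < ereal M'" "ereal M' < occ_J I \<beta> g" using M ereal_dense2 by blast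
  have ev1: "\<forall>\<^sub>F N in sequentially. M' < disc_cost I \<beta> N g"
    by (rule disc_cost_eventually_gt[OF b g M'(2)])
  have "(\<lambda>N. 2 * real (I+2) * (\<beta> / real N) * \<beta>) \<longlonglongrightarrow> 0" by real_asymp
  then have ev2: "\<forall>\<^sub>F N in sequentially. 2 * real (I+2) * (\<beta> / real N) * \<beta> < M' - M"
    by (rule order_tendstoD(2)) (use M' in simp)
  have "\<forall>\<^sub>F N in sequentially. N > 0 \<and> M < disc_cost I \<beta> N g - 2 * real (I+2) * (\<beta> / real N) * \<beta>"
    using ev1 ev2 eventually_gt_at_top[of 0] by eventually_elim auto
  then obtain N where "N > 0" "M < disc_cost I \<beta> N g - 2 * real (I+2) * (\<beta> / real N) * \<beta>"
    using eventually_happens'[OF sequentially_bot] by blast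
  then show ?thesis by (rule occ_prob_sup_close_le[OF b g])
qed

section \<open>Probabilities of prescribed occupancy counts\<close>

text \<open>The marginal law after \<open>L\<close> throws, while \<open>occ_states\<close> records
  the history; single blocks are estimated here and then attached to a history by
  \<open>occ_states_extend\<close>.\<close>

primrec occ_walk :: "nat \<Rightarrow> nat \<Rightarrow> nat \<Rightarrow> (nat \<Rightarrow> real) \<Rightarrow> (nat \<Rightarrow> real) pmf" where
  "occ_walk I n 0 x = return_pmf x"
| "occ_walk I n (Suc L) x = bind_pmf (occ_walk I n L x) (occ_step I n)"

text \<open>The state reached from \<open>x\<close> after \<open>c j\<close> throws at each level
  \<open>j\<close>; it depends on the counts and not on the order of the throws.\<close>

definition occ_disp :: "nat \<Rightarrow> nat \<Rightarrow> (nat \<Rightarrow> real) \<Rightarrow> (nat \<Rightarrow> nat) \<Rightarrow> nat \<Rightarrow> real" where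
  "occ_disp I n x c = (\<lambda>i. x i + (\<Sum>j\<le>I+1. real (c j) * occ_incr I n j i))"

lemma occ_states_markov:
  assumes "n > 0" "g0 \<in> occ_lattice I n"
  shows "(\<integral>\<^sup>+xs. indicator A (take (Suc m) xs) * f (last xs) \<partial>measure_pmf (occ_states I n g0 (m + L)))
    = (\<integral>\<^sup>+xs. indicator A xs * (\<integral>\<^sup>+y. f y \<partial>measure_pmf (occ_walk I n L (last xs))) \<partial>measure_pmf (occ_states I n g0 m))"
proof (induction L arbitrary: f)
  case 0
  have "(\<integral>\<^sup>+xs. indicator A (take (Suc m) xs) * f (last xs) \<partial>measure_pmf (occ_states I n g0 m))
    = (\<integral>\<^sup>+xs. indicator A xs * f (last xs) \<partial>measure_pmf (occ_states I n g0 m))"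
  proof (rule nn_integral_cong_AE, rule AE_pmfI)
    fix xs assume "xs \<in> set_pmf (occ_states I n g0 m)"
    then have "length xs = Suc m" using occ_states_traj[OF assms] by (auto simp: occ_traj_def)
    then show "indicator A (take (Suc m) xs) * f (last xs) = indicator A xs * f (last xs)" by simp
  qed
  then show ?case by simp
next
  case (Suc L)
  have "(\<integral>\<^sup>+xs. indicator A (take (Suc m) xs) * f (last xs) \<partial>measure_pmf (occ_states I n g0 (m + Suc L)))
    = (\<integral>\<^sup>+xs. (\<integral>\<^sup>+y. indicator A (take (Suc m) (xs @ [y])) * f (last (xs @ [y])) \<partial>measure_pmf (occ_step I n (last xs)))
        \<partial>measure_pmf (occ_states I n g0 (m + L)))"
    by (simp add: nn_integral_bind_pmf nn_integral_map_pmf)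
  also have "\<dots> = (\<integral>\<^sup>+xs. indicator A (take (Suc m) xs) * (\<integral>\<^sup>+y. f y \<partial>measure_pmf (occ_step I n (last xs)))
        \<partial>measure_pmf (occ_states I n g0 (m + L)))"
  proof (rule nn_integral_cong_AE, rule AE_pmfI)
    fix xs assume "xs \<in> set_pmf (occ_states I n g0 (m + L))"
    then have "length xs = Suc (m + L)" using occ_states_traj[OF assms] by (auto simp: occ_traj_def)
    then have "take (Suc m) (xs @ [y]) = take (Suc m) xs" for y by simp
    then show "(\<integral>\<^sup>+y. indicator A (take (Suc m) (xs @ [y])) * f (last (xs @ [y])) \<partial>measure_pmf (occ_step I n (last xs)))
      = indicator A (take (Suc m) xs) * (\<integral>\<^sup>+y. f y \<partial>measure_pmf (occ_step I n (last xs)))"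
      by (simp add: nn_integral_cmult del: take_append)
  qed
  also have "\<dots> = (\<integral>\<^sup>+xs. indicator A xs * (\<integral>\<^sup>+x. (\<integral>\<^sup>+y. f y \<partial>measure_pmf (occ_step I n x)) \<partial>measure_pmf (occ_walk I n L (last xs)))
     \<partial>measure_pmf (occ_states I n g0 m))"
    by (rule Suc.IH)
  also have "\<dots> = (\<integral>\<^sup>+xs. indicator A xs * (\<integral>\<^sup>+y. f y \<partial>measure_pmf (occ_walk I n (Suc L) (last xs))) \<partial>measure_pmf (occ_states I n g0 m))"
    by (simp add: nn_integral_bind_pmf)
  finally show ?case .
qed

text \<open>The Markov property at a time when the event \<open>A\<close> fixes the state: the
  history event and one further block multiply.\<close>

lemma occ_states_extend:
  assumes "n > 0" "g0 \<in> occ_lattice I n"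
    and "\<And>xs. xs \<in> A \<Longrightarrow> last xs = x"
  shows "measure_pmf.prob (occ_states I n g0 m) A * pmf (occ_walk I n L x) y
    \<le> measure_pmf.prob (occ_states I n g0 (m + L)) {xs. take (Suc m) xs \<in> A \<and> last xs = y}"
proof -
  let ?P = "\<lambda>m. measure_pmf (occ_states I n g0 m)"
  have "ennreal (measure_pmf.prob (occ_states I n g0 m) A * pmf (occ_walk I n L x) y)
    = emeasure (?P m) A * ennreal (pmf (occ_walk I n L x) y)"
    by (simp add: measure_pmf.emeasure_eq_measure ennreal_mult)
  also have "\<dots> = (\<integral>\<^sup>+xs. indicator A xs * ennreal (pmf (occ_walk I n L x) y) \<partial>?P m)"
    by (simp add: nn_integral_multc)
  also have "\<dots> = (\<integral>\<^sup>+xs. indicator A xs * (\<integral>\<^sup>+z. indicator {y} z \<partial>measure_pmf (occ_walk I n L (last xs))) \<partial>?P m)"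
  proof (rule nn_integral_cong)
    fix xs
    show "indicator A xs * ennreal (pmf (occ_walk I n L x) y)
      = indicator A xs * (\<integral>\<^sup>+z. indicator {y} z \<partial>measure_pmf (occ_walk I n L (last xs)))"
      by (cases "xs \<in> A") (simp_all add: assms(3) emeasure_pmf_single)
  qed
  also have "\<dots> = (\<integral>\<^sup>+xs. indicator A (take (Suc m) xs) * indicator {y} (last xs) \<partial>?P (m + L))"
    by (rule occ_states_markov[OF assms(1,2), symmetric])
  also have "\<dots> = (\<integral>\<^sup>+xs. indicator {xs. take (Suc m) xs \<in> A \<and> last xs = y} xs \<partial>?P (m + L))"
    by (rule nn_integral_cong) (auto simp: indicator_def)
  also have "\<dots> = ennreal (measure_pmf.prob (occ_states I n g0 (m + L)) {xs. take (Suc m) xs \<in> A \<and> last xs = y})"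
    by (simp add: measure_pmf.emeasure_eq_measure)
  finally show ?thesis by simp
qed

lemma occ_walk_compose: "pmf (occ_walk I n L x) y * pmf (occ_walk I n L' y) z \<le> pmf (occ_walk I n (L + L') x) z"
proof -
  have eq: "occ_walk I n (L + L') x = bind_pmf (occ_walk I n L x) (occ_walk I n L')"
    by (induction L') (simp_all add: bind_return_pmf' bind_assoc_pmf)
  have "ennreal (pmf (occ_walk I n L x) y * pmf (occ_walk I n L' y) z)
    = (\<integral>\<^sup>+v. indicator {y} v * ennreal (pmf (occ_walk I n L' y) z) \<partial>measure_pmf (occ_walk I n L x))"
    by (simp add: nn_integral_multc emeasure_pmf_single ennreal_mult)
  also have "\<dots> \<le> (\<integral>\<^sup>+v. ennreal (pmf (occ_walk I n L' v) z) \<partial>measure_pmf (occ_walk I n L x))"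
    by (rule nn_integral_mono) (auto simp: indicator_def)
  also have "\<dots> = ennreal (pmf (occ_walk I n (L + L') x) z)" unfolding eq by (simp add: ennreal_pmf_bind)
  finally show ?thesis by simp
qed

section \<open>Reaching prescribed counts\<close>

lemma occ_disp_zero [simp]: "occ_disp I n x (\<lambda>_. 0) = x"
  by (simp add: occ_disp_def)

lemma occ_disp_add: "occ_disp I n (occ_disp I n x c) c' = occ_disp I n x (\<lambda>j. c j + c' j)"
  by (simp add: occ_disp_def sum.distrib distrib_right add.assoc del: sum.atMost_Suc)

lemma occ_disp_shift:
  assumes "j \<le> I + 1"
  shows "occ_shift I n (occ_disp I n x c) j = occ_disp I n x (c(j := Suc (c j)))"
proof
  fix i
  have "(\<Sum>l\<le>I+1. real ((c(j := Suc (c j))) l) * occ_incr I n l i)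
    = (\<Sum>l\<le>I+1. real (c l) * occ_incr I n l i + (if l = j then occ_incr I n j i else 0))"
    by (rule sum.cong) (auto simp: algebra_simps)
  also have "\<dots> = (\<Sum>l\<le>I+1. real (c l) * occ_incr I n l i) + occ_incr I n j i"
    using assms by (simp add: sum.distrib del: sum.atMost_Suc)
  finally show "occ_shift I n (occ_disp I n x c) j i = occ_disp I n x (c(j := Suc (c j))) i"
    by (simp add: occ_shift_def occ_disp_def del: sum.atMost_Suc)
qed

lemma occ_disp_component:
  assumes "i \<le> I + 1"
  shows "occ_disp I n x c i = x i + ((if i = 0 then 0 else real (c (i - 1))) - (if i \<le> I then real (c i) else 0)) / real n"
proof -
  have "(\<Sum>j\<le>I+1. real (c j) * occ_incr I n j i)
    = (\<Sum>j\<le>I+1. (if i > 0 \<and> j = i - 1 then real (c (i - 1)) / real n else 0) - (if j = i then if i \<le> I then real (c i) / real n else 0 else 0))"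
    by (rule sum.cong) (use assms in \<open>auto simp: occ_incr_def\<close>)
  also have "\<dots> = (if i > 0 then real (c (i - 1)) / real n else 0) - (if i \<le> I then real (c i) / real n else 0)"
    unfolding sum_subtractf using assms by (cases "i = 0") (auto simp del: sum.atMost_Suc)
  finally show ?thesis by (auto simp: occ_disp_def diff_divide_distrib simp del: sum.atMost_Suc)
qed

text \<open>Different levels hit by the last ball come from different predecessor states, so their
  contributions to the mass of a state may be added. The top level takes part with the zero
  increment.\<close>

lemma inj_on_occ_incr: "n > 0 \<Longrightarrow> inj_on (occ_incr I n) {..I+1}"
proof (rule inj_onI, rule ccontr)
  fix j l assume n: "n > 0" and jl: "j \<in> {..I+1}" "l \<in> {..I+1}" "occ_incr I n j = occ_incr I n l" "j \<noteq> l"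
  have *: "occ_incr I n j \<noteq> occ_incr I n l" if "j \<le> I" "j \<noteq> l" for j l
  proof
    assume "occ_incr I n j = occ_incr I n l"
    then have "occ_incr I n j j = occ_incr I n l j" by simp
    then show False using that n by (auto simp: occ_incr_def split: if_splits)
  qed
  show False using *[of j l] *[of l j] jl by (cases "j \<le> I") auto
qed

lemma pmf_occ_step_ge:
  assumes "z \<in> occ_simplex I"
  shows "z j \<le> pmf (occ_step I n z) (occ_shift I n z j)"
proof -
  have "z j = measure_pmf.prob (occ_choice I z) {j}" using pmf_occ_choice[OF assms] by (simp add: pmf.rep_eq)
  also have "\<dots> \<le> measure_pmf.prob (occ_choice I z) (occ_shift I n z -` {occ_shift I n z j})"
    by (rule measure_pmf.finite_measure_mono) auto
  also have "\<dots> = pmf (occ_step I n z) (occ_shift I n z j)"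
    by (simp add: occ_step_shift pmf_map)
  finally show ?thesis .
qed

text \<open>Whatever the order in which counts \<open>m\<close> are thrown, the level hit next has occupancy at least \<open>q\<close>.\<close>

definition occ_feasible :: "nat \<Rightarrow> nat \<Rightarrow> (nat \<Rightarrow> real) \<Rightarrow> (nat \<Rightarrow> real) \<Rightarrow> (nat \<Rightarrow> nat) \<Rightarrow> bool" where
  "occ_feasible I n q x m \<longleftrightarrow> (\<forall>c. (\<forall>j\<le>I+1. c j \<le> m j) \<longrightarrow> (\<forall>j\<le>I+1. c j < m j \<longrightarrow> q j \<le> occ_disp I n x c j))"

lemma occ_feasible_pred:
  assumes "occ_feasible I n q x m" "j \<le> I + 1" "m j > 0"
  shows "occ_feasible I n q x (m(j := m j - 1))" "q j \<le> occ_disp I n x (m(j := m j - 1)) j"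
proof -
  show "occ_feasible I n q x (m(j := m j - 1))"
    unfolding occ_feasible_def
  proof (intro allI impI)
    fix c i assume c: "\<forall>i\<le>I+1. c i \<le> (m(j := m j - 1)) i" and i: "i \<le> I + 1" "c i < (m(j := m j - 1)) i"
    have "c i \<le> m i" if "i \<le> I + 1" for i using c that by (cases "i = j") (auto intro: order_trans[OF _ diff_le_self])
    moreover have "c i < m i" using i by (cases "i = j") auto
    ultimately show "q i \<le> occ_disp I n x c i" using assms(1) i(1) unfolding occ_feasible_def by blast
  qed
  have 1: "\<forall>i\<le>I+1. (m(j := m j - 1)) i \<le> m i" by auto
  have 2: "(m(j := m j - 1)) j < m j" using assms(3) by simp
  show "q j \<le> occ_disp I n x (m(j := m j - 1)) j"
    using assms(1,2) 1 2 unfolding occ_feasible_def by blast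
qed

lemma sum_fun_upd_pred:
  assumes "j \<le> (N::nat)" "m j > 0"
  shows "Suc (\<Sum>i\<le>N. (m(j := m j - 1)) i) = (\<Sum>i\<le>N. m i :: nat)"
  using assms by (simp add: sum.remove[of "{..N}" j])

lemma occ_disp_lattice:
  assumes n: "n > 0" and x: "x \<in> occ_lattice I n" and q: "\<And>j. j \<le> I + 1 \<Longrightarrow> 0 < q j"
  shows "occ_feasible I n q x m \<Longrightarrow> occ_disp I n x m \<in> occ_lattice I n"
proof (induction "\<Sum>j\<le>I+1. m j" arbitrary: m)
  case 0
  then have "m j = 0" if "j \<le> I + 1" for j using that by (simp add: sum_eq_0_iff del: sum.atMost_Suc)
  then have "occ_disp I n x m = occ_disp I n x (\<lambda>_. 0)" by (auto simp: occ_disp_def fun_eq_iff intro!: sum.cong simp del: sum.atMost_Suc)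
  then show ?case using x by simp
next
  case (Suc L)
  then have "\<exists>j\<le>I+1. m j \<noteq> 0" by (metis sum.neutral atMost_iff nat.distinct(1))
  then obtain j where j: "j \<le> I + 1" "m j > 0" by auto
  let ?m = "m(j := m j - 1)"
  note f = occ_feasible_pred[of I n q x m j, OF Suc.prems j]
  have "L = (\<Sum>i\<le>I+1. ?m i)" using Suc.hyps(2) sum_fun_upd_pred[of j "I+1" m, OF j] by (metis Suc_inject)
  then have l: "occ_disp I n x ?m \<in> occ_lattice I n" using Suc.hyps(1) f(1) by blast
  have "0 < occ_disp I n x ?m j" using f(2) q[OF j(1)] by linarith
  from occ_shift_lattice[OF n l j(1) this] show ?case
    unfolding occ_disp_shift[OF j(1)] using j(2) by simp
qed

text \<open>The multinomial coefficient counts the orders of the throws, and by feasibility every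
  order has probability at least the product of the powers of \<open>q\<close>. Induction on the
  last ball avoids enumerating the orders.\<close>

lemma occ_walk_multinomial:
  assumes n: "n > 0" and x: "x \<in> occ_lattice I n" and q: "\<And>j. j \<le> I + 1 \<Longrightarrow> 0 < q j"
  shows "occ_feasible I n q x m \<Longrightarrow>
    fact (\<Sum>j\<le>I+1. m j) * (\<Prod>j\<le>I+1. q j ^ m j / fact (m j)) \<le> pmf (occ_walk I n (\<Sum>j\<le>I+1. m j) x) (occ_disp I n x m)"
proof (induction "\<Sum>j\<le>I+1. m j" arbitrary: m)
  case 0
  then have m0: "m j = 0" if "j \<le> I + 1" for j using that by (simp add: sum_eq_0_iff del: sum.atMost_Suc)
  then have "occ_disp I n x m = occ_disp I n x (\<lambda>_. 0)" by (auto simp: occ_disp_def fun_eq_iff intro!: sum.cong simp del: sum.atMost_Suc)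
  moreover have "(\<Prod>j\<le>I+1. q j ^ m j / fact (m j)) = 1" by (rule prod.neutral) (use m0 in auto)
  ultimately show ?case using 0(1) by (simp flip: 0(1) del: sum.atMost_Suc prod.atMost_Suc)
next
  case (Suc L)
  \<comment> \<open>The levels that the last ball can have hit; \<open>z j\<close> is the state just
    before it.\<close>
  define J where "J = {j. j \<le> I + 1 \<and> m j > 0}"
  have J: "finite J" "J \<subseteq> {..I+1}" by (auto simp: J_def)
  define y where "y = occ_disp I n x m"
  define mm where "mm j = m(j := m j - 1)" for j
  define z where "z j = occ_disp I n x (mm j)" for j
  define R where "R = (\<Prod>j\<le>I+1. q j ^ m j / fact (m j))"
  have mL: "(\<Sum>i\<le>I+1. mm j i) = L" if "j \<in> J" for j
    using sum_fun_upd_pred[of j "I+1" m] that Suc.hyps(2) unfolding mm_def J_def by (metis (mono_tags, lifting) Suc_inject mem_Collect_eq)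
  have zs: "occ_shift I n (z j) j = y" if "j \<in> J" for j
    unfolding z_def mm_def y_def using that by (subst occ_disp_shift) (auto simp: J_def)
  have f: "occ_feasible I n q x (mm j)" "q j \<le> z j j" if "j \<in> J" for j
    using occ_feasible_pred[OF Suc.prems, of j] that by (auto simp: J_def mm_def z_def)
  have lat: "z j \<in> occ_simplex I" if "j \<in> J" for j
    using occ_disp_lattice[OF n x q f(1)[OF that]] by (simp add: z_def occ_lattice_def)
  have injz: "inj_on z J"
  proof (rule inj_onI)
    fix j l assume jl: "j \<in> J" "l \<in> J" "z j = z l"
    have "occ_incr I n j i = y i - z j i" for i using zs[OF jl(1)] by (auto simp: occ_shift_def)
    moreover have "occ_incr I n l i = y i - z l i" for i using zs[OF jl(2)] by (auto simp: occ_shift_def)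
    ultimately have "occ_incr I n j = occ_incr I n l" using jl(3) by (simp add: fun_eq_iff)
    then show "j = l" using inj_on_occ_incr[OF n] jl J(2) by (auto dest: inj_onD)
  qed
  have step: "pmf (occ_walk I n L x) (z j) * pmf (occ_step I n (z j)) y \<ge> fact L * (real (m j) * R)" if j: "j \<in> J" for j
  proof -
    have jI: "j \<in> {..I+1}" "m j > 0" using j by (auto simp: J_def)
    have IH: "fact L * (\<Prod>i\<le>I+1. q i ^ mm j i / fact (mm j i)) \<le> pmf (occ_walk I n L x) (z j)"
      using Suc.hyps(1)[of "mm j"] f(1)[OF j] mL[OF j] by (simp add: z_def)
    have "q j \<le> pmf (occ_step I n (z j)) y"
      using pmf_occ_step_ge[OF lat[OF j], of j n] zs[OF j] f(2)[OF j] by simp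
    then have "(fact L * (\<Prod>i\<le>I+1. q i ^ mm j i / fact (mm j i))) * q j \<le> pmf (occ_walk I n L x) (z j) * pmf (occ_step I n (z j)) y"
      using IH q jI(1) by (intro mult_mono) (auto intro: less_imp_le)
    moreover have "(\<Prod>i\<le>I+1. q i ^ mm j i / fact (mm j i)) * q j = real (m j) * R"
    proof -
      have 1: "(\<Prod>i\<le>I+1. q i ^ mm j i / fact (mm j i)) = (q j ^ (m j - 1) / fact (m j - 1)) * (\<Prod>i\<in>{..I+1} - {j}. q i ^ m i / fact (m i))"
        using jI by (subst prod.remove[of _ j]) (auto simp: mm_def simp del: prod.atMost_Suc)
      have 2: "R = (q j ^ m j / fact (m j)) * (\<Prod>i\<in>{..I+1} - {j}. q i ^ m i / fact (m i))"
        unfolding R_def using jI by (subst prod.remove[of _ j]) auto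
      have 3: "(q j ^ (m j - 1) / fact (m j - 1)) * q j = real (m j) * (q j ^ m j / fact (m j))"
      proof -
        obtain k where "m j = Suc k" using jI(2) by (cases "m j") auto
        then show ?thesis by (simp del: of_nat_Suc)
      qed
      have "\<And>A P B c :: real. A * q j = c * B \<Longrightarrow> A * P * q j = c * (B * P)"
        by (metis mult.assoc mult.commute)
      from this[OF 3] show ?thesis unfolding 1 2 .
    qed
    ultimately show ?thesis by (simp add: mult.assoc del: prod.atMost_Suc)
  qed
  \<comment> \<open>The recursion of the multinomial coefficient: the counts \<open>m j\<close> sum
    to \<open>Suc L\<close>.\<close>
  have "fact (Suc L) * R = (\<Sum>j\<in>J. fact L * (real (m j) * R))"
  proof -
    have "(\<Sum>j\<in>J. real (m j)) = (\<Sum>j\<le>I+1. real (m j))"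
      by (rule sum.mono_neutral_left) (auto simp: J_def)
    also have "\<dots> = real (Suc L)" using Suc.hyps(2) by (simp del: sum.atMost_Suc flip: of_nat_sum)
    finally show ?thesis unfolding sum_distrib_left[symmetric] sum_distrib_right[symmetric] by (simp add: algebra_simps)
  qed
  also have "\<dots> \<le> (\<Sum>j\<in>J. pmf (occ_walk I n L x) (z j) * pmf (occ_step I n (z j)) y)"
    by (rule sum_mono) (rule step)
  also have "\<dots> = (\<Sum>v\<in>z ` J. pmf (occ_walk I n L x) v * pmf (occ_step I n v) y)"
    by (simp add: sum.reindex[OF injz])
  also have "\<dots> \<le> pmf (occ_walk I n (Suc L) x) y"
  proof -
    have "ennreal (\<Sum>v\<in>z ` J. pmf (occ_walk I n L x) v * pmf (occ_step I n v) y)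
      = (\<Sum>v\<in>z ` J. ennreal (pmf (occ_walk I n L x) v) * ennreal (pmf (occ_step I n v) y))"
      by (subst sum_ennreal[symmetric]) (auto simp: ennreal_mult)
    also have "\<dots> = (\<integral>\<^sup>+v. ennreal (pmf (occ_walk I n L x) v) * (ennreal (pmf (occ_step I n v) y) * indicator (z ` J) v) \<partial>count_space UNIV)"
      using J(1) by (subst nn_integral_count_space'[of "z ` J"]) (auto intro!: sum.cong)
    also have "\<dots> \<le> (\<integral>\<^sup>+v. ennreal (pmf (occ_walk I n L x) v) * ennreal (pmf (occ_step I n v) y) \<partial>count_space UNIV)"
      by (rule nn_integral_mono) (auto simp: indicator_def)
    also have "\<dots> = ennreal (pmf (occ_walk I n (Suc L) x) y)"
      by (simp add: ennreal_pmf_bind nn_integral_measure_pmf)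
    finally show ?thesis by simp
  qed
  finally show ?case unfolding R_def y_def Suc.hyps(2)[symmetric] .
qed

text \<open>Throwing at the levels in increasing order never depletes a level below its final occupancy.\<close>

lemma occ_walk_ordered:
  assumes n: "n > 0" and x: "x \<in> occ_lattice I n" and q: "0 < q"
    and final: "\<And>j. j \<le> I + 1 \<Longrightarrow> m j > 0 \<Longrightarrow> q \<le> occ_disp I n x m j"
  shows "q ^ (\<Sum>j\<le>I+1. m j) \<le> pmf (occ_walk I n (\<Sum>j\<le>I+1. m j) x) (occ_disp I n x m)"
proof -
  \<comment> \<open>The counts after all throws at the levels below \<open>J\<close>.\<close>
  define cc where "cc J j = (if j < J then m j else 0)" for J j :: nat
  have "J \<le> I + 2 \<Longrightarrow> occ_disp I n x (cc J) \<in> occ_lattice I n \<and>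
    q ^ (\<Sum>j<J. m j) \<le> pmf (occ_walk I n (\<Sum>j<J. m j) x) (occ_disp I n x (cc J))" for J
  proof (induction J)
    case 0
    have "cc 0 = (\<lambda>_. 0)" by (simp add: cc_def fun_eq_iff)
    then show ?case using x by simp
  next
    case (Suc J)
    then have J: "J \<le> I + 1" by simp
    let ?y = "occ_disp I n x (cc J)"
    have y: "?y \<in> occ_lattice I n" and py: "q ^ (\<Sum>j<J. m j) \<le> pmf (occ_walk I n (\<Sum>j<J. m j) x) ?y"
      using Suc by auto
    define mj where "mj j = (if j = J then m J else 0)" for j
    define Q where "Q j = q" for j :: nat
    have sum_mj: "(\<Sum>j\<le>I+1. mj j) = m J" using J by (simp add: mj_def del: sum.atMost_Suc)
    have disp: "occ_disp I n ?y mj = occ_disp I n x (cc (Suc J))"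
      unfolding occ_disp_add by (rule arg_cong[where f="occ_disp I n x"]) (auto simp: cc_def mj_def fun_eq_iff less_Suc_eq)
    have feas: "occ_feasible I n Q ?y mj"
      unfolding occ_feasible_def
    proof (intro allI impI)
      fix c j assume c: "\<forall>j\<le>I+1. c j \<le> mj j" and j: "j \<le> I + 1" "c j < mj j"
      have jJ: "j = J" using j(2) by (auto simp: mj_def split: if_splits)
      have cJ: "c J < m J" using j(2) jJ by (simp add: mj_def)
      \<comment> \<open>At this stage level \<open>J\<close> has received everything from level
        \<open>J - 1\<close> and can only lose by its own throws, so its final occupancy is the
        smallest one.\<close>
      have "q \<le> occ_disp I n x m J" using final[OF J] cJ by simp
      also have "\<dots> \<le> occ_disp I n x (\<lambda>j. cc J j + c j) J"
        unfolding occ_disp_component[OF J]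
      proof (intro add_left_mono divide_right_mono diff_mono)
        show "(if J = 0 then 0 else real (m (J - 1))) \<le> (if J = 0 then 0 else real (cc J (J - 1) + c (J - 1)))" by (simp add: cc_def)
        show "(if J \<le> I then real (cc J J + c J) else 0) \<le> (if J \<le> I then real (m J) else 0)" using cJ by (simp add: cc_def)
      qed simp
      finally show "Q j \<le> occ_disp I n ?y c j" unfolding occ_disp_add Q_def jJ .
    qed
    have 1: "fact (m J) * (\<Prod>j\<le>I+1. q ^ mj j / fact (mj j)) \<le> pmf (occ_walk I n (m J) ?y) (occ_disp I n x (cc (Suc J)))"
      using occ_walk_multinomial[OF n y _ feas] q sum_mj disp by (simp add: Q_def del: prod.atMost_Suc sum.atMost_Suc)
    have "(\<Prod>j\<le>I+1. q ^ mj j / fact (mj j)) = (\<Prod>j\<le>I+1. if j = J then q ^ m J / fact (m J) else 1)"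
      by (rule prod.cong) (auto simp: mj_def)
    also have "\<dots> = q ^ m J / fact (m J)" using J by (simp del: prod.atMost_Suc)
    finally have 2: "q ^ m J \<le> pmf (occ_walk I n (m J) ?y) (occ_disp I n x (cc (Suc J)))" using 1 by simp
    have "q ^ (\<Sum>j<Suc J. m j) = q ^ (\<Sum>j<J. m j) * q ^ m J" by (simp add: power_add)
    also have "\<dots> \<le> pmf (occ_walk I n (\<Sum>j<J. m j) x) ?y * pmf (occ_walk I n (m J) ?y) (occ_disp I n x (cc (Suc J)))"
      using py 2 q by (intro mult_mono) auto
    also have "\<dots> \<le> pmf (occ_walk I n (\<Sum>j<Suc J. m j) x) (occ_disp I n x (cc (Suc J)))"
      using occ_walk_compose by simp
    finally have "q ^ (\<Sum>j<Suc J. m j) \<le> pmf (occ_walk I n (\<Sum>j<Suc J. m j) x) (occ_disp I n x (cc (Suc J)))" .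
    moreover have "occ_disp I n x (cc (Suc J)) \<in> occ_lattice I n"
      using occ_disp_lattice[OF n y _ feas] q disp by (simp add: Q_def)
    ultimately show ?case by blast
  qed
  from this[of "I + 2"] have "q ^ (\<Sum>j<I+2. m j) \<le> pmf (occ_walk I n (\<Sum>j<I+2. m j) x) (occ_disp I n x (cc (I+2)))" by simp
  moreover have "{..<I+2} = {..I+1}" by auto
  moreover have "occ_disp I n x (cc (I+2)) = occ_disp I n x m"
    by (auto simp: occ_disp_def cc_def fun_eq_iff intro!: sum.cong simp del: sum.atMost_Suc)
  ultimately show ?thesis by metis
qed

section \<open>Stirling bounds and asymptotics of multinomial coefficients\<close>

lemma ln_fact_ge: "real L * ln (real L) - real L \<le> ln (fact L)"
proof (induction L)
  case (Suc L)
  have "real L * (ln (real (Suc L)) - ln (real L)) \<le> 1"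
  proof (cases "L = 0")
    case False
    then have "ln (real (Suc L)) - ln (real L) = ln (1 + 1 / real L)" 
    proof -
      have "ln (real (Suc L)) - ln (real L) = ln (real (Suc L) / real L)" using False by (simp add: ln_div del: of_nat_Suc)
      also have "real (Suc L) / real L = 1 + 1 / real L" using False by (simp add: add_divide_distrib)
      finally show ?thesis .
    qed
    also have "\<dots> \<le> 1 / real L" by (rule ln_add_one_self_le_self) simp
    finally show ?thesis using False by (simp add: field_simps)
  qed simp
  then have "real (Suc L) * ln (real (Suc L)) - real (Suc L) \<le> ln (real (Suc L)) + (real L * ln (real L) - real L)"
    by (simp add: algebra_simps)
  also have "\<dots> \<le> ln (real (Suc L)) + ln (fact L)" using Suc by simp
  also have "\<dots> = ln (fact (Suc L))" by (simp add: ln_mult del: of_nat_Suc)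
  finally show ?case .
qed simp

text \<open>A crude upper Stirling bound. Its excess over the main term is logarithmic in
  \<open>m\<close>, hence negligible on the scale \<open>n\<close>.\<close>

lemma ln_fact_le: "ln (fact m) \<le> real m * ln (real m) - real m + 2 * ln (real m + 1) + (1::real)"
proof (induction m)
  case (Suc m)
  have "1 \<le> real m * (ln (real m + 1) - ln (real m)) + 2 * (ln (real m + 2) - ln (real m + 1))"
  proof -
    have *: "1 / (x + 1) \<le> ln (x + 1) - ln x" if "x > 0" for x :: real
    proof -
      have "ln (x / (x + 1)) \<le> x / (x + 1) - 1" using that by (intro ln_le_minus_one) simp
      also have "x / (x + 1) - 1 = - (1 / (x + 1))" using that by (simp add: field_simps)
      finally show ?thesis using that by (simp add: ln_div)
    qed
    have "real m / (real m + 1) \<le> real m * (ln (real m + 1) - ln (real m))"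
    proof (cases "m = 0")
      case False
      then have "real m * (1 / (real m + 1)) \<le> real m * (ln (real m + 1) - ln (real m))" by (intro mult_left_mono *) auto
      then show ?thesis by simp
    qed simp
    moreover have "1 / (real m + 2) \<le> ln (real m + 2) - ln (real m + 1)" using *[of "real m + 1"] by (simp add: add.assoc)
    moreover have "1 \<le> real m / (real m + 1) + 2 * (1 / (real m + 2))"
    proof -
      have "real m / (real m + 1) + 2 * (1 / (real m + 2)) - 1 = real m / ((real m + 1) * (real m + 2))"
        by (simp add: divide_simps) (simp add: algebra_simps)
      also have "\<dots> \<ge> 0" by simp
      finally show ?thesis by simp
    qed
    moreover have "\<And>a b x y :: real. a \<le> x \<Longrightarrow> b \<le> y \<Longrightarrow> 1 \<le> a + 2 * b \<Longrightarrow> 1 \<le> x + 2 * y" by linarith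
    ultimately show ?thesis by blast
  qed
  moreover have "ln (fact (Suc m)) = ln (real m + 1) + ln (fact m)" by (simp add: ln_mult add.commute)
  ultimately show ?case using Suc by (simp add: algebra_simps)
qed simp

lemma ln_multinomial_ge:
  fixes m :: "nat \<Rightarrow> nat" and q :: "nat \<Rightarrow> real"
  assumes q: "\<And>j. j \<le> J \<Longrightarrow> 0 < q j" and n: "n > 0" and L: "(\<Sum>j\<le>J. m j) > 0"
  shows "real n * (\<Sum>j\<le>J. real (m j) / real n * (ln (real (\<Sum>j\<le>J. m j) / real n) - ln (real (m j) / real n) + ln (q j))
      - (2 * ln (real (m j) + 1) + 1) / real n)
    \<le> ln (fact (\<Sum>j\<le>J. m j) * (\<Prod>j\<le>J. q j ^ m j / fact (m j)))"
proof -
  let ?L = "\<Sum>j\<le>J. m j"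
  have "ln (fact ?L * (\<Prod>j\<le>J. q j ^ m j / fact (m j))) = ln (fact ?L) + (\<Sum>j\<le>J. ln (q j ^ m j / fact (m j)))"
  proof -
    have pos: "0 < q j ^ m j / fact (m j)" if "j \<le> J" for j using q[OF that] by simp
    have "0 < (\<Prod>j\<le>J. q j ^ m j / fact (m j))" by (rule prod_pos) (use pos in simp)
    moreover have "ln (a * b) = ln a + ln b" if "0 < a" "0 < b" for a b :: real using that by (simp add: ln_mult)
    ultimately have "ln (fact ?L * (\<Prod>j\<le>J. q j ^ m j / fact (m j))) = ln (fact ?L) + ln (\<Prod>j\<le>J. q j ^ m j / fact (m j))"
      using fact_gt_zero by blast
    also have "ln (\<Prod>j\<le>J. q j ^ m j / fact (m j)) = (\<Sum>j\<le>J. ln (q j ^ m j / fact (m j)))"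
    proof (rule ln_prod)
      show "q j ^ m j / fact (m j) \<noteq> 0" if "j \<in> {..J}" for j using pos[of j] that by (intro less_imp_neq[symmetric]) simp
    qed simp
    finally show ?thesis .
  qed
  also have "(\<Sum>j\<le>J. ln (q j ^ m j / fact (m j))) = (\<Sum>j\<le>J. real (m j) * ln (q j) - ln (fact (m j)))"
  proof (rule sum.cong)
    fix j assume "j \<in> {..J}"
    then have "0 < q j" using q by simp
    then show "ln (q j ^ m j / fact (m j)) = real (m j) * ln (q j) - ln (fact (m j))" by (simp add: ln_div ln_realpow)
  qed simp
  also have "ln (fact ?L) + (\<Sum>j\<le>J. real (m j) * ln (q j) - ln (fact (m j)))
    \<ge> (real ?L * ln (real ?L) - real ?L) + (\<Sum>j\<le>J. real (m j) * ln (q j) - (real (m j) * ln (real (m j)) - real (m j) + 2 * ln (real (m j) + 1) + 1))"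
    by (intro add_mono ln_fact_ge sum_mono diff_left_mono ln_fact_le)
  also have "(real ?L * ln (real ?L) - real ?L) + (\<Sum>j\<le>J. real (m j) * ln (q j) - (real (m j) * ln (real (m j)) - real (m j) + 2 * ln (real (m j) + 1) + 1))
    = (\<Sum>j\<le>J. real (m j) * (ln (real ?L) - ln (real (m j)) + ln (q j)) - (2 * ln (real (m j) + 1) + 1))"
  proof -
    have eq: "real ?L * w - real ?L = (\<Sum>j\<le>J. real (m j) * w - real (m j))" for w
      by (simp add: sum_subtractf sum_distrib_right)
    have "(real ?L * w - real ?L) + (\<Sum>j\<le>J. real (m j) * ln (q j) - (real (m j) * ln (real (m j)) - real (m j) + 2 * ln (real (m j) + 1) + 1))
      = (\<Sum>j\<le>J. real (m j) * (w - ln (real (m j)) + ln (q j)) - (2 * ln (real (m j) + 1) + 1))" for w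
      unfolding eq sum.distrib[symmetric] by (rule sum.cong) (simp_all add: algebra_simps)
    then show ?thesis .
  qed
  also have "\<dots> = real n * (\<Sum>j\<le>J. real (m j) / real n * (ln (real ?L / real n) - ln (real (m j) / real n) + ln (q j))
      - (2 * ln (real (m j) + 1) + 1) / real n)"
    unfolding sum_distrib_left
  proof (rule sum.cong)
    fix j
    have "real (m j) * (ln (real ?L) - ln (real (m j)) + ln (q j)) = real (m j) * (ln (real ?L / real n) - ln (real (m j) / real n) + ln (q j))"
    proof (cases "m j = 0")
      case False
      have "ln (a / real n) - ln (b / real n) = ln a - ln b" if "0 < a" "0 < b" for a b using that n by (simp add: ln_div)
      from this[of "real ?L" "real (m j)"] False L
      have "ln (real ?L / real n) - ln (real (m j) / real n) = ln (real ?L) - ln (real (m j))" by (simp del: of_nat_sum)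
      then show ?thesis by (simp only:)
    qed simp
    then show "real (m j) * (ln (real ?L) - ln (real (m j)) + ln (q j)) - (2 * ln (real (m j) + 1) + 1)
      = real n * (real (m j) / real n * (ln (real ?L / real n) - ln (real (m j) / real n) + ln (q j)) - (2 * ln (real (m j) + 1) + 1) / real n)"
      using n by (simp add: right_diff_distrib)
  qed simp
  finally show ?thesis .
qed

text \<open>After division by \<open>n\<close> the Stirling terms converge wherever
  \<open>p j > 0\<close>; a level with \<open>p j = 0\<close> is never hit and leaves only its
  logarithmic error. The limit is the entropy of \<open>p\<close> relative to \<open>P * q\<close>,
  with \<open>P\<close> the total share of balls thrown.\<close>

lemma multinomial_asymp:
  fixes m :: "nat \<Rightarrow> nat \<Rightarrow> nat" and p q :: "nat \<Rightarrow> real"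
  assumes lim: "\<And>j. j \<le> J \<Longrightarrow> (\<lambda>n. real (m n j) / real n) \<longlonglongrightarrow> p j"
    and p: "\<And>j. j \<le> J \<Longrightarrow> p j > 0 \<or> p j = 0 \<and> (\<forall>n. m n j = 0)"
    and P: "(\<Sum>j\<le>J. p j) = P" "P > 0"
    and q: "\<And>j. j \<le> J \<Longrightarrow> 0 < q j" and \<eta>: "\<eta> > 0"
  shows "eventually (\<lambda>n. - real n * ((\<Sum>j\<le>J. p j * ln (p j / (P * q j))) + \<eta>)
     \<le> ln (fact (\<Sum>j\<le>J. m n j) * (\<Prod>j\<le>J. q j ^ m n j / fact (m n j))) \<and> (\<Sum>j\<le>J. m n j) > 0) sequentially"
proof -
  have limL: "(\<lambda>n. real (\<Sum>j\<le>J. m n j) / real n) \<longlonglongrightarrow> P"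
    unfolding of_nat_sum sum_divide_distrib P(1)[symmetric] by (intro tendsto_sum) (use lim in auto)
  have small: "(\<lambda>n. (2 * ln (real (m n j) + 1) + 1) / real n) \<longlonglongrightarrow> 0" if j: "j \<le> J" for j
  proof (rule Lim_null_comparison)
    define K where "K = p j + 1"
    have K: "K > 0" using p[OF j] by (auto simp: K_def)
    have "\<forall>\<^sub>F n in sequentially. real (m n j) / real n < K"
      by (rule order_tendstoD(2)[OF lim[OF j]]) (simp add: K_def)
    with eventually_gt_at_top[of 0] show "\<forall>\<^sub>F n in sequentially. norm ((2 * ln (real (m n j) + 1) + 1) / real n) \<le> (2 * ln (K * real n + 1) + 1) / real n"
    proof eventually_elim
      case (elim n)
      then have "real (m n j) \<le> K * real n" by (simp add: pos_divide_less_eq)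
      then have "ln (real (m n j) + 1) \<le> ln (K * real n + 1)" by (subst ln_le_cancel_iff) auto
      moreover have "0 \<le> ln (real (m n j) + 1)" by simp
      ultimately show ?case using elim by (simp add: divide_right_mono)
    qed
    show "(\<lambda>n. (2 * ln (K * real n + 1) + 1) / real n) \<longlonglongrightarrow> 0" using K by real_asymp
  qed
  define T where "T n j = real (m n j) / real n * (ln (real (\<Sum>j\<le>J. m n j) / real n) - ln (real (m n j) / real n) + ln (q j))
      - (2 * ln (real (m n j) + 1) + 1) / real n" for n j
  have limT: "(\<lambda>n. T n j) \<longlonglongrightarrow> - (p j * ln (p j / (P * q j)))" if j: "j \<le> J" for j
  proof (cases "p j > 0")
    case True
    have "(\<lambda>n. T n j) \<longlonglongrightarrow> p j * (ln P - ln (p j) + ln (q j)) - 0"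
      unfolding T_def by (intro tendsto_intros lim[OF j] limL small[OF j]) (use P True in auto)
    also have "p j * (ln P - ln (p j) + ln (q j)) - 0 = - (p j * ln (p j / (P * q j)))"
      using True P q[OF j] by (simp add: ln_div ln_mult algebra_simps)
    finally show ?thesis .
  next
    case False
    then have z: "p j = 0" "m n j = 0" for n using p[OF j] by auto
    have "(\<lambda>n. T n j) = (\<lambda>n. - ((2 * ln (real (m n j) + 1) + 1) / real n))" by (simp add: T_def z)
    then show ?thesis using tendsto_minus[OF small[OF j]] z by simp
  qed
  have "(\<lambda>n. \<Sum>j\<le>J. T n j) \<longlonglongrightarrow> (\<Sum>j\<le>J. - (p j * ln (p j / (P * q j))))"
    by (intro tendsto_sum) (use limT in auto)
  then have "\<forall>\<^sub>F n in sequentially. (\<Sum>j\<le>J. - (p j * ln (p j / (P * q j)))) - \<eta> < (\<Sum>j\<le>J. T n j)"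
    by (rule order_tendstoD(1)) (use \<eta> in simp)
  moreover have "\<forall>\<^sub>F n in sequentially. 0 < real (\<Sum>j\<le>J. m n j) / real n"
    by (rule order_tendstoD(1)[OF limL P(2)])
  ultimately show ?thesis using eventually_gt_at_top[of 0]
  proof eventually_elim
    case (elim n)
    have L: "(\<Sum>j\<le>J. m n j) > 0" using elim(2) by (metis div_0 less_irrefl of_nat_0 gr0I)
    have "real n * ((\<Sum>j\<le>J. - (p j * ln (p j / (P * q j)))) - \<eta>) \<le> real n * (\<Sum>j\<le>J. T n j)"
      using elim(1) by (intro mult_left_mono) auto
    also have "\<dots> \<le> ln (fact (\<Sum>j\<le>J. m n j) * (\<Prod>j\<le>J. q j ^ m n j / fact (m n j)))"
      unfolding T_def using ln_multinomial_ge[of J q n "m n", OF q elim(3) L] by blast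
    finally show ?case using L by (simp add: sum_negf algebra_simps)
  qed
qed

lemma nat_floor_over_n: "x \<ge> 0 \<Longrightarrow> (\<lambda>n. real (nat \<lfloor>real n * x\<rfloor>) / real n) \<longlonglongrightarrow> x"
proof (rule tendsto_sandwich)
  assume x: "x \<ge> 0"
  have fl: "real (nat \<lfloor>real n * x\<rfloor>) = of_int \<lfloor>real n * x\<rfloor>" for n using x by simp
  show "\<forall>\<^sub>F n in sequentially. x - 1 / real n \<le> real (nat \<lfloor>real n * x\<rfloor>) / real n"
    using eventually_gt_at_top[of 0]
  proof eventually_elim
    case (elim n)
    have "(real n * x - 1) / real n \<le> real (nat \<lfloor>real n * x\<rfloor>) / real n" unfolding fl by (intro divide_right_mono) linarith+
    then show ?case using elim by (simp add: diff_divide_distrib)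
  qed
  show "\<forall>\<^sub>F n in sequentially. real (nat \<lfloor>real n * x\<rfloor>) / real n \<le> x"
    using eventually_gt_at_top[of 0]
  proof eventually_elim
    case (elim n)
    have "real (nat \<lfloor>real n * x\<rfloor>) / real n \<le> real n * x / real n" unfolding fl by (intro divide_right_mono) linarith+
    then show ?case using elim by simp
  qed
  show "(\<lambda>n. x - 1 / real n) \<longlonglongrightarrow> x" by real_asymp
qed simp

text \<open>\<open>\<psi> k j\<close> is the flow through level \<open>j\<close> up to the \<open>k\<close>-th grid time; levels below \<open>i0\<close> are never hit,
  and \<open>[0, k0 \<beta>/N]\<close> is the initial layer on which the path may touch the boundary.\<close>

locale occ_grid =
  fixes I :: nat and \<beta> :: real and N :: nat and \<Gamma>0 :: "nat \<Rightarrow> nat \<Rightarrow> real" and \<alpha> :: "nat \<Rightarrow> real"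
    and i0 k0 :: nat and \<psi> q :: "nat \<Rightarrow> nat \<Rightarrow> real" and q0 :: real
  assumes \<beta>: "\<beta> > 0" and N: "N > 0"
    and lat: "\<And>n. n > 0 \<Longrightarrow> \<Gamma>0 n \<in> occ_lattice I n"
    and lim: "\<And>j. (\<lambda>n. \<Gamma>0 n j) \<longlonglongrightarrow> \<alpha> j"
    and i0: "i0 \<le> I + 1" and k0: "k0 \<le> N"
    and \<psi>0: "\<And>j. \<psi> 0 j = 0"
    and \<psi>i: "\<And>k j. j < i0 \<Longrightarrow> \<psi> k j = 0"
    and \<psi>sum: "\<And>k. k \<le> N \<Longrightarrow> (\<Sum>j\<le>I+1. \<psi> k j) = real k * (\<beta> / real N)"
    and \<psi>inc: "\<And>k j. k < N \<Longrightarrow> i0 \<le> j \<Longrightarrow> j \<le> I + 1 \<Longrightarrow> \<psi> k j < \<psi> (Suc k) j"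
    and q: "\<And>k j. k0 \<le> k \<Longrightarrow> k < N \<Longrightarrow> i0 \<le> j \<Longrightarrow> j \<le> I + 1 \<Longrightarrow> 0 < q k j \<and>
      q k j < \<alpha> j + (if j = 0 then 0 else \<psi> k (j-1)) - (if j \<le> I then \<psi> k j else 0) - \<beta> / real N"
    and q0: "0 < q0" "q0 \<le> 1" "\<And>j. i0 \<le> j \<Longrightarrow> j \<le> I + 1 \<Longrightarrow>
      q0 < \<alpha> j + (if j = 0 then 0 else \<psi> k0 (j-1)) - (if j \<le> I then \<psi> k0 j else 0)"
begin

text \<open>Levels up to \<open>I\<close> get the rounded flows, and the top level gets the rest, so
  that the counts sum exactly to the number of balls thrown by the grid time.
  \<open>sum_floor_le\<close> ensures that the subtraction of naturals is not truncated.\<close>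

definition target_count :: "nat \<Rightarrow> nat \<Rightarrow> nat \<Rightarrow> nat" where
  "target_count n k j = (if j \<le> I then nat \<lfloor>real n * \<psi> k j\<rfloor>
     else if j = I + 1 then step_grid \<beta> N n k - (\<Sum>i\<le>I. nat \<lfloor>real n * \<psi> k i\<rfloor>) else 0)"

definition target_state :: "nat \<Rightarrow> nat \<Rightarrow> nat \<Rightarrow> real" where
  "target_state n k = occ_disp I n (\<Gamma>0 n) (target_count n k)"

definition target_limit :: "nat \<Rightarrow> nat \<Rightarrow> real" where
  "target_limit k j = \<alpha> j + (if j = 0 then 0 else \<psi> k (j-1)) - (if j \<le> I then \<psi> k j else 0)"

definition block_count :: "nat \<Rightarrow> nat \<Rightarrow> nat \<Rightarrow> nat" where
  "block_count n k j = target_count n (Suc k) j - target_count n k j"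

section \<open>Convergence of the prescribed counts and states\<close>

lemma \<psi>_mono: "k < N \<Longrightarrow> j \<le> I + 1 \<Longrightarrow> \<psi> k j \<le> \<psi> (Suc k) j"
  using \<psi>inc[of k j] \<psi>i[of j k] \<psi>i[of j "Suc k"] by (cases "i0 \<le> j") auto

lemma \<psi>_nonneg: "k \<le> N \<Longrightarrow> j \<le> I + 1 \<Longrightarrow> 0 \<le> \<psi> k j"
proof (induction k)
  case (Suc k)
  then show ?case using \<psi>_mono[of k j] by simp
qed (simp add: \<psi>0)

lemma sum_floor_le:
  assumes "k \<le> N"
  shows "(\<Sum>i\<le>I. nat \<lfloor>real n * \<psi> k i\<rfloor>) \<le> step_grid \<beta> N n k"
proof -
  have "(\<Sum>i\<le>I. real_of_int \<lfloor>real n * \<psi> k i\<rfloor>) \<le> (\<Sum>i\<le>I. real n * \<psi> k i)" by (rule sum_mono) simp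
  also have "\<dots> = real n * (\<Sum>i\<le>I. \<psi> k i)" by (simp add: sum_distrib_left)
  also have "\<dots> \<le> real n * (real k * (\<beta> / real N))"
    using \<psi>sum[OF assms] \<psi>_nonneg[OF assms, of "I+1"] by (intro mult_left_mono) auto
  finally have "real_of_int (\<Sum>i\<le>I. \<lfloor>real n * \<psi> k i\<rfloor>) \<le> real n * (real k * (\<beta> / real N))" by simp
  then have "(\<Sum>i\<le>I. \<lfloor>real n * \<psi> k i\<rfloor>) \<le> \<lfloor>real n * (real k * (\<beta> / real N))\<rfloor>" by (simp add: le_floor_iff)
  moreover have "int (\<Sum>i\<le>I. nat \<lfloor>real n * \<psi> k i\<rfloor>) = (\<Sum>i\<le>I. \<lfloor>real n * \<psi> k i\<rfloor>)"
    unfolding of_nat_sum by (rule sum.cong) (use \<psi>_nonneg[OF assms] in auto)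
  ultimately show ?thesis unfolding step_grid_def by linarith
qed

lemma sum_target_count: "k \<le> N \<Longrightarrow> (\<Sum>j\<le>I+1. target_count n k j) = step_grid \<beta> N n k"
  using sum_floor_le[of k n] by (simp add: target_count_def)

lemma target_count_below: "j < i0 \<Longrightarrow> target_count n k j = 0"
  using i0 by (simp add: target_count_def \<psi>i)

lemma target_count_lim:
  assumes "k \<le> N" "j \<le> I + 1"
  shows "(\<lambda>n. real (target_count n k j) / real n) \<longlonglongrightarrow> \<psi> k j"
proof (cases "j \<le> I")
  case True
  then show ?thesis using nat_floor_over_n[OF \<psi>_nonneg[OF assms]] by (simp add: target_count_def)
next
  case False
  then have j: "j = I + 1" using assms by simp
  have nn: "0 \<le> real k * (\<beta> / real N)" using \<beta> by simp
  have "(\<lambda>n. real (step_grid \<beta> N n k) / real n - (\<Sum>i\<le>I. real (nat \<lfloor>real n * \<psi> k i\<rfloor>) / real n)) \<longlonglongrightarrow> real k * (\<beta> / real N) - (\<Sum>i\<le>I. \<psi> k i)"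
    unfolding step_grid_def using assms by (intro tendsto_diff tendsto_sum nat_floor_over_n \<psi>_nonneg nn) auto
  moreover have "real k * (\<beta> / real N) - (\<Sum>i\<le>I. \<psi> k i) = \<psi> k j" using \<psi>sum[OF assms(1)] j by simp
  moreover have "real (step_grid \<beta> N n k) / real n - (\<Sum>i\<le>I. real (nat \<lfloor>real n * \<psi> k i\<rfloor>) / real n) = real (target_count n k j) / real n" for n
    using sum_floor_le[OF assms(1), of n] j by (simp add: target_count_def of_nat_diff diff_divide_distrib sum_divide_distrib)
  ultimately show ?thesis by simp
qed

lemma target_state_lim:
  assumes "k \<le> N" "j \<le> I + 1"
  shows "(\<lambda>n. target_state n k j) \<longlonglongrightarrow> target_limit k j"
proof -
  have c: "(\<lambda>n. real (target_count n k i) / real n) \<longlonglongrightarrow> \<psi> k i" if "i \<le> I + 1" for i by (rule target_count_lim[OF assms(1) that])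
  have "target_state n k j = \<Gamma>0 n j + ((if j = 0 then 0 else real (target_count n k (j - 1)) / real n) - (if j \<le> I then real (target_count n k j) / real n else 0))" for n
    unfolding target_state_def occ_disp_component[OF assms(2)] by (simp add: diff_divide_distrib)
  moreover have "(\<lambda>n. \<Gamma>0 n j + ((if j = 0 then 0 else real (target_count n k (j - 1)) / real n) - (if j \<le> I then real (target_count n k j) / real n else 0)))
    \<longlonglongrightarrow> \<alpha> j + ((if j = 0 then 0 else \<psi> k (j-1)) - (if j \<le> I then \<psi> k j else 0))"
    using assms by (intro tendsto_add lim tendsto_diff) (auto intro: c)
  ultimately show ?thesis by (simp add: target_limit_def add_diff_eq)
qed

text \<open>The top count is a difference of rounded quantities, so it can decrease for small
  \<open>n\<close>. The strict growth of \<psi> at the levels that are hit outweighs the rounding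
  for large \<open>n\<close>.\<close>

lemma target_count_mono_eventually:
  assumes k: "k < N"
  shows "\<forall>\<^sub>F n in sequentially. \<forall>j\<in>{..I+1}. target_count n k j \<le> target_count n (Suc k) j"
proof (rule eventually_ball_finite)
  show "\<forall>j\<in>{..I+1}. \<forall>\<^sub>F n in sequentially. target_count n k j \<le> target_count n (Suc k) j"
  proof
    fix j assume "j \<in> {..I+1}"
    then have j: "j \<le> I + 1" by simp
    show "\<forall>\<^sub>F n in sequentially. target_count n k j \<le> target_count n (Suc k) j"
    proof (cases "i0 \<le> j")
      case False
      then show ?thesis by (simp add: target_count_below)
    next
      case True
      have "(\<lambda>n. real (target_count n (Suc k) j) / real n - real (target_count n k j) / real n) \<longlonglongrightarrow> \<psi> (Suc k) j - \<psi> k j"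
        using k j by (intro tendsto_diff target_count_lim) auto
      then have "\<forall>\<^sub>F n in sequentially. 0 < real (target_count n (Suc k) j) / real n - real (target_count n k j) / real n"
        by (rule order_tendstoD(1)) (use \<psi>inc[OF k True j] in simp)
      then show ?thesis using eventually_gt_at_top[of 0]
        by eventually_elim (auto simp: field_simps)
    qed
  qed
qed simp

definition block_prob_cost :: "nat \<Rightarrow> real" where
  "block_prob_cost k = (\<Sum>j\<in>{i0..I+1}. (\<psi> (Suc k) j - \<psi> k j) * ln ((\<psi> (Suc k) j - \<psi> k j) / (\<beta> / real N * q k j)))"

text \<open>Within a block a level loses at most its own throws, a share of at most \<beta>/N, so
  whatever the order its occupancy stays above \<open>q k j\<close>; the multinomial bound then
  applies. The alternative in the conclusion is there because the target is known to be a lattice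
  point only once some trajectory has reached it.\<close>

lemma block_prob_eventually:
  assumes k: "k0 \<le> k" "k < N" and \<eta>: "\<eta> > 0"
  shows "\<forall>\<^sub>F n in sequentially. exp (- real n * (block_prob_cost k + \<eta>))
     \<le> pmf (occ_walk I n (step_grid \<beta> N n (Suc k) - step_grid \<beta> N n k) (target_state n k)) (target_state n (Suc k))
       \<or> target_state n k \<notin> occ_lattice I n"
proof -
  define d where "d = \<beta> / real N"
  have d: "d > 0" using \<beta> N by (simp add: d_def)
  define p where "p j = \<psi> (Suc k) j - \<psi> k j" for j
  \<comment> \<open>Levels below \<open>i0\<close> are not hit; 1 is a positive filler for their
    bound.\<close>
  define Q where "Q j = (if i0 \<le> j \<and> j \<le> I + 1 then q k j else 1)" for j
  have Q: "0 < Q j" for j using q[OF k, of j] by (simp add: Q_def)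
  have pnn: "0 \<le> p j" if "j \<le> I + 1" for j using \<psi>_mono[OF k(2) that] by (simp add: p_def)
  have psum: "(\<Sum>j\<le>I+1. p j) = d"
  proof -
    have "(\<Sum>j\<le>I+1. p j) = real (Suc k) * (\<beta> / real N) - real k * (\<beta> / real N)"
      unfolding p_def sum_subtractf using \<psi>sum[of "Suc k"] \<psi>sum[of k] k(2) by simp
    also have "\<dots> = d" by (simp add: d_def algebra_simps add_divide_distrib)
    finally show ?thesis .
  qed
  have pd: "p j \<le> d" if "j \<le> I + 1" for j
    using member_le_sum[of j "{..I+1}" p] that pnn psum by simp
  have blim: "(\<lambda>n. real (target_count n (Suc k) j) / real n - real (target_count n k j) / real n) \<longlonglongrightarrow> p j" if "j \<le> I + 1" for j
    unfolding p_def using k that by (intro tendsto_diff target_count_lim) auto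
  have ev_mono: "\<forall>\<^sub>F n in sequentially. \<forall>j\<in>{..I+1}. target_count n k j \<le> target_count n (Suc k) j"
    by (rule target_count_mono_eventually[OF k(2)])
  have blim': "(\<lambda>n. real (block_count n k j) / real n) \<longlonglongrightarrow> p j" if "j \<le> I + 1" for j
  proof (rule Lim_transform_eventually[OF blim[OF that]])
    show "\<forall>\<^sub>F n in sequentially. real (target_count n (Suc k) j) / real n - real (target_count n k j) / real n = real (block_count n k j) / real n"
      using ev_mono by eventually_elim (use that in \<open>auto simp: block_count_def of_nat_diff diff_divide_distrib\<close>)
  qed
  have p: "p j > 0 \<or> p j = 0 \<and> (\<forall>n. block_count n k j = 0)" if "j \<le> I + 1" for j
    using \<psi>inc[OF k(2) _ that] \<psi>i[of j] by (cases "i0 \<le> j") (auto simp: p_def block_count_def target_count_below)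
  have cost: "(\<Sum>j\<le>I+1. p j * ln (p j / (d * Q j))) = block_prob_cost k"
    unfolding block_prob_cost_def
  proof (rule sum.mono_neutral_cong_right)
    show "\<forall>j\<in>{..I+1} - {i0..I+1}. p j * ln (p j / (d * Q j)) = 0" using \<psi>i by (auto simp: p_def)
  qed (auto simp: p_def d_def Q_def)
  have "\<forall>\<^sub>F n in sequentially. - real n * ((\<Sum>j\<le>I+1. p j * ln (p j / (d * Q j))) + \<eta>)
     \<le> ln (fact (\<Sum>j\<le>I+1. block_count n k j) * (\<Prod>j\<le>I+1. Q j ^ block_count n k j / fact (block_count n k j))) \<and> (\<Sum>j\<le>I+1. block_count n k j) > 0"
    by (rule multinomial_asymp[OF blim' p psum d Q \<eta>])
  moreover have "\<forall>\<^sub>F n in sequentially. \<forall>j\<in>{i0..I+1}. q k j < target_state n k j - real (block_count n k j) / real n"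
  proof (rule eventually_ball_finite)
    show "\<forall>j\<in>{i0..I+1}. \<forall>\<^sub>F n in sequentially. q k j < target_state n k j - real (block_count n k j) / real n"
    proof
      fix j assume "j \<in> {i0..I+1}"
      then have j: "i0 \<le> j" "j \<le> I + 1" by auto
      have "(\<lambda>n. target_state n k j - real (block_count n k j) / real n) \<longlonglongrightarrow> target_limit k j - p j"
        using k j by (intro tendsto_diff target_state_lim blim') auto
      then show "\<forall>\<^sub>F n in sequentially. q k j < target_state n k j - real (block_count n k j) / real n"
        by (rule order_tendstoD(1)) (use q[OF k j] pd[OF j(2)] in \<open>simp add: target_limit_def d_def\<close>)
    qed
  qed simp
  ultimately show ?thesis using ev_mono eventually_gt_at_top[of 0]
  proof eventually_elim
    case (elim n)
    note e1 = elim(1)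
    show ?case
    proof (intro disjCI)
      assume "\<not> target_state n k \<notin> occ_lattice I n"
      then have l: "target_state n k \<in> occ_lattice I n" by simp
      have n: "n > 0" using elim by simp
      have feas: "occ_feasible I n Q (target_state n k) (block_count n k)"
        unfolding occ_feasible_def
      proof (intro allI impI)
        fix c j assume c: "\<forall>j\<le>I+1. c j \<le> block_count n k j" and j: "j \<le> I + 1" "c j < block_count n k j"
        then have ij: "i0 \<le> j" using p[OF j(1)] by (metis block_count_def diff_is_0_eq' le_refl less_nat_zero_code not_le target_count_below)
        have "q k j < target_state n k j - real (block_count n k j) / real n" using elim ij j(1) by auto
        also have "\<dots> \<le> occ_disp I n (target_state n k) c j"
        proof -
          have "- real (block_count n k j) \<le> (if j = 0 then 0 else real (c (j - 1))) - (if j \<le> I then real (c j) else 0)"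
            using j(2) by auto
          then have "- real (block_count n k j) / real n \<le> ((if j = 0 then 0 else real (c (j - 1))) - (if j \<le> I then real (c j) else 0)) / real n"
            by (rule divide_right_mono) simp
          then show ?thesis unfolding occ_disp_component[OF j(1)] by simp
        qed
        finally show "Q j \<le> occ_disp I n (target_state n k) c j" using ij j(1) by (simp add: Q_def)
      qed
      have le: "target_count n k j \<le> target_count n (Suc k) j" if "j \<le> I + 1" for j using elim that by auto
      have sumb: "(\<Sum>j\<le>I+1. block_count n k j) = step_grid \<beta> N n (Suc k) - step_grid \<beta> N n k"
        unfolding sum_target_count[of "Suc k" n, OF Suc_leI[OF k(2)], symmetric] sum_target_count[of k n, OF less_imp_le[OF k(2)], symmetric] block_count_def
        by (rule sum_subtractf_nat) (use le in auto)
      have disp: "occ_disp I n (target_state n k) (block_count n k) = target_state n (Suc k)"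
        unfolding target_state_def occ_disp_add
        by (auto simp: occ_disp_def fun_eq_iff block_count_def le simp del: sum.atMost_Suc intro!: sum.cong)
      let ?F = "fact (\<Sum>j\<le>I+1. block_count n k j) * (\<Prod>j\<le>I+1. Q j ^ block_count n k j / fact (block_count n k j))"
      have F: "0 < ?F" using Q by (intro mult_pos_pos prod_pos) auto
      have "exp (- real n * (block_prob_cost k + \<eta>)) \<le> exp (ln ?F)"
        using elim unfolding cost by (subst exp_le_cancel_iff) blast
      also have "\<dots> = ?F" using F by simp
      also have "\<dots> \<le> pmf (occ_walk I n (\<Sum>j\<le>I+1. block_count n k j) (target_state n k)) (occ_disp I n (target_state n k) (block_count n k))"
        by (rule occ_walk_multinomial[OF n l Q feas])
      finally show "exp (- real n * (block_prob_cost k + \<eta>))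
        \<le> pmf (occ_walk I n (step_grid \<beta> N n (Suc k) - step_grid \<beta> N n k) (target_state n k)) (target_state n (Suc k))"
        unfolding sumb disp .
    qed
  qed
qed

definition target_event :: "nat \<Rightarrow> nat \<Rightarrow> (nat \<Rightarrow> real) list set" where
  "target_event n k = {xs. length xs = Suc (step_grid \<beta> N n k) \<and> (\<forall>i\<in>{k0..k}. xs ! step_grid \<beta> N n i = target_state n i)}"

text \<open>The layer before \<open>k0\<close> is crossed in a single stretch with ordered throws,
  each of probability at least \<open>q0\<close>. Only the occupancy at the end of the layer has to
  be bounded below, which suits levels that start empty.\<close>

lemma initial_prob_eventually:
  "\<forall>\<^sub>F n in sequentially. exp (real n * (real k0 * (\<beta> / real N) * ln q0))
     \<le> measure_pmf.prob (occ_states I n (\<Gamma>0 n) (step_grid \<beta> N n k0)) (target_event n k0)"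
proof -
  have "\<forall>\<^sub>F n in sequentially. \<forall>j\<in>{i0..I+1}. q0 < target_state n k0 j"
  proof (rule eventually_ball_finite)
    show "\<forall>j\<in>{i0..I+1}. \<forall>\<^sub>F n in sequentially. q0 < target_state n k0 j"
    proof
      fix j assume "j \<in> {i0..I+1}"
      then have j: "i0 \<le> j" "j \<le> I + 1" by auto
      show "\<forall>\<^sub>F n in sequentially. q0 < target_state n k0 j"
        by (rule order_tendstoD(1)[OF target_state_lim[OF k0 j(2)]]) (use q0(3)[OF j] in \<open>simp add: target_limit_def\<close>)
    qed
  qed simp
  then show ?thesis using eventually_gt_at_top[of 0]
  proof eventually_elim
    case (elim n)
    define s where "s = step_grid \<beta> N n k0"
    have s: "(\<Sum>j\<le>I+1. target_count n k0 j) = s" using sum_target_count[OF k0] by (simp add: s_def)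
    note n = elim(2)
    have "exp (real n * (real k0 * (\<beta> / real N) * ln q0)) \<le> exp (real s * ln q0)"
    proof -
      have "real s \<le> real n * (real k0 * (\<beta> / real N))" unfolding s_def by (rule step_grid_bounds(1)[OF \<beta>])
      moreover have "ln q0 \<le> 0" using q0 by simp
      ultimately have "real n * (real k0 * (\<beta> / real N)) * ln q0 \<le> real s * ln q0" by (rule mult_right_mono_neg)
      then show ?thesis by (simp add: mult.assoc)
    qed
    also have "\<dots> = q0 ^ s" using q0(1) by (simp add: exp_of_nat_mult)
    also have "\<dots> \<le> pmf (occ_walk I n s (\<Gamma>0 n)) (target_state n k0)"
    proof -
      have "q0 \<le> occ_disp I n (\<Gamma>0 n) (target_count n k0) j" if "j \<le> I + 1" "target_count n k0 j > 0" for j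
      proof -
        have "i0 \<le> j" using that target_count_below[of j n k0] by (cases "i0 \<le> j") auto
        then show ?thesis using elim(1) that(1) by (auto simp: target_state_def less_imp_le)
      qed
      from occ_walk_ordered[OF n lat[OF n] q0(1) this] show ?thesis unfolding s target_state_def .
    qed
    also have "\<dots> = measure_pmf.prob (occ_states I n (\<Gamma>0 n) 0) {[\<Gamma>0 n]} * pmf (occ_walk I n s (\<Gamma>0 n)) (target_state n k0)"
      by simp
    also have "\<dots> \<le> measure_pmf.prob (occ_states I n (\<Gamma>0 n) (0 + s)) {xs. take (Suc 0) xs \<in> {[\<Gamma>0 n]} \<and> last xs = target_state n k0}"
      by (rule occ_states_extend[OF n lat[OF n]]) simp
    also have "\<dots> = measure_pmf.prob (occ_states I n (\<Gamma>0 n) s)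
      ({xs. take (Suc 0) xs \<in> {[\<Gamma>0 n]} \<and> last xs = target_state n k0} \<inter> set_pmf (occ_states I n (\<Gamma>0 n) s))"
      by (simp add: measure_Int_set_pmf)
    also have "\<dots> \<le> measure_pmf.prob (occ_states I n (\<Gamma>0 n) s) (target_event n k0)"
    proof (rule measure_pmf.finite_measure_mono)
      show "{xs. take (Suc 0) xs \<in> {[\<Gamma>0 n]} \<and> last xs = target_state n k0} \<inter> set_pmf (occ_states I n (\<Gamma>0 n) s) \<subseteq> target_event n k0"
      proof
        fix xs assume xs: "xs \<in> {xs. take (Suc 0) xs \<in> {[\<Gamma>0 n]} \<and> last xs = target_state n k0} \<inter> set_pmf (occ_states I n (\<Gamma>0 n) s)"
        then have t: "occ_traj I n (\<Gamma>0 n) s xs" using occ_states_traj[OF n lat[OF n]] by blast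
        then have "length xs = Suc s" by (simp add: occ_traj_def)
        moreover have "xs ! s = target_state n k0" using occ_traj_last[OF t] xs by simp
        ultimately show "xs \<in> target_event n k0" by (simp add: target_event_def s_def)
      qed
    qed simp
    finally show ?case by (simp add: s_def)
  qed
qed

text \<open>The costs of the blocks add up along the Markov chain; each block may lose another
  \<eta>.\<close>

lemma target_event_prob:
  assumes "k0 \<le> k" "k \<le> N" "\<eta> > 0"
  shows "\<forall>\<^sub>F n in sequentially. exp (- real n * ((\<Sum>i=k0..<k. block_prob_cost i + \<eta>) - real k0 * (\<beta> / real N) * ln q0))
     \<le> measure_pmf.prob (occ_states I n (\<Gamma>0 n) (step_grid \<beta> N n k)) (target_event n k)"
  using assms(1,2)
proof (induction k rule: dec_induct)
  case base
  then show ?case using initial_prob_eventually by simp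
next
  case (step k)
  have kN: "k < N" using step by simp
  from step.IH[OF less_imp_le[OF kN]] block_prob_eventually[OF step(1) kN assms(3)] eventually_gt_at_top[of 0]
  show ?case
  proof eventually_elim
    case (elim n)
    note n = elim(3)
    define s where "s = step_grid \<beta> N n k"
    define s' where "s' = step_grid \<beta> N n (Suc k)"
    have ss: "s \<le> s'" using step_grid_mono[OF \<beta>, of N n] by (simp add: s_def s'_def monoD)
    let ?P = "measure_pmf.prob (occ_states I n (\<Gamma>0 n) s) (target_event n k)"
    have Ppos: "0 < ?P" using elim(1) exp_gt_zero less_le_trans unfolding s_def by blast
    \<comment> \<open>An event of positive probability contains a trajectory of the chain. It passes
      through the target state, which is therefore a lattice point, and this rules out the
      alternative in \<open>block_prob_eventually\<close>.\<close>
    have "target_event n k \<inter> set_pmf (occ_states I n (\<Gamma>0 n) s) \<noteq> {}"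
    proof
      assume "target_event n k \<inter> set_pmf (occ_states I n (\<Gamma>0 n) s) = {}"
      then have "?P = 0" by (subst measure_Int_set_pmf[symmetric]) simp
      with Ppos show False by simp
    qed
    then obtain ys where ys: "ys \<in> target_event n k" "ys \<in> set_pmf (occ_states I n (\<Gamma>0 n) s)" by blast
    have "occ_traj I n (\<Gamma>0 n) s ys" by (rule occ_states_traj[OF n lat[OF n] ys(2)])
    then have "ys ! s \<in> occ_lattice I n" by (simp add: occ_traj_def)
    moreover have "ys ! s = target_state n k" using ys(1) step(1) by (simp add: target_event_def s_def)
    ultimately have w: "exp (- real n * (block_prob_cost k + \<eta>))
     \<le> pmf (occ_walk I n (s' - s) (target_state n k)) (target_state n (Suc k))"
      using elim(2) by (simp add: s_def s'_def)
    have "exp (- real n * ((\<Sum>i=k0..<Suc k. block_prob_cost i + \<eta>) - real k0 * (\<beta> / real N) * ln q0))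
      = exp (- real n * ((\<Sum>i=k0..<k. block_prob_cost i + \<eta>) - real k0 * (\<beta> / real N) * ln q0)) * exp (- real n * (block_prob_cost k + \<eta>))"
      using step(1) by (simp add: exp_add[symmetric] algebra_simps)
    also have "\<dots> \<le> ?P * pmf (occ_walk I n (s' - s) (target_state n k)) (target_state n (Suc k))"
      using elim(1) w unfolding s_def by (intro mult_mono) auto
    also have "\<dots> \<le> measure_pmf.prob (occ_states I n (\<Gamma>0 n) (s + (s' - s))) {xs. take (Suc s) xs \<in> target_event n k \<and> last xs = target_state n (Suc k)}"
    proof (rule occ_states_extend[OF n lat[OF n]])
      fix xs assume "xs \<in> target_event n k"
      then show "last xs = target_state n k" using step(1)
        by (subst last_conv_nth) (auto simp: target_event_def)
    qed
    also have "\<dots> = measure_pmf.prob (occ_states I n (\<Gamma>0 n) s')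
      ({xs. take (Suc s) xs \<in> target_event n k \<and> last xs = target_state n (Suc k)} \<inter> set_pmf (occ_states I n (\<Gamma>0 n) s'))"
      using ss by (simp add: measure_Int_set_pmf)
    also have "\<dots> \<le> measure_pmf.prob (occ_states I n (\<Gamma>0 n) s') (target_event n (Suc k))"
    proof (rule measure_pmf.finite_measure_mono)
      show "{xs. take (Suc s) xs \<in> target_event n k \<and> last xs = target_state n (Suc k)} \<inter> set_pmf (occ_states I n (\<Gamma>0 n) s') \<subseteq> target_event n (Suc k)"
      proof
        fix xs assume xs: "xs \<in> {xs. take (Suc s) xs \<in> target_event n k \<and> last xs = target_state n (Suc k)} \<inter> set_pmf (occ_states I n (\<Gamma>0 n) s')"
        then have t: "occ_traj I n (\<Gamma>0 n) s' xs" using occ_states_traj[OF n lat[OF n]] by blast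
        then have len: "length xs = Suc s'" by (simp add: occ_traj_def)
        have "xs ! step_grid \<beta> N n i = target_state n i" if i: "i \<in> {k0..Suc k}" for i
        proof (cases "i = Suc k")
          case True
          then show ?thesis using occ_traj_last[OF t] xs by (simp add: s'_def)
        next
          case False
          then have ik: "i \<in> {k0..k}" using i by auto
          then have "step_grid \<beta> N n i \<le> s" using step_grid_mono[OF \<beta>, of N n] by (simp add: s_def monoD)
          then have "xs ! step_grid \<beta> N n i = take (Suc s) xs ! step_grid \<beta> N n i" by simp
          also have "\<dots> = target_state n i" using xs ik by (simp add: target_event_def)
          finally show ?thesis .
        qed
        then show "xs \<in> target_event n (Suc k)" using len by (simp add: target_event_def s'_def)
      qed
    qed simp
    finally show ?case by (simp add: s'_def)
  qed
qed

end

section \<open>Local lower bound\<close>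

text \<open>With \<tau> = B/N these are the costs of the initial layer and of the linear path after
  it, both of order \<tau> log (1/\<tau>).\<close>

lemma cost_tendsto_0:
  fixes B K :: real
  assumes "B > 0" "K > 0"
  shows "(\<lambda>N. B / real N * ln (2 * real N ^ 2 * K) + B / real N * ln (real N * K)) \<longlonglongrightarrow> 0"
  using assms by real_asymp

text \<open>The total occupancy of the levels up to \<open>j\<close> never increases, so it remains
  zero once it is zero.\<close>

lemma adm_zero_below:
  assumes g: "g \<in> admissible_paths I \<beta> 0" "0 \<le> \<beta>" and i0: "i0 \<le> I + 1" and z: "\<And>j. j < i0 \<Longrightarrow> g 0 j = 0" and j: "j < i0"
  shows "g t j = 0"
proof -
  define s where "s = max 0 (min \<beta> t)"
  have s: "0 \<le> s" "s \<le> \<beta>" using g by (simp_all add: s_def)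
  have jI: "j \<le> I" using i0 j by simp
  have nn: "0 \<le> g s k" for k by (rule occ_simplexD(1)[OF admD(1)[OF g(1)]])
  have "0 \<le> occ_flow I g 0 s j" by (rule admD(4)[OF g(1)]) (use s jI in auto)
  moreover have "(\<Sum>k\<le>j. g 0 k) = 0" by (rule sum.neutral) (use z j in auto)
  ultimately have "(\<Sum>k\<le>j. g s k) \<le> 0" using jI by (simp add: occ_flow_def)
  moreover have "g s j \<le> (\<Sum>k\<le>j. g s k)" by (rule member_le_sum) (use nn in auto)
  ultimately have "g s j = 0" using nn[of j] by linarith
  then show ?thesis using adm_clamp[OF g, of t] by (simp add: s_def)
qed

text \<open>A path with constant rates that immediately populates every level at or above the lowest
  occupied one; mixing a given path with it moves the latter away from the boundary.\<close>

lemma linear_interior_path: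
  fixes \<alpha> :: "nat \<Rightarrow> real"
  assumes \<alpha>: "\<alpha> \<in> occ_simplex I" and i0: "i0 \<le> I + 1" "\<alpha> i0 > 0" and \<beta>: "\<beta> > 0"
  obtains c :: real and th :: "nat \<Rightarrow> real" where "0 < c" "c \<le> 1" "c * \<beta> \<le> 1"
    "\<And>j. j < i0 \<Longrightarrow> th j = 0" "\<And>j. i0 \<le> j \<Longrightarrow> j \<le> I + 1 \<Longrightarrow> c \<le> th j \<and> th j \<le> 1" "(\<Sum>j\<le>I+1. th j) = 1"
    "\<And>j t. i0 \<le> j \<Longrightarrow> j \<le> I + 1 \<Longrightarrow> 0 \<le> t \<Longrightarrow> t \<le> \<beta> \<Longrightarrow>
       c * t \<le> \<alpha> j + t * ((if j = 0 then 0 else th (j-1)) - (if j \<le> I then th j else 0))"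
proof -
  \<comment> \<open>The first bound keeps the rates below the top level at a sum of at most 1/2,
    leaving at least 1/2 for the top; the second keeps level \<open>i0\<close> from being used up
    before time \<beta>.\<close>
  define c where "c = min (1 / (2 * real (I+2) ^ 2)) (\<alpha> i0 / (2 * \<beta> * real (I+2)))"
  have c: "c > 0" using i0 \<beta> by (simp add: c_def)
  have c1: "c * real (I+2) ^ 2 \<le> 1/2"
  proof -
    have "c * real (I+2) ^ 2 \<le> 1 / (2 * real (I+2) ^ 2) * real (I+2) ^ 2" by (intro mult_right_mono) (simp_all add: c_def)
    also have "\<dots> = 1/2" by simp
    finally show ?thesis .
  qed
  have c2: "c * \<beta> * real (I+2) \<le> \<alpha> i0 / 2"
  proof -
    have "c * (\<beta> * real (I+2)) \<le> \<alpha> i0 / (2 * \<beta> * real (I+2)) * (\<beta> * real (I+2))" using \<beta> by (intro mult_right_mono) (simp_all add: c_def)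
    also have "\<dots> = \<alpha> i0 / 2"
    proof -
      have "x / (2 * \<beta> * r) * (\<beta> * r) = x / 2" if "r > 0" for x r :: real using \<beta> that by simp
      then show ?thesis by simp
    qed
    finally show ?thesis by (simp add: mult.assoc)
  qed
  have sq: "real (I+2) \<le> real (I+2) ^ 2" by (simp add: power2_eq_square)
  have cI: "c * real (I+2) \<le> 1/2" using c1 mult_left_mono[OF sq, of c] c by linarith
  have c_half: "c \<le> 1/2"
  proof -
    have "c * 1 \<le> c * real (I+2)" using c by (intro mult_left_mono) auto
    then show ?thesis using cI by linarith
  qed
  \<comment> \<open>The rates fall by \<open>c\<close> from one level to the next, so every level
    above \<open>i0\<close> gains \<open>c\<close> per unit of time, the top level included.\<close>
  define th where "th j = (if j < i0 then 0 else if j \<le> I then c * real (I + 1 - j)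
      else if j = I + 1 then 1 - (\<Sum>i\<in>{i0..I}. c * real (I + 1 - i)) else 0)" for j
  have s2: "(\<Sum>i\<in>{i0..I}. c * real (I + 1 - i)) \<le> 1/2"
  proof -
    have "(\<Sum>i\<in>{i0..I}. c * real (I + 1 - i)) \<le> (\<Sum>i\<in>{i0..I}. c * real (I+2))" using c by (intro sum_mono mult_left_mono) auto
    also have "\<dots> = real (card {i0..I}) * (c * real (I+2))" by simp
    also have "\<dots> \<le> real (I+2) * (c * real (I+2))" using c by (intro mult_right_mono) auto
    also have "\<dots> \<le> 1/2" using c1 by (simp add: power2_eq_square algebra_simps)
    finally show ?thesis .
  qed
  have s0: "0 \<le> (\<Sum>i\<in>{i0..I}. c * real (I + 1 - i))" using c by (intro sum_nonneg) auto
  have thI: "th j = c * real (I + 1 - j)" if "i0 \<le> j" "j \<le> I" for j using that by (simp add: th_def)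
  have th_low: "th j = 0" if "j < i0" for j using that by (simp add: th_def)
  have th_last: "th (I+1) = 1 - (\<Sum>i\<in>{i0..I}. c * real (I + 1 - i))" using i0 by (simp add: th_def)
  have cIj: "c * real (I + 1 - j) \<le> c * real (I+2)" "c \<le> c * real (I + 1 - j)" if "j \<le> I" for j
  proof -
    show "c * real (I + 1 - j) \<le> c * real (I+2)" using c by (intro mult_left_mono) auto
    have "c * 1 \<le> c * real (I + 1 - j)" using c that by (intro mult_left_mono) auto
    then show "c \<le> c * real (I + 1 - j)" by simp
  qed
  have bounds: "c \<le> th j \<and> th j \<le> 1" if "i0 \<le> j" "j \<le> I + 1" for j
  proof (cases "j \<le> I")
    case True
    then show ?thesis using thI[OF that(1) True] cIj[OF True] cI by linarith
  next
    case False
    then have jI: "j = I + 1" using that by simp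
    show ?thesis unfolding jI using th_last s2 s0 c_half by linarith
  qed
  have sum1: "(\<Sum>j\<le>I+1. th j) = 1"
  proof -
    have "(\<Sum>j\<le>I. th j) = (\<Sum>i\<in>{i0..I}. c * real (I + 1 - i))"
      by (rule sum.mono_neutral_cong_right) (auto simp: th_def)
    then show ?thesis using th_last by simp
  qed
  have lower: "c * t \<le> \<alpha> j + t * ((if j = 0 then 0 else th (j-1)) - (if j \<le> I then th j else 0))"
    if j: "i0 \<le> j" "j \<le> I + 1" and t: "0 \<le> t" "t \<le> \<beta>" for j t
  proof (cases "j = i0")
    case True
    have prev: "(if j = 0 then 0 else th (j-1)) = 0" using True by (simp add: th_low)
    have le1: "(if j \<le> I then th j else 0) \<le> c * real (I+1)"
    proof (cases "j \<le> I")
      case jI: True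
      have "c * real (I + 1 - j) \<le> c * real (I+1)" using c by (intro mult_left_mono) auto
      then show ?thesis using thI[OF j(1) jI] jI by simp
    next
      case False
      then show ?thesis using c by simp
    qed
    have "c * t + t * (if j \<le> I then th j else 0) \<le> c * t + t * (c * real (I+1))" using le1 t by (intro add_left_mono mult_left_mono)
    also have "\<dots> = t * (c * real (I+2))" by (simp add: algebra_simps)
    also have "\<dots> \<le> \<beta> * (c * real (I+2))" using t c by (intro mult_right_mono) auto
    also have "\<dots> \<le> \<alpha> j" using c2 True i0 by (simp add: algebra_simps)
    finally show ?thesis using prev by (simp add: right_diff_distrib)
  next
    case False
    then have j0: "j > 0" "i0 \<le> j - 1" "j - 1 \<le> I" using j by auto
    have inc: "th (j-1) - (if j \<le> I then th j else 0) = c"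
    proof (cases "j \<le> I")
      case True
      have "I + 1 - (j - 1) = Suc (I + 1 - j)" using j0(1) True by linarith
      then have "th (j-1) = c * real (I + 1 - j) + c" unfolding thI[OF j0(2,3)] by (simp only: of_nat_Suc distrib_left mult_1_right)
      then show ?thesis unfolding if_P[OF True] thI[OF j(1) True] by linarith
    next
      case F: False
      then have "j = I + 1" using j by simp
      then show ?thesis using thI[OF j0(2,3)] by simp
    qed
    have "(if j = 0 then 0 else th (j-1)) = th (j-1)" using j0(1) by simp
    then show ?thesis unfolding inc[symmetric] using occ_simplexD(1)[OF \<alpha>, of j] by (simp only: mult.commute[of t])
  qed
  have "c * \<beta> * 1 \<le> c * \<beta> * real (I+2)" using c \<beta> by (intro mult_left_mono) auto
  then have "c * \<beta> \<le> 1" using c2 occ_simplexD(4)[OF \<alpha>, of i0] by linarith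
  show ?thesis
  proof (rule that[of c th])
    show "c \<le> 1" using c_half by simp
  qed (fact c \<open>c * \<beta> \<le> 1\<close> th_low bounds sum1 lower)+
qed

text \<open>The left side is maximal in \<open>s\<close> at \<open>x / y\<close>, with value
  \<open>x * ln (x / y)\<close>. This bounds the cost of the linear path for multipliers chosen with
  another path in mind.\<close>

lemma entropy_term_le:
  fixes x y s l :: real
  assumes "0 < x" "x \<le> 1" "l \<le> y" "0 < l" "0 < s"
  shows "x * ln s + x - s * y \<le> x * ln (1 / l)"
proof -
  have y: "y > 0" using assms by linarith
  have "x * (ln s + 1 - s / (x / y)) \<le> x * ln (x / y)" using assms y by (intro mult_left_mono ln_ge_tangent) auto
  moreover have "x * (s / (x / y)) = s * y" using assms by simp
  moreover have "x * ln (x / y) \<le> x * ln (1 / l)"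
  proof (intro mult_left_mono)
    have "x / y \<le> 1 / l" using assms y by (intro frac_le) auto
    then show "ln (x / y) \<le> ln (1 / l)" using assms y by (subst ln_le_cancel_iff) auto
  qed (use assms in auto)
  ultimately show ?thesis by (simp add: algebra_simps)
qed

text \<open>The target is the mixture \<open>G\<close> of \<open>g\<close> and the linear path
  \<open>gb\<close>. The multipliers \<open>s\<close> are optimal for \<open>G\<close> up to mesh
  errors; testing \<open>g\<close> and \<open>gb\<close> with the same multipliers bounds the cost
  of \<open>G\<close> by \<open>J\<close> plus the cost of \<open>gb\<close> with weight \<kappa>,
  without using convexity of the entropy.\<close>

lemma occ_prob_local_lower:
  assumes b: "\<beta> > 0" and lat: "\<And>n. n > 0 \<Longrightarrow> \<Gamma>0 n \<in> occ_lattice I n"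
    and lim: "\<And>j. (\<lambda>n. \<Gamma>0 n j) \<longlonglongrightarrow> g 0 j"
    and g: "g \<in> admissible_paths I \<beta> 0" and M: "occ_J I \<beta> g < ereal M" and e: "e > 0"
  shows "\<forall>\<^sub>F n in sequentially. exp (- real n * M) \<le> occ_prob I \<beta> n (\<Gamma>0 n) {h. sup_close I \<beta> e g h}"
proof -
  have b0: "0 \<le> \<beta>" using b by simp
  define \<alpha> where "\<alpha> = g 0"
  have \<alpha>: "\<alpha> \<in> occ_simplex I" unfolding \<alpha>_def by (rule admD(1)[OF g])
  have "0 \<le> occ_J I \<beta> g" by (simp add: occ_J_def)
  with M obtain J where J: "occ_J I \<beta> g = ereal J" "0 \<le> J" "J < M" by (cases "occ_J I \<beta> g") auto
  define \<Delta> where "\<Delta> = M - J"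
  have \<Delta>: "\<Delta> > 0" using J by (simp add: \<Delta>_def)
  \<comment> \<open>The lowest occupied level of the limiting initial state. The levels below it may
    be occupied in \<open>\<Gamma>0 n\<close> by a vanishing share of cells, at which the target
    throws no balls.\<close>
  define i0 where "i0 = (LEAST i. \<alpha> i > 0)"
  have ex: "\<exists>i\<le>I+1. \<alpha> i > 0"
  proof (rule ccontr)
    assume "\<not> ?thesis"
    then have "(\<Sum>j\<le>I+1. \<alpha> j) \<le> 0" by (intro sum_nonpos) (auto simp: not_less)
    then show False using occ_simplexD(3)[OF \<alpha>] by simp
  qed
  then obtain i where i: "i \<le> I + 1" "\<alpha> i > 0" by blast
  have i0: "\<alpha> i0 > 0" "i0 \<le> I + 1"
    unfolding i0_def using LeastI[of "\<lambda>i. \<alpha> i > 0", OF i(2)] Least_le[of "\<lambda>i. \<alpha> i > 0", OF i(2)] i(1) by auto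
  have low: "g t j = 0" if "j < i0" for t j
  proof (rule adm_zero_below[OF g b0 i0(2) _ that])
    fix j assume "j < i0"
    then have "\<not> \<alpha> j > 0" unfolding i0_def by (rule not_less_Least)
    then show "g 0 j = 0" using occ_simplexD(1)[OF \<alpha>, of j] by (simp add: \<alpha>_def)
  qed
  obtain c th where c: "0 < c" "c \<le> 1" "c * \<beta> \<le> 1" and th_low: "\<And>j. j < i0 \<Longrightarrow> th j = 0"
    and th: "\<And>j. i0 \<le> j \<Longrightarrow> j \<le> I + 1 \<Longrightarrow> c \<le> th j \<and> th j \<le> 1" and th_sum: "(\<Sum>j\<le>I+1. th j) = 1"
    and lin: "\<And>j t. i0 \<le> j \<Longrightarrow> j \<le> I + 1 \<Longrightarrow> 0 \<le> t \<Longrightarrow> t \<le> \<beta> \<Longrightarrow>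
       c * t \<le> \<alpha> j + t * ((if j = 0 then 0 else th (j-1)) - (if j \<le> I then th j else 0))"
    using linear_interior_path[OF \<alpha> i0(2,1) b] by blast
  define gb where "gb t j = \<alpha> j + t * ((if j = 0 then 0 else th (j-1)) - (if j \<le> I then th j else 0))" for t j
  have th_nn: "0 \<le> th j" "th j \<le> 1" if "j \<le> I + 1" for j using th[OF _ that] th_low[of j] c by (cases "i0 \<le> j"; force)+
  have gb_close: "\<bar>gb t j - g t j\<bar> \<le> 2 * t" if t: "0 \<le> t" "t \<le> \<beta>" and j: "j \<le> I + 1" for t j
  proof -
    have "\<bar>(if j = 0 then 0 else th (j-1)) - (if j \<le> I then th j else 0)\<bar> \<le> 1"
    proof -
      have "j - 1 \<le> I + 1" using j by simp
      then show ?thesis using th_nn[OF j] th_nn[of "j-1"] by auto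
    qed
    then have "\<bar>t * ((if j = 0 then 0 else th (j-1)) - (if j \<le> I then th j else 0))\<bar> \<le> t * 1"
      unfolding abs_mult abs_of_nonneg[OF t(1)] by (rule mult_left_mono[OF _ t(1)])
    then have "\<bar>gb t j - \<alpha> j\<bar> \<le> t" by (simp add: gb_def)
    moreover have "\<bar>g t j - \<alpha> j\<bar> \<le> \<bar>t - 0\<bar>" unfolding \<alpha>_def by (rule adm_0_Lipschitz[OF g b0])
    ultimately show ?thesis using t by linarith
  qed
  \<comment> \<open>Normalised so that \<open>1 / (c * \<tau>)\<close> equals \<open>N0 * K\<close>
    below.\<close>
  define K where "K = 1 / (c * \<beta>)"
  have K: "K > 0" using c b by (simp add: K_def)
  have "\<forall>\<^sub>F N0 in sequentially. \<beta> / real N0 * ln (2 * real N0 ^ 2 * K) + \<beta> / real N0 * ln (real N0 * K) < \<Delta> / 4"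
    by (rule order_tendstoD(2)[OF cost_tendsto_0[OF b K]]) (use \<Delta> in simp)
  moreover have "(\<lambda>N0. 2 * (\<beta> / real N0)) \<longlonglongrightarrow> 0" by real_asymp
  then have "\<forall>\<^sub>F N0 in sequentially. 2 * (\<beta> / real N0) < e / 4" by (rule order_tendstoD(2)) (use e in simp)
  ultimately have "\<forall>\<^sub>F N0 in sequentially. \<beta> / real N0 * ln (2 * real N0 ^ 2 * K) + \<beta> / real N0 * ln (real N0 * K) < \<Delta> / 4
     \<and> 2 * (\<beta> / real N0) < e / 4 \<and> N0 \<ge> 2"
    using eventually_ge_at_top[of 2] by eventually_elim auto
  then obtain N0 where N0: "\<beta> / real N0 * ln (2 * real N0 ^ 2 * K) + \<beta> / real N0 * ln (real N0 * K) < \<Delta> / 4"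
    "2 * (\<beta> / real N0) < e / 4" "N0 \<ge> 2"
    using eventually_happens'[OF sequentially_bot] by blast
  \<comment> \<open>The one parameter \<open>N0\<close> fixes both the length \<tau> of the layer
    and the weight \<kappa> of the mixture. Since \<kappa> times \<beta> is \<tau>, the linear path
    costs as little over the whole interval as it would over the layer.\<close>
  define \<tau> where "\<tau> = \<beta> / real N0"
  define \<kappa> where "\<kappa> = 1 / real N0"
  have \<tau>: "0 < \<tau>" "\<tau> \<le> \<beta>" "2 * \<tau> < e / 4" using N0 b by (auto simp: \<tau>_def field_simps)
  have \<kappa>: "0 < \<kappa>" "\<kappa> < 1" "\<kappa> * \<beta> = \<tau>" using N0 by (auto simp: \<tau>_def \<kappa>_def field_simps)
  \<comment> \<open>A lower bound for the mixture after time \<tau> at all levels from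
    \<open>i0\<close> on, obtained from the linear part alone.\<close>
  define c' where "c' = \<kappa> * (c * \<tau>)"
  have c': "c' > 0" using \<kappa> c \<tau> by (simp add: c'_def)
  have c'1: "c' \<le> 1"
  proof -
    have "c * \<tau> \<le> c * \<beta>" using c \<tau> by simp
    then have "c * \<tau> \<le> 1" using c by linarith
    then have "\<kappa> * (c * \<tau>) \<le> 1 * 1" using \<kappa> c \<tau> by (intro mult_mono) auto
    then show ?thesis by (simp add: c'_def)
  qed
  have dlim: "(\<lambda>R. \<beta> / real (N0 * R)) \<longlonglongrightarrow> 0"
  proof -
    have "(\<lambda>R. (\<beta> / real N0) / real R) \<longlonglongrightarrow> 0" by real_asymp
    then show ?thesis by simp
  qed
  have "(\<lambda>R. \<beta> * (6 * (\<beta> / real (N0 * R)) / c' + real (I+2) * (\<beta> / real (N0 * R)))) \<longlonglongrightarrow> \<beta> * (6 * 0 / c' + real (I+2) * 0)"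
    using c' by (intro tendsto_intros dlim) auto
  then have "\<forall>\<^sub>F R in sequentially. \<beta> * (6 * (\<beta> / real (N0 * R)) / c' + real (I+2) * (\<beta> / real (N0 * R))) < \<Delta> / 4"
    by (rule order_tendstoD(2)) (use \<Delta> in simp)
  moreover have "\<forall>\<^sub>F R in sequentially. \<beta> / real (N0 * R) < c' / 4"
    by (rule order_tendstoD(2)[OF dlim]) (use c' in simp)
  ultimately have "\<forall>\<^sub>F R in sequentially. \<beta> * (6 * (\<beta> / real (N0 * R)) / c' + real (I+2) * (\<beta> / real (N0 * R))) < \<Delta> / 4
     \<and> \<beta> / real (N0 * R) < c' / 4 \<and> R \<ge> 1"
    using eventually_ge_at_top[of 1] by eventually_elim auto
  then obtain R where R: "\<beta> * (6 * (\<beta> / real (N0 * R)) / c' + real (I+2) * (\<beta> / real (N0 * R))) < \<Delta> / 4"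
     "\<beta> / real (N0 * R) < c' / 4" "R \<ge> 1"
    using eventually_happens'[OF sequentially_bot] by blast
  \<comment> \<open>Each of the \<open>N0\<close> long cells is divided into \<open>R\<close>
    blocks, so that \<tau> is the grid time with index \<open>R\<close>. The mesh is chosen after
    \<open>c'\<close> because the discretisation error contains \<open>d / c'\<close>.\<close>
  define N where "N = N0 * R"
  define d where "d = \<beta> / real N"
  have Npos: "N > 0" using N0 R by (simp add: N_def)
  have d: "d > 0" "d < c' / 4" "\<beta> * (6 * d / c' + real (I+2) * d) < \<Delta> / 4" using R b Npos by (simp_all add: d_def N_def)
  have RN: "R \<le> N" using N0 by (simp add: N_def)
  have Rd: "real R * d = \<tau>" using R N0 by (simp add: d_def N_def \<tau>_def)
  have Nd: "real N * d = \<beta>" using Npos by (simp add: d_def)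
  have d\<tau>: "d \<le> \<tau>"
  proof -
    have "1 * d \<le> real R * d" using R(3) d(1) by (intro mult_right_mono) auto
    then show ?thesis using Rd by simp
  qed
  define t where "t k = real k * d" for k
  have tk: "0 \<le> t k" for k using d by (simp add: t_def)
  have tN: "t k \<le> \<beta>" if "k \<le> N" for k
  proof -
    have "real k * d \<le> real N * d" using that d by (intro mult_right_mono) auto
    then show ?thesis by (simp add: t_def Nd)
  qed
  have t\<tau>: "\<tau> \<le> t k" if "R \<le> k" for k
  proof -
    have "real R * d \<le> real k * d" using that d by (intro mult_right_mono) auto
    then show ?thesis by (simp add: t_def Rd)
  qed
  have dt: "t (Suc k) - t k = d" for k by (simp add: t_def algebra_simps)
  \<comment> \<open>The cumulative flow of the mixed path. The term with \<open>th\<close> makes it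
    strictly increasing at every level from \<open>i0\<close> on.\<close>
  define \<psi> where "\<psi> k j = (1 - \<kappa>) * occ_flow I g 0 (t k) j + \<kappa> * (t k * th j)" for k j
  define G where "G k j = (1 - \<kappa>) * g (t k) j + \<kappa> * gb (t k) j" for k j
  have G_eq: "g 0 j + (if j = 0 then 0 else \<psi> k (j-1)) - (if j \<le> I then \<psi> k j else 0) = G k j" if "j \<le> I + 1" for k j
  proof -
    have "g (t k) j - g 0 j = (if j = 0 then 0 else occ_flow I g 0 (t k) (j-1)) - (if j \<le> I then occ_flow I g 0 (t k) j else 0)"
      by (rule simplex_diff_flow[OF admD(1)[OF g] admD(1)[OF g] that])
    then have gt: "g (t k) j = g 0 j + ((if j = 0 then 0 else occ_flow I g 0 (t k) (j-1)) - (if j \<le> I then occ_flow I g 0 (t k) j else 0))" by simp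
    show ?thesis unfolding G_def gt gb_def \<psi>_def \<alpha>_def by (cases "j = 0"; cases "j \<le> I") (simp_all add: algebra_simps)
  qed
  have G_ge: "c' \<le> G k j" if k: "R \<le> k" "k \<le> N" and j: "i0 \<le> j" "j \<le> I + 1" for k j
  proof -
    have "c * \<tau> \<le> c * t k" using t\<tau>[OF k(1)] c by simp
    also have "\<dots> \<le> gb (t k) j" unfolding gb_def by (rule lin[OF j tk tN[OF k(2)]])
    finally have "\<kappa> * (c * \<tau>) \<le> \<kappa> * gb (t k) j" using \<kappa> by simp
    moreover have "0 \<le> (1 - \<kappa>) * g (t k) j" using \<kappa> occ_simplexD(1)[OF admD(1)[OF g]] by simp
    ultimately show ?thesis by (simp add: G_def c'_def)
  qed
  \<comment> \<open>One \<open>d\<close> covers the loss within a block, the other gives the strict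
    inequality of the locale; as \<open>d < c'/4\<close>, at least \<open>c'/2\<close>
    remains.\<close>
  define q where "q k j = G k j - 2 * d" for k j
  define q0 where "q0 = c' / 2"
  have flow_low: "occ_flow I g s u j = 0" if "j < i0" for s u j
    using that i0(2) low by (simp add: occ_flow_def)
  have flow_nn: "0 \<le> occ_flow I g (t k) (t (Suc k)) j" if "k < N" "j \<le> I + 1" for k j
    using adm_flow_le(2)[OF g tk _ tN that(2), of k "Suc k"] that(1) dt[of k] d(1) by auto
  have \<psi>diff: "\<psi> (Suc k) j - \<psi> k j = (1 - \<kappa>) * occ_flow I g (t k) (t (Suc k)) j + \<kappa> * (d * th j)" for k j
  proof -
    have "occ_flow I g 0 (t (Suc k)) j = occ_flow I g 0 (t k) j + occ_flow I g (t k) (t (Suc k)) j" by (simp add: occ_flow_add)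
    moreover have "t (Suc k) = t k + d" using dt[of k] by simp
    ultimately show ?thesis unfolding \<psi>_def by (simp add: algebra_simps)
  qed
  note i0_le = i0(2)
  interpret occ_grid I \<beta> N \<Gamma>0 "g 0" i0 R \<psi> q q0
  proof
    show "\<psi> 0 j = 0" for j by (simp add: \<psi>_def t_def)
    show "\<psi> k j = 0" if "j < i0" for k j using that by (simp add: \<psi>_def flow_low th_low)
    show "(\<Sum>j\<le>I+1. \<psi> k j) = real k * (\<beta> / real N)" if "k \<le> N" for k
    proof -
      have "(\<Sum>j\<le>I+1. \<psi> k j) = (1 - \<kappa>) * (\<Sum>j\<le>I+1. occ_flow I g 0 (t k) j) + \<kappa> * (t k * (\<Sum>j\<le>I+1. th j))"
        unfolding \<psi>_def sum.distrib sum_distrib_left ..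
      also have "\<dots> = t k" unfolding sum_occ_flow th_sum by (simp add: algebra_simps)
      finally show ?thesis by (simp add: t_def d_def)
    qed
    show "\<psi> k j < \<psi> (Suc k) j" if "k < N" "i0 \<le> j" "j \<le> I + 1" for k j
    proof -
      have "0 < \<kappa> * (d * th j)" using \<kappa> d th[OF that(2,3)] c by simp
      moreover have "0 \<le> (1 - \<kappa>) * occ_flow I g (t k) (t (Suc k)) j" using \<kappa> flow_nn[OF that(1,3)] by simp
      ultimately show ?thesis using \<psi>diff[of k j] by linarith
    qed
    show "0 < q k j \<and> q k j < g 0 j + (if j = 0 then 0 else \<psi> k (j - 1)) - (if j \<le> I then \<psi> k j else 0) - \<beta> / real N"
      if "R \<le> k" "k < N" "i0 \<le> j" "j \<le> I + 1" for k j
      using G_ge[of k j] that d unfolding G_eq[OF that(4)] d_def[symmetric] by (simp add: q_def)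
    show "q0 < g 0 j + (if j = 0 then 0 else \<psi> R (j - 1)) - (if j \<le> I then \<psi> R j else 0)" if "i0 \<le> j" "j \<le> I + 1" for j
      using G_ge[OF order_refl RN that] c' unfolding G_eq[OF that(2)] by (simp add: q0_def)
  qed (use b Npos lat lim i0 RN c' c'1 in \<open>auto simp: q0_def\<close>)
  have TL: "target_limit k j = G k j" if "j \<le> I + 1" for k j unfolding target_limit_def by (rule G_eq[OF that])
  define a where "a k j = (\<psi> (Suc k) j - \<psi> k j) / d" for k j
  \<comment> \<open>The optimal multiplier for rate \<open>a\<close> and occupancy \<open>q\<close>.
    The filler 1 keeps \<open>s\<close> positive, as Gibbs' inequality requires.\<close>
  define s where "s k j = (if k < N \<and> R \<le> k \<and> i0 \<le> j \<and> j \<le> I + 1 then a k j / q k j else 1)" for k j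
  have a_pos: "0 < a k j" if "k < N" "i0 \<le> j" "j \<le> I + 1" for k j using \<psi>inc[OF that] d by (simp add: a_def)
  have q_ge: "c' / 2 \<le> q k j" if "R \<le> k" "k < N" "i0 \<le> j" "j \<le> I + 1" for k j
    using G_ge[of k j] that d by (simp add: q_def)
  have s_pos: "0 < s k j" for k j
    using a_pos[of k j] q_ge[of k j] c' by (auto simp: s_def intro!: divide_pos_pos)
  have a_sum: "(\<Sum>j\<in>{i0..I+1}. a k j) = 1" if k: "k < N" for k
  proof -
    have "(\<Sum>j\<in>{i0..I+1}. a k j) = (\<Sum>j\<le>I+1. a k j)"
      by (rule sum.mono_neutral_left) (auto simp: a_def \<psi>i)
    also have "\<dots> = (real (Suc k) * (\<beta> / real N) - real k * (\<beta> / real N)) / d"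
      unfolding a_def sum_divide_distrib[symmetric] sum_subtractf using \<psi>sum[of k] \<psi>sum[of "Suc k"] k by simp
    also have "real (Suc k) * (\<beta> / real N) - real k * (\<beta> / real N) = d" using dt[of k] by (simp add: t_def d_def)
    finally show ?thesis using d by simp
  qed
  \<comment> \<open>The mesh errors have two sources: \<open>G + d\<close> exceeds \<open>q\<close>
    by \<open>3 * d\<close>, which relative to \<open>q >= c'/2\<close> gives
    \<open>6 * d / c'\<close>, and each level below \<open>i0\<close> with multiplier 1 contributes
    \<open>d * d\<close>. The remaining error is the entropy of the linear path.\<close>
  have block: "block_prob_cost k - d * (6 * d / c' + real (I+2) * d) - \<kappa> * (d * ln (1 / (c * \<tau>)))
    \<le> (1 - \<kappa>) * (\<Sum>j\<le>I+1. occ_flow I g (t k) (t (Suc k)) j * (ln (s k j) + 1) - d * (s k j * (g (t k) j + d)))"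
    if k: "R \<le> k" "k < N" for k
  proof -
    have lin_bound: "(\<Sum>j\<le>I+1. th j * ln (s k j) + th j - s k j * gb (t k) j) \<le> ln (1 / (c * \<tau>))"
    proof -
      have "(\<Sum>j\<le>I+1. th j * ln (s k j) + th j - s k j * gb (t k) j) \<le> (\<Sum>j\<le>I+1. th j * ln (1 / (c * \<tau>)))"
      proof (rule sum_mono)
        fix j assume "j \<in> {..I+1}"
        then have j: "j \<le> I + 1" by simp
        show "th j * ln (s k j) + th j - s k j * gb (t k) j \<le> th j * ln (1 / (c * \<tau>))"
        proof (cases "i0 \<le> j")
          case True
          have "c * \<tau> \<le> c * t k" using t\<tau>[OF k(1)] c by simp
          also have "\<dots> \<le> gb (t k) j" unfolding gb_def by (rule lin[OF True j tk tN]) (use k in simp)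
          finally have gbl: "c * \<tau> \<le> gb (t k) j" .
          have "0 < th j" "th j \<le> 1" using th[OF True j] c by auto
          then show ?thesis using gbl c(1) \<tau>(1) s_pos by (intro entropy_term_le) auto
        next
          case False
          then have "j < i0" by simp
          moreover have "0 \<le> gb (t k) j" using \<open>j < i0\<close> i0_le th_low[of j] th_low[of "j-1"] occ_simplexD(1)[OF \<alpha>, of j] by (simp add: gb_def)
          ultimately show ?thesis using th_low[of j] s_pos[of k j] by simp
        qed
      qed
      also have "\<dots> = ln (1 / (c * \<tau>))" unfolding sum_distrib_right[symmetric] th_sum by simp
      finally show ?thesis .
    qed
    have "(\<Sum>j\<le>I+1. d * (a k j * (ln (s k j) + 1) - s k j * (G k j + d)))
      \<le> (\<Sum>j\<le>I+1. (1 - \<kappa>) * (occ_flow I g (t k) (t (Suc k)) j * (ln (s k j) + 1) - d * (s k j * (g (t k) j + d)))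
          + \<kappa> * (d * (th j * ln (s k j) + th j - s k j * gb (t k) j)))"
    proof (rule sum_mono)
      fix j assume "j \<in> {..I+1}"
      have da: "d * a k j = (1 - \<kappa>) * occ_flow I g (t k) (t (Suc k)) j + \<kappa> * (d * th j)" using d \<psi>diff[of k j] by (simp add: a_def)
      have "d * (a k j * (ln (s k j) + 1) - s k j * (G k j + d)) = d * a k j * (ln (s k j) + 1) - d * s k j * (G k j + d)" by (simp add: algebra_simps)
      also have "\<dots> = (1 - \<kappa>) * (occ_flow I g (t k) (t (Suc k)) j * (ln (s k j) + 1) - d * (s k j * (g (t k) j + d)))
          + \<kappa> * (d * (th j * ln (s k j) + th j - s k j * gb (t k) j)) - \<kappa> * (d * s k j * d)"
        unfolding da G_def by (simp add: algebra_simps)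
      also have "\<dots> \<le> (1 - \<kappa>) * (occ_flow I g (t k) (t (Suc k)) j * (ln (s k j) + 1) - d * (s k j * (g (t k) j + d)))
          + \<kappa> * (d * (th j * ln (s k j) + th j - s k j * gb (t k) j))"
        using \<kappa> d s_pos[of k j] by simp
      finally show "d * (a k j * (ln (s k j) + 1) - s k j * (G k j + d)) \<le> (1 - \<kappa>) * (occ_flow I g (t k) (t (Suc k)) j * (ln (s k j) + 1) - d * (s k j * (g (t k) j + d)))
          + \<kappa> * (d * (th j * ln (s k j) + th j - s k j * gb (t k) j))" .
    qed
    also have "\<dots> = (1 - \<kappa>) * (\<Sum>j\<le>I+1. occ_flow I g (t k) (t (Suc k)) j * (ln (s k j) + 1) - d * (s k j * (g (t k) j + d)))
       + \<kappa> * (d * (\<Sum>j\<le>I+1. th j * ln (s k j) + th j - s k j * gb (t k) j))"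
      unfolding sum.distrib sum_distrib_left[symmetric] ..
    also have "\<dots> \<le> (1 - \<kappa>) * (\<Sum>j\<le>I+1. occ_flow I g (t k) (t (Suc k)) j * (ln (s k j) + 1) - d * (s k j * (g (t k) j + d)))
       + \<kappa> * (d * ln (1 / (c * \<tau>)))"
      using lin_bound \<kappa> d by (intro add_left_mono mult_left_mono) auto
    finally have 1: "(\<Sum>j\<le>I+1. d * (a k j * (ln (s k j) + 1) - s k j * (G k j + d))) - \<kappa> * (d * ln (1 / (c * \<tau>)))
      \<le> (1 - \<kappa>) * (\<Sum>j\<le>I+1. occ_flow I g (t k) (t (Suc k)) j * (ln (s k j) + 1) - d * (s k j * (g (t k) j + d)))" by simp
    have "block_prob_cost k - d * (6 * d / c' + real (I+2) * d)
      \<le> (\<Sum>j\<in>{i0..I+1}. d * (a k j * ln (a k j / q k j)) - d * (6 * d / c' * a k j)) - (\<Sum>j\<in>{..<i0}. d * d)"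
    proof -
      have "block_prob_cost k = (\<Sum>j\<in>{i0..I+1}. d * (a k j * ln (a k j / q k j)))"
        unfolding block_prob_cost_def d_def[symmetric] by (rule sum.cong) (use d in \<open>auto simp: a_def\<close>)
      moreover have "(\<Sum>j\<in>{i0..I+1}. d * (6 * d / c' * a k j)) = d * (6 * d / c')"
        unfolding sum_distrib_left[symmetric] a_sum[OF k(2)] by simp
      moreover have "(\<Sum>j\<in>{..<i0}. d * d) \<le> real (I+2) * (d * d)" using i0_le by (simp add: mult_right_mono)
      ultimately show ?thesis unfolding sum_subtractf by (simp add: algebra_simps)
    qed
    also have "\<dots> \<le> (\<Sum>j\<in>{i0..I+1}. d * (a k j * (ln (s k j) + 1) - s k j * (G k j + d)))
        + (\<Sum>j\<in>{..<i0}. d * (a k j * (ln (s k j) + 1) - s k j * (G k j + d)))"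
    proof -
      have "d * (a k j * ln (a k j / q k j)) - d * (6 * d / c' * a k j) \<le> d * (a k j * (ln (s k j) + 1) - s k j * (G k j + d))"
        if "j \<in> {i0..I+1}" for j
      proof -
        have j: "i0 \<le> j" "j \<le> I + 1" using that by auto
        have qp: "0 < q k j" using q_ge[OF k j] c' by linarith
        have sj: "s k j = a k j / q k j" using k j by (simp add: s_def)
        have "s k j * (G k j + d) = s k j * (q k j + 3 * d)" by (simp add: q_def)
        also have "\<dots> = a k j + 3 * d * (a k j / q k j)" using qp by (simp add: sj field_simps)
        also have "3 * d * (a k j / q k j) \<le> 3 * d * (a k j / (c' / 2))"
          using d(1) a_pos[OF k(2) j] q_ge[OF k j] c' qp by (intro mult_left_mono divide_left_mono mult_pos_pos) auto
        also have "3 * d * (a k j / (c' / 2)) = 6 * d / c' * a k j" by simp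
        finally have "s k j * (G k j + d) \<le> a k j + 6 * d / c' * a k j" by simp
        then have "a k j * ln (a k j / q k j) - 6 * d / c' * a k j \<le> a k j * (ln (s k j) + 1) - s k j * (G k j + d)"
          unfolding sj[symmetric] distrib_left by linarith
        then have "d * (a k j * ln (a k j / q k j) - 6 * d / c' * a k j) \<le> d * (a k j * (ln (s k j) + 1) - s k j * (G k j + d))"
          using d(1) by (intro mult_left_mono) auto
        then show ?thesis by (simp only: right_diff_distrib)
      qed
      moreover have "- (d * d) = d * (a k j * (ln (s k j) + 1) - s k j * (G k j + d))" if "j \<in> {..<i0}" for j
      proof -
        have j: "j < i0" using that by simp
        have "a k j = 0" using j by (simp add: a_def \<psi>i)
        moreover have "s k j = 1" using j by (simp add: s_def)
        moreover have "G k j = 0" using j low th_low[of j] th_low[of "j-1"] by (simp add: G_def gb_def \<alpha>_def)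
        ultimately show ?thesis by simp
      qed
      ultimately show ?thesis unfolding diff_conv_add_uminus[of "sum _ _" "sum _ _"] sum_negf[symmetric]
        by (intro add_mono sum_mono) (auto simp del: atLeastAtMost_iff)
    qed
    also have "\<dots> = (\<Sum>j\<le>I+1. d * (a k j * (ln (s k j) + 1) - s k j * (G k j + d)))"
    proof -
      have "{..I+1} = {i0..I+1} \<union> {..<i0}" using i0_le by auto
      then show ?thesis by (simp only:) (rule sum.union_disjoint[symmetric], auto)
    qed
    finally show ?thesis using 1 by linarith
  qed
  \<comment> \<open>Only the blocks after the layer are summed, and the multipliers tested against
    \<open>g\<close> there are bounded by its full cost \<open>J\<close>. The factor
    \<open>1 - \<kappa>\<close> may be dropped since \<open>J\<close> is nonnegative.\<close>
  have cost: "(\<Sum>k=R..<N. block_prob_cost k) \<le> J + \<Delta> / 4 + \<tau> * ln (1 / (c * \<tau>))"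
  proof -
    define t' where "t' k = t (R + k)" for k
    define s' where "s' k = s (R + k)" for k
    have mt: "mono t'" using d by (auto simp: mono_def t'_def t_def intro!: mult_right_mono)
    have "ereal (\<Sum>k<N-R. \<Sum>j\<le>I+1. occ_flow I g (t' k) (t' (Suc k)) j * (ln (s' k j) + 1)
      - (t' (Suc k) - t' k) * (s' k j * (g (t' k) j + (t' (Suc k) - t' k)))) \<le> occ_J I \<beta> g"
      by (rule occ_J_ge_gibbs[OF b g mt]) (use tk tN[of N] RN s_pos in \<open>auto simp: t'_def s'_def\<close>)
    then have "(\<Sum>k<N-R. \<Sum>j\<le>I+1. occ_flow I g (t (R+k)) (t (Suc (R+k))) j * (ln (s (R+k) j) + 1)
      - d * (s (R+k) j * (g (t (R+k)) j + d))) \<le> J"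
      unfolding J(1) t'_def s'_def add_Suc_right dt by simp
    moreover have "(\<Sum>k=R..<N. \<Sum>j\<le>I+1. occ_flow I g (t k) (t (Suc k)) j * (ln (s k j) + 1) - d * (s k j * (g (t k) j + d)))
      = (\<Sum>k<N-R. \<Sum>j\<le>I+1. occ_flow I g (t (R+k)) (t (Suc (R+k))) j * (ln (s (R+k) j) + 1) - d * (s (R+k) j * (g (t (R+k)) j + d)))"
      using sum.shift_bounds_nat_ivl[of "\<lambda>k. \<Sum>j\<le>I+1. occ_flow I g (t k) (t (Suc k)) j * (ln (s k j) + 1) - d * (s k j * (g (t k) j + d))" 0 R "N - R"] RN
      by (simp add: lessThan_atLeast0 add.commute del: sum.atMost_Suc)
    ultimately have SJ: "(\<Sum>k=R..<N. \<Sum>j\<le>I+1. occ_flow I g (t k) (t (Suc k)) j * (ln (s k j) + 1) - d * (s k j * (g (t k) j + d))) \<le> J" by simp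
    define E where "E = d * (6 * d / c' + real (I+2) * d) + \<kappa> * (d * ln (1 / (c * \<tau>)))"
    have "(\<Sum>k=R..<N. block_prob_cost k - E) \<le> (\<Sum>k=R..<N. (1 - \<kappa>) * (\<Sum>j\<le>I+1. occ_flow I g (t k) (t (Suc k)) j * (ln (s k j) + 1) - d * (s k j * (g (t k) j + d))))"
    proof (rule sum_mono)
      fix k assume "k \<in> {R..<N}"
      then show "block_prob_cost k - E \<le> (1 - \<kappa>) * (\<Sum>j\<le>I+1. occ_flow I g (t k) (t (Suc k)) j * (ln (s k j) + 1) - d * (s k j * (g (t k) j + d)))"
        using block[of k] unfolding E_def by simp
    qed
    also have "\<dots> \<le> (1 - \<kappa>) * J" unfolding sum_distrib_left[symmetric] using SJ \<kappa> by (intro mult_left_mono) auto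
    also have "\<dots> \<le> J" using \<kappa> J by (simp add: mult_left_le_one_le)
    finally have "(\<Sum>k=R..<N. block_prob_cost k) \<le> J + real (N - R) * E" by (simp add: sum_subtractf)
    also have "real (N - R) * E \<le> real N * E"
    proof (rule mult_right_mono)
      have "c * \<tau> \<le> 1" using c \<tau> mult_left_mono[OF \<tau>(2), of c] by linarith
      then have "0 \<le> ln (1 / (c * \<tau>))" using c \<tau> by (simp add: ln_div)
      then show "0 \<le> E" unfolding E_def using d c' \<kappa> by (intro add_nonneg_nonneg mult_nonneg_nonneg) auto
    qed (use RN in simp)
    also have "real N * E = (real N * d) * (6 * d / c' + real (I+2) * d) + \<kappa> * ((real N * d) * ln (1 / (c * \<tau>)))"
      unfolding E_def by (simp add: algebra_simps)
    also have "\<dots> = \<beta> * (6 * d / c' + real (I+2) * d) + \<tau> * ln (1 / (c * \<tau>))" unfolding Nd \<kappa>(3)[symmetric] by (simp add: mult.assoc)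
    also have "\<dots> \<le> \<Delta> / 4 + \<tau> * ln (1 / (c * \<tau>))" using d(3) by simp
    finally show ?thesis by simp
  qed
  \<comment> \<open>\<open>N0\<close> was chosen so that crossing the layer and admixing the linear
    path cost less than a quarter of \<Delta>; mesh errors and the \<eta> of all blocks take one
    further quarter each.\<close>
  have tail: "\<tau> * ln (1 / (c * \<tau>)) + \<tau> * ln (1 / q0) < \<Delta> / 4"
  proof -
    have "1 / (c * \<tau>) = real N0 * K" using c b N0 by (simp add: \<tau>_def K_def)
    moreover have "1 / q0 = 2 * real N0 ^ 2 * K"
      using c b N0 by (simp add: q0_def c'_def \<tau>_def \<kappa>_def K_def power2_eq_square)
    ultimately show ?thesis using N0(1) by (simp add: \<tau>_def)
  qed
  define \<eta> where "\<eta> = \<Delta> / (4 * real N)"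
  have \<eta>: "\<eta> > 0" using \<Delta> Npos by (simp add: \<eta>_def)
  have total: "(\<Sum>i=R..<N. block_prob_cost i + \<eta>) - real R * (\<beta> / real N) * ln q0 \<le> M"
  proof -
    have "(\<Sum>i=R..<N. \<eta>) \<le> \<Delta> / 4"
    proof -
      have "(\<Sum>i=R..<N. \<eta>) = real (N - R) * \<eta>" by simp
      also have "\<dots> \<le> real N * \<eta>" using \<eta> by (intro mult_right_mono) auto
      also have "\<dots> = \<Delta> / 4" using Npos by (simp add: \<eta>_def)
      finally show ?thesis .
    qed
    moreover have "- (real R * (\<beta> / real N) * ln q0) = \<tau> * ln (1 / q0)"
    proof -
      have "ln (1 / q0) = - ln q0" using c' by (simp add: ln_div q0_def)
      moreover have "real R * (\<beta> / real N) = \<tau>" using Rd by (simp add: d_def)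
      ultimately show ?thesis by (simp only: mult_minus_right)
    qed
    moreover have "S + E - C \<le> M" if "E \<le> \<Delta> / 4" "- C = B" "S \<le> J + \<Delta> / 4 + A" "A + B < \<Delta> / 4" for S E C A B
      using that \<Delta> \<Delta>_def by linarith
    ultimately show ?thesis using cost tail unfolding sum.distrib by blast
  qed
  have ev1: "\<forall>\<^sub>F n in sequentially. exp (- real n * ((\<Sum>i=R..<N. block_prob_cost i + \<eta>) - real R * (\<beta> / real N) * ln q0))
     \<le> measure_pmf.prob (occ_states I n (\<Gamma>0 n) (step_grid \<beta> N n N)) (target_event n N)"
    by (rule target_event_prob[OF RN order_refl \<eta>])
  have ev2: "\<forall>\<^sub>F n in sequentially. \<forall>k\<in>{..N}. \<forall>j\<in>{..I+1}. \<bar>target_state n k j - G k j\<bar> < e / 4"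
  proof (intro eventually_ball_finite ballI)
    fix k j assume kj: "k \<in> {..N}" "j \<in> {..I+1}"
    then have "(\<lambda>n. target_state n k j) \<longlonglongrightarrow> G k j" using target_state_lim[of k j] TL[of j k] by simp
    then have "\<forall>\<^sub>F n in sequentially. dist (target_state n k j) (G k j) < e / 4" by (rule tendstoD) (use e in simp)
    then show "\<forall>\<^sub>F n in sequentially. \<bar>target_state n k j - G k j\<bar> < e / 4" by (simp add: dist_real_def)
  qed auto
  have ev3: "\<forall>\<^sub>F n in sequentially. \<forall>j\<in>{..I+1}. \<bar>\<Gamma>0 n j - g 0 j\<bar> < e / 4"
  proof (intro eventually_ball_finite ballI)
    fix j
    have "\<forall>\<^sub>F n in sequentially. dist (\<Gamma>0 n j) (g 0 j) < e / 4" by (rule tendstoD[OF lim]) (use e in simp)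
    then show "\<forall>\<^sub>F n in sequentially. \<bar>\<Gamma>0 n j - g 0 j\<bar> < e / 4" by (simp add: dist_real_def)
  qed auto
  have ev4: "\<forall>\<^sub>F n in sequentially. 1 / real n < e / 4"
    by (rule order_tendstoD(2)[of _ 0]) (real_asymp, use e in simp)
  show ?thesis using ev1 ev2 ev3 ev4 eventually_gt_at_top[of 0]
  proof eventually_elim
    case (elim n)
    note n = elim(5)
    define m where "m = nat \<lfloor>real n * \<beta>\<rfloor>"
    have mN: "step_grid \<beta> N n N = m" using step_grid_last[OF Npos] by (simp add: m_def)
    have sub: "target_event n N \<inter> set_pmf (occ_states I n (\<Gamma>0 n) m) \<subseteq> occ_path \<beta> n -` {h. sup_close I \<beta> e g h}"
    proof
      fix xs assume xs: "xs \<in> target_event n N \<inter> set_pmf (occ_states I n (\<Gamma>0 n) m)"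
      then have tr: "occ_traj I n (\<Gamma>0 n) m xs" using occ_states_traj[OF n lat[OF n]] by blast
      let ?p = "occ_path \<beta> n xs"
      have pa: "?p \<in> admissible_paths I \<beta> (1 / real n)" using occ_path_adm[OF n b] tr by (simp add: m_def)
      have n0: "0 \<le> 1 / real n" by simp
      have "sup_close I \<beta> e g ?p"
        unfolding sup_close_def
      proof (intro ballI allI impI)
        fix x j assume x: "x \<in> {0..\<beta>}" and j: "j \<le> I + 1"
        \<comment> \<open>Before \<tau> no intermediate state is prescribed, but both paths stay
          near their starting points; afterwards they are compared at the preceding grid
          time.\<close>
        show "\<bar>g x j - ?p x j\<bar> \<le> e"
        proof (cases "x < \<tau>")
          case True
          have p0: "?p 0 = \<Gamma>0 n" using tr b by (simp add: occ_path_def occ_traj_def)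
          have "\<bar>?p x j - ?p 0 j\<bar> \<le> x - 0 + 1 / real n" by (rule adm_near_Lipschitz[OF pa]) (use x in auto)
          moreover have "\<bar>\<Gamma>0 n j - g 0 j\<bar> < e / 4" using elim(3) j by auto
          moreover have "\<bar>g x j - g 0 j\<bar> \<le> \<bar>x - 0\<bar>" by (rule adm_0_Lipschitz[OF g b0])
          moreover have "0 \<le> x" using x by simp
          ultimately show ?thesis using True \<tau>(3) elim(4) unfolding p0 by linarith
        next
          case False
          define k where "k = nat \<lfloor>x / d\<rfloor>"
          have fl: "real k = of_int \<lfloor>x / d\<rfloor>" using x d by (simp add: k_def)
          have "real k \<le> x / d" "x / d < real k + 1" using fl by linarith+
          then have kx: "t k \<le> x" "x < t k + d" using d(1) by (simp_all add: t_def pos_le_divide_eq pos_divide_less_eq distrib_right)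
          have "x / d \<le> real N" using x d(1) Nd by (simp add: pos_divide_le_eq)
          then have kN: "k \<le> N" using \<open>real k \<le> x / d\<close> by linarith
          have "real R \<le> x / d" using False Rd d(1) by (simp add: pos_le_divide_eq)
          then have kR: "R \<le> k" using fl \<open>x / d < real k + 1\<close> by linarith
          have pk: "?p (t k) = target_state n k"
            using occ_path_grid[OF b Npos kN, of n xs] xs kR kN by (simp add: target_event_def t_def d_def)
          have "\<bar>?p x j - ?p (t k) j\<bar> \<le> x - t k + 1 / real n" by (rule adm_near_Lipschitz[OF pa]) (use x kx tk in auto)
          moreover have "\<bar>target_state n k j - G k j\<bar> < e / 4" using elim(2) kN j by auto
          \<comment> \<open>The mixture deviates from \<open>g\<close> by \<kappa> times a distance
            of at most \<open>2 * \<beta>\<close>.\<close>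
          moreover have "\<bar>G k j - g (t k) j\<bar> \<le> 2 * \<tau>"
          proof -
            have "G k j - g (t k) j = \<kappa> * (gb (t k) j - g (t k) j)" by (simp add: G_def algebra_simps)
            moreover have "\<bar>gb (t k) j - g (t k) j\<bar> \<le> 2 * \<beta>" using gb_close[OF tk tN[OF kN] j] tN[OF kN] by linarith
            ultimately have "\<bar>G k j - g (t k) j\<bar> \<le> \<kappa> * (2 * \<beta>)" using \<kappa>(1) by (simp add: abs_mult mult_left_mono)
            also have "\<dots> = 2 * \<tau>" using \<kappa>(3) by simp
            finally show ?thesis .
          qed
          moreover have "\<bar>g x j - g (t k) j\<bar> \<le> \<bar>x - t k\<bar>" by (rule adm_0_Lipschitz[OF g b0])
          ultimately show ?thesis using kx d\<tau> \<tau>(3) elim(4) unfolding pk by linarith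
        qed
      qed
      then show "xs \<in> occ_path \<beta> n -` {h. sup_close I \<beta> e g h}" by simp
    qed
    have "exp (- real n * M) \<le> exp (- real n * ((\<Sum>i=R..<N. block_prob_cost i + \<eta>) - real R * (\<beta> / real N) * ln q0))"
      using total by (subst exp_le_cancel_iff) (simp add: mult_left_mono)
    also have "\<dots> \<le> measure_pmf.prob (occ_states I n (\<Gamma>0 n) m) (target_event n N)" using elim(1) unfolding mN .
    also have "\<dots> = measure_pmf.prob (occ_states I n (\<Gamma>0 n) m) (target_event n N \<inter> set_pmf (occ_states I n (\<Gamma>0 n) m))"
      by (simp add: measure_Int_set_pmf)
    also have "\<dots> \<le> measure_pmf.prob (occ_states I n (\<Gamma>0 n) m) (occ_path \<beta> n -` {h. sup_close I \<beta> e g h})"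
      by (rule measure_pmf.finite_measure_mono[OF sub]) simp
    also have "\<dots> = occ_prob I \<beta> n (\<Gamma>0 n) {h. sup_close I \<beta> e g h}"
      by (simp add: occ_prob_def occ_law_def m_def)
    finally show ?case .
  qed
qed

section \<open>The large deviation principle\<close>

lemma ereal_uminus_le_swap: "- a \<le> b \<Longrightarrow> - b \<le> (a::ereal)"
  by (metis ereal_minus_le_minus ereal_uminus_uminus)

lemma ereal_le_uminus_swap: "a \<le> - b \<Longrightarrow> b \<le> - (a::ereal)"
  by (metis ereal_minus_le_minus ereal_uminus_uminus)

text \<open>The inclusion need hold only on the support of the law, whose members are admissible
  with slack \<open>1/n\<close>, are right-continuous with left limits, and start at
  \<open>g0\<close>.\<close>

lemma occ_prob_mono:
  assumes n: "n > 0" and b: "\<beta> > 0" and g0: "g0 \<in> occ_lattice I n"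
    and S: "\<And>h. h \<in> admissible_paths I \<beta> (1 / real n) \<Longrightarrow> h \<in> Dsp I \<beta> \<Longrightarrow> h 0 = g0 \<Longrightarrow> h \<in> S \<Longrightarrow> h \<in> S'"
  shows "occ_prob I \<beta> n g0 S \<le> occ_prob I \<beta> n g0 S'"
proof -
  have "S \<inter> set_pmf (occ_law I \<beta> n g0) \<subseteq> S'"
  proof
    fix h assume h: "h \<in> S \<inter> set_pmf (occ_law I \<beta> n g0)"
    then obtain xs where xs: "xs \<in> set_pmf (occ_states I n g0 (nat \<lfloor>real n * \<beta>\<rfloor>))" "h = occ_path \<beta> n xs"
      by (auto simp: occ_law_def)
    have t: "occ_traj I n g0 (nat \<lfloor>real n * \<beta>\<rfloor>) xs" by (rule occ_states_traj[OF n g0 xs(1)])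
    have "h 0 = g0" using t b by (simp add: xs(2) occ_path_def occ_traj_def)
    then show "h \<in> S'" using S occ_path_adm[OF n b t] occ_path_Dsp[OF n b t] h unfolding xs(2) by blast
  qed
  then have "measure_pmf.prob (occ_law I \<beta> n g0) (S \<inter> set_pmf (occ_law I \<beta> n g0)) \<le> measure_pmf.prob (occ_law I \<beta> n g0) S'"
    by (rule measure_pmf.finite_measure_mono) simp
  then show ?thesis by (simp add: occ_prob_def measure_Int_set_pmf)
qed

lemma scaled_elog_ge:
  assumes "n > 0" "exp (- real n * M) \<le> p"
  shows "ereal (- M) \<le> ereal (1 / real n) * elog p"
proof -
  have "0 < p" using assms(2) exp_gt_zero less_le_trans by blast
  then have "- real n * M \<le> ln p" using assms(2) by (simp add: ln_ge_iff)
  then have "- M \<le> 1 / real n * ln p" using assms(1) by (simp add: field_simps)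
  then show ?thesis using \<open>0 < p\<close> by (simp add: elog_def)
qed

lemma scaled_elog_le:
  assumes "n > 0" "p \<le> exp (- real n * M)" "0 \<le> p"
  shows "ereal (1 / real n) * elog p \<le> ereal (- M)"
proof (cases "p = 0")
  case True
  then show ?thesis using assms(1) by (simp add: elog_def)
next
  case False
  then have "0 < p" using assms(3) by simp
  then have "ln p \<le> - real n * M" using assms(2) by (metis ln_exp ln_le_cancel_iff exp_gt_zero)
  then have "1 / real n * ln p \<le> - M" using assms(1) by (simp add: field_simps)
  then show ?thesis using \<open>0 < p\<close> by (simp add: elog_def)
qed

text \<open>An interior point comes with a uniform ball inside \<open>A\<close>, so the local lower
  bound at each path of finite cost suffices.\<close>

lemma occ_ldp_lower:
  assumes b: "\<beta> > 0" and lat: "\<And>n. n > 0 \<Longrightarrow> \<Gamma>0 n \<in> occ_lattice I n"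
    and lim: "\<And>j. (\<lambda>n. \<Gamma>0 n j) \<longlonglongrightarrow> \<alpha> j"
  shows "- (INF g\<in>{g\<in>skor_interior I \<beta> A. g 0 = \<alpha>}. occ_J I \<beta> g)
    \<le> liminf (\<lambda>n. ereal (1 / real n) * elog (occ_prob I \<beta> n (\<Gamma>0 n) A))" (is "_ \<le> ?L")
proof -
  have "- ?L \<le> (INF g\<in>{g\<in>skor_interior I \<beta> A. g 0 = \<alpha>}. occ_J I \<beta> g)"
  proof (rule INF_greatest)
    fix g assume "g \<in> {g\<in>skor_interior I \<beta> A. g 0 = \<alpha>}"
    then have g: "g \<in> skor_interior I \<beta> A" "g 0 = \<alpha>" by auto
    show "- ?L \<le> occ_J I \<beta> g"
    proof (rule dense_ge)
      fix z assume z: "occ_J I \<beta> g < z"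
      show "- ?L \<le> z"
      proof (cases z)
        case (real M)
        have "occ_J I \<beta> g \<noteq> \<infinity>" using z by auto
        then have ga: "g \<in> admissible_paths I \<beta> 0" by (rule occ_J_finite_adm[OF b])
        obtain e where e: "e > 0" "\<forall>h\<in>Dsp I \<beta>. sup_close I \<beta> e g h \<longrightarrow> h \<in> A"
          using skor_interior_sup_close[OF less_imp_le[OF b] g(1)] by blast
        have "\<forall>\<^sub>F n in sequentially. exp (- real n * M) \<le> occ_prob I \<beta> n (\<Gamma>0 n) {h. sup_close I \<beta> e g h}"
          by (rule occ_prob_local_lower[OF b lat _ ga _ e(1)]) (use lim g(2) z real in auto)
        then have "\<forall>\<^sub>F n in sequentially. ereal (- M) \<le> ereal (1 / real n) * elog (occ_prob I \<beta> n (\<Gamma>0 n) A)"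
          using eventually_gt_at_top[of 0]
        proof eventually_elim
          case (elim n)
          have "occ_prob I \<beta> n (\<Gamma>0 n) {h. sup_close I \<beta> e g h} \<le> occ_prob I \<beta> n (\<Gamma>0 n) A"
            by (rule occ_prob_mono[OF elim(2) b lat[OF elim(2)]]) (use e(2) in auto)
          then show ?case using elim by (intro scaled_elog_ge) auto
        qed
        then have "ereal (- M) \<le> ?L" by (rule Liminf_bounded)
        then show ?thesis using real ereal_uminus_le_swap[of "ereal M" ?L] by simp
      next
        case MInf
        then show ?thesis using z by simp
      qed simp
    qed
  qed
  then show ?thesis by (rule ereal_uminus_le_swap)
qed

text \<open>A path that is not admissible, starts elsewhere, or lies outside the closure of
  \<open>A\<close> has a neighbourhood that contributes nothing for large \<open>n\<close>. Every
  other path has cost above \<open>M\<close>, and the local upper bound applies.\<close>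

lemma occ_ldp_upper_nhd:
  assumes b: "\<beta> > 0" and lat: "\<And>n. n > 0 \<Longrightarrow> \<Gamma>0 n \<in> occ_lattice I n"
    and lim: "\<And>j. (\<lambda>n. \<Gamma>0 n j) \<longlonglongrightarrow> \<alpha> j"
    and M: "ereal M < (INF g\<in>{g\<in>skor_closure I \<beta> A. g 0 = \<alpha>}. occ_J I \<beta> g)"
  shows "\<exists>W. open W \<and> g \<in> W \<and> (\<forall>\<^sub>F n in sequentially. occ_prob I \<beta> n (\<Gamma>0 n) (W \<inter> A) \<le> exp (- real n * M))"
proof -
  have nul: "occ_prob I \<beta> n (\<Gamma>0 n) S \<le> exp (- real n * M)"
    if "n > 0" "\<And>h. h \<in> admissible_paths I \<beta> (1 / real n) \<Longrightarrow> h \<in> Dsp I \<beta> \<Longrightarrow> h 0 = \<Gamma>0 n \<Longrightarrow> h \<notin> S" for n S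
  proof -
    have "occ_prob I \<beta> n (\<Gamma>0 n) S \<le> occ_prob I \<beta> n (\<Gamma>0 n) {}"
      by (rule occ_prob_mono[OF that(1) b lat[OF that(1)]]) (use that(2) in blast)
    also have "\<dots> = 0" by (simp add: occ_prob_def)
    finally show ?thesis by (rule order_trans) simp
  qed
  have small: "\<forall>\<^sub>F n in sequentially. n > 0 \<and> 1 / real n \<le> c" if "c > 0" for c
  proof -
    have "\<forall>\<^sub>F n in sequentially. 1 / real n < c"
      by (rule order_tendstoD(2)[of _ 0]) (real_asymp, use that in simp)
    then show ?thesis using eventually_gt_at_top[of 0] by eventually_elim auto
  qed
  consider (bad) "g \<notin> admissible_paths I \<beta> 0" | (init) "g \<in> admissible_paths I \<beta> 0" "g 0 \<noteq> \<alpha>"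
    | (off) "g \<in> admissible_paths I \<beta> 0" "g 0 = \<alpha>" "g \<notin> skor_closure I \<beta> A"
    | (on) "g \<in> admissible_paths I \<beta> 0" "g 0 = \<alpha>" "g \<in> skor_closure I \<beta> A" by blast
  then show ?thesis
  proof cases
    case bad
    then obtain c where c: "c > 0" "g \<notin> admissible_paths I \<beta> c" using adm_0_if by blast
    have "\<forall>\<^sub>F n in sequentially. occ_prob I \<beta> n (\<Gamma>0 n) (- admissible_paths I \<beta> c \<inter> A) \<le> exp (- real n * M)"
      using small[OF c(1)]
    proof eventually_elim
      case (elim n)
      show ?case
      proof (rule nul)
        fix h assume "h \<in> admissible_paths I \<beta> (1 / real n)"
        then have "h \<in> admissible_paths I \<beta> c" using adm_mono[of "1 / real n" c I \<beta>] elim by (meson subsetD)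
        then show "h \<notin> - admissible_paths I \<beta> c \<inter> A" by simp
      qed (use elim in simp)
    qed
    then show ?thesis using c(2) closed_adm by (intro exI[of _ "- admissible_paths I \<beta> c"]) auto
  next
    case init
    then obtain j where j: "g 0 j \<noteq> \<alpha> j" by (auto simp: fun_eq_iff)
    define r where "r = \<bar>g 0 j - \<alpha> j\<bar> / 2"
    have r: "r > 0" using j by (simp add: r_def)
    define W where "W = {h :: real \<Rightarrow> nat \<Rightarrow> real. r < \<bar>h 0 j - \<alpha> j\<bar>}"
    have "open W" unfolding W_def by (intro open_Collect_less continuous_intros)
    moreover have "g \<in> W" using r by (simp add: W_def r_def)
    moreover have "\<forall>\<^sub>F n in sequentially. dist (\<Gamma>0 n j) (\<alpha> j) < r" by (rule tendstoD[OF lim r])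
    then have "\<forall>\<^sub>F n in sequentially. occ_prob I \<beta> n (\<Gamma>0 n) (W \<inter> A) \<le> exp (- real n * M)"
      using eventually_gt_at_top[of 0]
    proof eventually_elim
      case (elim n)
      show ?case by (rule nul[OF elim(2)]) (use elim(1) in \<open>auto simp: W_def dist_real_def\<close>)
    qed
    ultimately show ?thesis by blast
  next
    case off
    obtain e where e: "e > 0" "\<forall>h\<in>Dsp I \<beta>. sup_close I \<beta> e g h \<longrightarrow> h \<notin> A"
      using skor_closure_sup_close[OF less_imp_le[OF b] adm_0_Dsp[OF off(1) less_imp_le[OF b]] off(3)] by blast
    obtain W c where W: "open W" "g \<in> W" "c > 0"
      "\<forall>h c'. h \<in> W \<longrightarrow> h \<in> admissible_paths I \<beta> c' \<longrightarrow> 0 \<le> c' \<longrightarrow> c' \<le> c \<longrightarrow> sup_close I \<beta> e g h"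
      using adm_0_nhd[OF b off(1) e(1)] by blast
    have "\<forall>\<^sub>F n in sequentially. occ_prob I \<beta> n (\<Gamma>0 n) (W \<inter> A) \<le> exp (- real n * M)"
      using small[OF W(3)]
    proof eventually_elim
      case (elim n)
      have "0 \<le> 1 / real n" by simp
      then have "h \<notin> W \<inter> A" if "h \<in> admissible_paths I \<beta> (1 / real n)" "h \<in> Dsp I \<beta>" for h
        using that elim W(4) e(2) by (meson IntD1 IntD2)
      then show ?case by (intro nul) (use elim in auto)
    qed
    then show ?thesis using W by blast
  next
    case on
    have "ereal M < occ_J I \<beta> g"
      using M by (rule less_le_trans) (use on in \<open>auto intro: INF_lower\<close>)
    then obtain e n0 where e: "e > 0" "\<forall>n\<ge>n0. \<forall>g0\<in>occ_lattice I n. occ_prob I \<beta> n g0 {h. sup_close I \<beta> e g h} \<le> exp (- real n * M)"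
      using occ_prob_local_upper[OF b on(1)] by blast
    obtain W c where W: "open W" "g \<in> W" "c > 0"
      "\<forall>h c'. h \<in> W \<longrightarrow> h \<in> admissible_paths I \<beta> c' \<longrightarrow> 0 \<le> c' \<longrightarrow> c' \<le> c \<longrightarrow> sup_close I \<beta> e g h"
      using adm_0_nhd[OF b on(1) e(1)] by blast
    have "\<forall>\<^sub>F n in sequentially. occ_prob I \<beta> n (\<Gamma>0 n) (W \<inter> A) \<le> exp (- real n * M)"
      using small[OF W(3)] eventually_ge_at_top[of n0]
    proof eventually_elim
      case (elim n)
      have n: "n > 0" using elim by simp
      have "0 \<le> 1 / real n" by simp
      then have "occ_prob I \<beta> n (\<Gamma>0 n) (W \<inter> A) \<le> occ_prob I \<beta> n (\<Gamma>0 n) {h. sup_close I \<beta> e g h}"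
        using elim W(4) by (intro occ_prob_mono[OF n b lat[OF n]]) blast
      also have "\<dots> \<le> exp (- real n * M)" using e(2) elim(2) lat[OF n] by blast
      finally show ?case .
    qed
    then show ?thesis using W by blast
  qed
qed

text \<open>As \<open>1/n <= 1\<close>, every sample path lies in the compact set
  \<open>admissible_paths I \<beta> 1\<close>, so finitely many of the local neighbourhoods cover
  all that can happen.\<close>

lemma occ_ldp_upper:
  assumes b: "\<beta> > 0" and lat: "\<And>n. n > 0 \<Longrightarrow> \<Gamma>0 n \<in> occ_lattice I n"
    and lim: "\<And>j. (\<lambda>n. \<Gamma>0 n j) \<longlonglongrightarrow> \<alpha> j"
  shows "limsup (\<lambda>n. ereal (1 / real n) * elog (occ_prob I \<beta> n (\<Gamma>0 n) A))
    \<le> - (INF g\<in>{g\<in>skor_closure I \<beta> A. g 0 = \<alpha>}. occ_J I \<beta> g)" (is "?L \<le> - ?C")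
proof -
  have "?C \<le> - ?L"
  proof (rule dense_le)
    fix z assume z: "z < ?C"
    show "z \<le> - ?L"
    proof (cases z)
      case (real M)
      then obtain M' where M': "ereal M < ereal M'" "ereal M' < ?C" using z ereal_dense2 by blast
      have "\<forall>g\<in>admissible_paths I \<beta> 1. \<exists>W. open W \<and> g \<in> W \<and> (\<forall>\<^sub>F n in sequentially. occ_prob I \<beta> n (\<Gamma>0 n) (W \<inter> A) \<le> exp (- real n * M'))"
        using occ_ldp_upper_nhd[OF b lat lim M'(2)] by blast
      from bchoice[OF this] obtain W where W: "\<forall>g\<in>admissible_paths I \<beta> 1. open (W g) \<and> g \<in> W g \<and>
        (\<forall>\<^sub>F n in sequentially. occ_prob I \<beta> n (\<Gamma>0 n) (W g \<inter> A) \<le> exp (- real n * M'))" ..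
      obtain D where D: "D \<subseteq> admissible_paths I \<beta> 1" "finite D" "admissible_paths I \<beta> 1 \<subseteq> (\<Union>g\<in>D. W g)"
      proof (rule compactE_image[OF compact_adm, of "admissible_paths I \<beta> 1" W I \<beta> 1])
        show "open (W g)" if "g \<in> admissible_paths I \<beta> 1" for g using W that by blast
        show "admissible_paths I \<beta> 1 \<subseteq> (\<Union>g\<in>admissible_paths I \<beta> 1. W g)" using W by blast
      qed blast
      have ev1: "\<forall>\<^sub>F n in sequentially. \<forall>g\<in>D. occ_prob I \<beta> n (\<Gamma>0 n) (W g \<inter> A) \<le> exp (- real n * M')"
        by (rule eventually_ball_finite[OF D(2)]) (use W D(1) in blast)
      \<comment> \<open>The number of covering sets is absorbed by the gap between \<open>M\<close>
        and \<open>M'\<close>.\<close>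
      define K where "K = real (card D) + 1"
      have "(\<lambda>n. K * exp (- real n * (M' - M))) \<longlonglongrightarrow> 0"
      proof -
        have "M' - M > 0" using M' by simp
        then show ?thesis by real_asymp
      qed
      then have ev2: "\<forall>\<^sub>F n in sequentially. K * exp (- real n * (M' - M)) < 1" by (rule order_tendstoD(2)) simp
      have "\<forall>\<^sub>F n in sequentially. ereal (1 / real n) * elog (occ_prob I \<beta> n (\<Gamma>0 n) A) \<le> ereal (- M)"
        using ev1 ev2 eventually_gt_at_top[of 0]
      proof eventually_elim
        case (elim n)
        note n = elim(3)
        have "occ_prob I \<beta> n (\<Gamma>0 n) A \<le> occ_prob I \<beta> n (\<Gamma>0 n) (\<Union>g\<in>D. W g \<inter> A)"
        proof (rule occ_prob_mono[OF n b lat[OF n]])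
          fix h assume h: "h \<in> admissible_paths I \<beta> (1 / real n)" "h \<in> A"
          have "1 / real n \<le> 1" using n by simp
          then have "h \<in> admissible_paths I \<beta> 1" using h(1) adm_mono by blast
          then show "h \<in> (\<Union>g\<in>D. W g \<inter> A)" using D(3) h(2) by blast
        qed
        also have "\<dots> \<le> (\<Sum>g\<in>D. occ_prob I \<beta> n (\<Gamma>0 n) (W g \<inter> A))"
          unfolding occ_prob_def by (rule measure_pmf.finite_measure_subadditive_finite[OF D(2)]) simp
        also have "\<dots> \<le> (\<Sum>g\<in>D. exp (- real n * M'))" by (rule sum_mono) (use elim(1) in blast)
        also have "\<dots> \<le> K * exp (- real n * M')" by (simp add: K_def distrib_right)
        also have "\<dots> = (K * exp (- real n * (M' - M))) * exp (- real n * M)"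
          by (simp add: mult.assoc exp_add[symmetric] algebra_simps)
        also have "\<dots> \<le> 1 * exp (- real n * M)" using elim(2) by (intro mult_right_mono) auto
        finally show ?case by (intro scaled_elog_le[OF n]) (auto simp: occ_prob_def)
      qed
      then have "?L \<le> ereal (- M)" by (rule Limsup_bounded)
      then show ?thesis using real ereal_le_uminus_swap[of ?L "ereal M"] by simp
    next
      case PInf
      then show ?thesis using z by simp
    qed simp
  qed
  then show ?thesis by (rule ereal_le_uminus_swap)
qed

theorem theorem2p2:
  fixes I :: nat and \<beta> :: real and \<Gamma>0 :: "nat \<Rightarrow> nat \<Rightarrow> real" and \<alpha> :: "nat \<Rightarrow> real"
  assumes "\<beta> > 0"
    and "\<forall>n\<ge>1. \<Gamma>0 n \<in> occ_simplex I \<and> (\<forall>j. \<exists>k::nat. real n * \<Gamma>0 n j = real k)"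
    and "\<alpha> \<in> occ_simplex I"
    and "\<Gamma>0 \<longlonglongrightarrow> \<alpha>"
  shows "(\<forall>A\<in>skor_borel I \<beta>.
            liminf (\<lambda>n. ereal (1 / real n) * elog (occ_prob I \<beta> n (\<Gamma>0 n) A))
              \<ge> - (INF g\<in>{g\<in>skor_interior I \<beta> A. g 0 = \<alpha>}. occ_J I \<beta> g)
          \<and> limsup (\<lambda>n. ereal (1 / real n) * elog (occ_prob I \<beta> n (\<Gamma>0 n) A))
              \<le> - (INF g\<in>{g\<in>skor_closure I \<beta> A. g 0 = \<alpha>}. occ_J I \<beta> g))
       \<and> (\<forall>K (C::real). compact K \<and> K \<subseteq> occ_simplex I \<longrightarrow>
            skor_compact I \<beta> {g. occ_J I \<beta> g \<le> ereal C \<and> g 0 \<in> K})"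
proof -
  have lat: "\<Gamma>0 n \<in> occ_lattice I n" if "n > 0" for n
    using assms(2) that by (auto simp: occ_lattice_def)
  have lim: "(\<lambda>n. \<Gamma>0 n j) \<longlonglongrightarrow> \<alpha> j" for j
    using assms(4) by (simp add: tendsto_fun_componentwise)
  show ?thesis
    using occ_ldp_lower[of \<beta> \<Gamma>0 I \<alpha>, OF assms(1) lat lim] occ_ldp_upper[of \<beta> \<Gamma>0 I \<alpha>, OF assms(1) lat lim]
      occ_J_levelset_skor_compact[OF assms(1)] by blast
qed

end
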